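(* Let $m,n,p,q,s,t,u,v\in\mathbb{Z}$, let $H$ be a BiHom-bialgebra over a field $\Bbbk$, and let $(H,D)$ be a BiHom-L-R-$\binom{m,n,p,q}{s,t,u,v}$-admissible pair. Then the vector space $D\natural H:=D\otimes H$ (write $d\natural h:=d\otimes h$), equipped with the multiplication $$(a\natural h)(b\natural g)=\big(\alpha_D^{-1}(a)\triangleleft \alpha^{m}\psi^{n}(g_2)\big)\big(\beta^{p}\omega^{q}(h_1)\triangleright\beta_D^{-1}(b)\big)\natural\, \psi^{-1}(h_2)\,\omega^{-1}(g_1),$$ unit $1_D\natural1_H$, the comultiplication $$\Delta(c\natural h)=\big(\omega_D^{-1}(c_{1(0)})\natural\,\alpha^{s}\psi^{t}(c_{2[-1]})\,\beta^{-1}(h_1)\big)\otimes\big(\psi_D^{-1}(c_{2[0]})\natural\,\alpha^{-1}(h_2)\,\beta^{u}\omega^{v}(c_{1(1)})\big),$$ counit $\varepsilon_D\otimes\varepsilon_H$, and structure maps $\alpha_D\otimes\alpha$, $\beta_D\otimes\beta$, $\omega_D\otimes\omega$, $\psi_D\otimes\psi$, is a BiHom-bialgebra.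
   Context: All spaces are over a field $\Bbbk$; $\Delta(h)=h_1\otimes h_2$ (summation suppressed). BiHom-algebra $(A,\mu,1_A,\alpha_A,\beta_A)$: a vector space with $\mu(a\otimes b)=ab$, an element $1_A$, and commuting linear isomorphisms $\alpha_A,\beta_A$ that are multiplicative and fix $1_A$, with $a1_A=\alpha_A(a)$, $1_Aa=\beta_A(a)$, $\alpha_A(a)(bc)=(ab)\beta_A(c)$. A BiHom-algebra map commutes with $\alpha,\beta$ and preserves products and units. BiHom-coalgebra $(C,\Delta,\varepsilon,\omega_C,\psi_C)$: commuting linear isomorphisms $\omega_C,\psi_C$ with $\varepsilon\omega_C=\varepsilon\psi_C=\varepsilon$, $\Delta\omega_C=(\omega_C\otimes\omega_C)\Delta$, $\Delta\psi_C=(\psi_C\otimes\psi_C)\Delta$, $c_1\varepsilon(c_2)=\omega_C(c)$, $\varepsilon(c_1)c_2=\psi_C(c)$, $\omega_C(c_1)\otimes\Delta(c_2)=\Delta(c_1)\otimes\psi_C(c_2)$. A BiHom-coalgebra map commutes with $\omega,\psi$ and preserves $\Delta$ and $\varepsilon$. BiHom-bialgebra $(H,\mu,1,\Delta,\varepsilon,\alpha,\beta,\omega,\psi)$: $(H,\mu,1,\alpha,\beta)$ is a BiHom-algebra, $(H,\Delta,\varepsilon,\omega,\psi)$ is a BiHom-coalgebra, $\Delta(hg)=h_1g_1\otimes h_2g_2$, $\varepsilon(hg)=\varepsilon(h)\varepsilon(g)$, $\Delta(1)=1\otimes1$, $\varepsilon(1)=1$, $\alpha,\beta$ are BiHom-coalgebra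 maps, $\omega,\psi$ are BiHom-algebra maps, and $\alpha,\beta,\omega,\psi$ commute with each other. Left $H$-module $(M,\triangleright,\alpha_M,\beta_M,\omega_M,\psi_M)$: $\alpha_M,\beta_M,\omega_M,\psi_M$ are mutually commuting linear automorphisms, $\theta_M(h\triangleright m)=\theta(h)\triangleright\theta_M(m)$ for $\theta\in\{\alpha,\beta,\omega,\psi\}$, $\alpha(h)\triangleright(g\triangleright m)=(hg)\triangleright\beta_M(m)$, $1_H\triangleright m=\beta_M(m)$. Right $H$-module: symmetrically, $\theta_M(m\triangleleft h)=\theta_M(m)\triangleleft\theta(h)$, $(m\triangleleft h)\triangleleft\beta(g)=\alpha_M(m)\triangleleft(hg)$, $m\triangleleft1_H=\alpha_M(m)$. $H$-bimodule: a left and right $H$-module with $\alpha(a)\triangleright(m\triangleleft b)=(a\triangleright m)\triangleleft\beta(b)$. $H$-bimodule BiHom-algebra $D$: a BiHom-algebra which is an $H$-bimodule (with structure automorphisms $\alpha_D,\beta_D,\omega_D,\psi_D$) such that $h\triangleright(ab)=(\alpha^{-1}\omega^{-1}(h_1)\triangleright a)(\beta^{-1}\psi^{-1}(h_2)\triangleright b)$, $h\triangleright1_D=\varepsilon(h)1_D$, $(ab)\triangleleft h=(a\triangleleft\alpha^{-1}\omega^{-1}(h_1))(b\triangleleft\beta^{-1}\psi^{-1}(h_2))$, $1_D\triangleleft h=\varepsilon(h)1_D$. Right $H$-comodule, $\rho_R(m)=m_{(0)}\otimes m_{(1)}\in M\otimes H$: with mutually commuting linear automorphisms $\alpha_M,\beta_M,\omega_M,\psi_M$,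 $(\theta_M\otimes\theta)\rho_R=\rho_R\theta_M$ for $\theta\in\{\alpha,\beta,\omega,\psi\}$, $\omega_M(m_{(0)})\otimes m_{(1)1}\otimes m_{(1)2}=m_{(0)(0)}\otimes m_{(0)(1)}\otimes\psi(m_{(1)})$, $m_{(0)}\varepsilon(m_{(1)})=\omega_M(m)$. Left $H$-comodule, $\rho_L(m)=m_{[-1]}\otimes m_{[0]}\in H\otimes M$: symmetrically, $(\theta\otimes\theta_M)\rho_L=\rho_L\theta_M$, $m_{[-1]1}\otimes m_{[-1]2}\otimes\psi_M(m_{[0]})=\omega(m_{[-1]})\otimes m_{[0][-1]}\otimes m_{[0][0]}$, $\varepsilon(m_{[-1]})m_{[0]}=\psi_M(m)$. $H$-bicomodule: both, with $\omega(m_{[-1]})\otimes m_{[0](0)}\otimes m_{[0](1)}=m_{(0)[-1]}\otimes m_{(0)[0]}\otimes\psi(m_{(1)})$. $H$-bicomodule BiHom-coalgebra $D$: a BiHom-coalgebra which is an $H$-bicomodule (with structure automorphisms $\alpha_D,\beta_D,\omega_D,\psi_D$) such that $c_{[-1]}\otimes c_{[0]1}\otimes c_{[0]2}=\alpha^{-1}\omega^{-1}(c_{1[-1]})\beta^{-1}\psi^{-1}(c_{2[-1]})\otimes c_{1[0]}\otimes c_{2[0]}$, $c_{[-1]}\varepsilon_D(c_{[0]})=\varepsilon_D(c)1_H$, $c_{(0)1}\otimes c_{(0)2}\otimes c_{(1)}=c_{1(0)}\otimes c_{2(0)}\otimes\alpha^{-1}\omega^{-1}(c_{1(1)})\beta^{-1}\psi^{-1}(c_{2(1)})$,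 $\varepsilon_D(c_{(0)})c_{(1)}=\varepsilon_D(c)1_H$. BiHom-L-R-$\binom{m,n,p,q}{s,t,u,v}$-admissible pair $(H,D)$: $D$ is an $H$-bimodule BiHom-algebra and an $H$-bicomodule BiHom-coalgebra, with linear automorphisms $\alpha_D,\beta_D,\omega_D,\psi_D$ that commute with each other, $\alpha_D,\beta_D$ BiHom-coalgebra maps, $\omega_D,\psi_D$ BiHom-algebra maps, and for all $h,g\in H$, $a,b\in D$: (1) $\varepsilon_D(1_D)=1$, $\varepsilon_D(ab)=\varepsilon_D(a)\varepsilon_D(b)$; (2) $\varepsilon_D(h\triangleright a)=\varepsilon_D(a\triangleleft h)=\varepsilon_H(h)\varepsilon_D(a)$; (3) $\rho_R(1_D)=1_D\otimes1_H$, $\rho_L(1_D)=1_H\otimes1_D$; (4) $\rho_R(ab)=a_{(0)}b_{(0)}\otimes a_{(1)}b_{(1)}$, $\rho_L(ab)=a_{[-1]}b_{[-1]}\otimes a_{[0]}b_{[0]}$; (5) $\Delta_D(1_D)=1_D\otimes1_D$; (6) $\Delta_D(h\triangleright a)=h_1\triangleright a_1\otimes h_2\triangleright a_2$, $\Delta_D(a\triangleleft h)=a_1\triangleleft h_1\otimes a_2\triangleleft h_2$; (7) $\Delta_D(ab)=a_1\big(\alpha^{s+1}\beta^{p}\omega^{q+1}\psi^{t}(a_{2[-1]})\triangleright\beta_D^{-1}\omega_D^{-1}(b_{1(0)})\big)\otimes\big(\alpha_D^{-1}\psi_D^{-1}(a_{2[0]})\triangleleft\alpha^{m}\beta^{u+1}\omega^{v}\psi^{n+1}(b_{1(1)})\big)b_2$;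 (8) $(\alpha^{s}\beta^{p+1}\omega^{q}\psi^{t+1}(h_1)\triangleright b)_{[-1]}\,\alpha\beta^{-1}\psi^{-1}\omega(h_2)\otimes(\alpha^{s}\beta^{p+1}\omega^{q}\psi^{t+1}(h_1)\triangleright b)_{[0]}=h_1\alpha(b_{[-1]})\otimes\alpha^{s}\beta^{p+1}\omega^{q+1}\psi^{t+1}(h_2)\triangleright b_{[0]}$; (9) $(h\triangleright b)_{(0)}\otimes(h\triangleright b)_{(1)}=\omega(h)\triangleright b_{(0)}\otimes\beta(b_{(1)})$; (10) $[a\triangleleft\alpha^{m+1}\beta^{u}\omega^{v+1}\psi^{n}(g_2)]_{(0)}\otimes\alpha^{-1}\beta\psi\omega^{-1}(g_1)[a\triangleleft\alpha^{m+1}\beta^{u}\omega^{v+1}\psi^{n}(g_2)]_{(1)}=a_{(0)}\triangleleft\alpha^{m+1}\beta^{u}\omega^{v+1}\psi^{n+1}(g_1)\otimes\beta(a_{(1)})g_2$; (11) $(a\triangleleft g)_{[-1]}\otimes(a\triangleleft g)_{[0]}=\alpha(a_{[-1]})\otimes a_{[0]}\triangleleft\psi(g)$; (12) $\alpha_D^{-1}\omega_D^{-1}(a_{(0)})\triangleleft\alpha^{m+s+1}\omega\psi^{n+t}(b_{[-1]})\otimes\beta^{p+u+1}\omega^{q+v}\psi(a_{(1)})\triangleright\beta_D^{-1}\psi_D^{-1}(b_{[0]})=a\otimes b$. *)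

theory Defs
  imports Complex_Main "HOL-Library.Function_Algebras"
begin

section \<open>Vector spaces with carrier\<close>

(* A vector space over the field 'k is a subspace of an ambient vector space 'a.
   Explicit carriers are needed because the tensor product of two spaces depends on
   their scalar multiplications, so it cannot be a type constructor. *)

record ('k, 'a) vspace =
  vcarrier :: "'a set"
  vscale :: "'k \<Rightarrow> 'a \<Rightarrow> 'a"

definition vec_space :: "('k::field, 'a::ab_group_add, 'x) vspace_scheme \<Rightarrow> bool" where
  "vec_space V \<longleftrightarrow> vector_space (vscale V) \<and> module.subspace (vscale V) (vcarrier V)"

definition ground :: "('k::field, 'k) vspace" where
  "ground = \<lparr>vcarrier = UNIV, vscale = (*)\<rparr>"

definition linear_map ::
  "('k::field, 'a::ab_group_add, 'x) vspace_scheme \<Rightarrow> ('k, 'b::ab_group_add, 'y) vspace_scheme \<Rightarrow>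
   ('a \<Rightarrow> 'b) \<Rightarrow> bool" where
  "linear_map V W f \<longleftrightarrow>
     (\<forall>x\<in>vcarrier V. f x \<in> vcarrier W) \<and>
     (\<forall>x\<in>vcarrier V. \<forall>y\<in>vcarrier V. f (x + y) = f x + f y) \<and>
     (\<forall>c. \<forall>x\<in>vcarrier V. f (vscale V c x) = vscale W c (f x))"

definition linear_aut :: "('k::field, 'a::ab_group_add, 'x) vspace_scheme \<Rightarrow> ('a \<Rightarrow> 'a) \<Rightarrow> bool" where
  "linear_aut V f \<longleftrightarrow> linear_map V V f \<and> bij_betw f (vcarrier V) (vcarrier V)"

definition bilinear_map ::
  "('k::field, 'a::ab_group_add, 'x) vspace_scheme \<Rightarrow> ('k, 'b::ab_group_add, 'y) vspace_scheme \<Rightarrow>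
   ('k, 'c::ab_group_add, 'z) vspace_scheme \<Rightarrow> ('a \<Rightarrow> 'b \<Rightarrow> 'c) \<Rightarrow> bool" where
  "bilinear_map V W U f \<longleftrightarrow>
     (\<forall>x\<in>vcarrier V. linear_map W U (\<lambda>y. f x y)) \<and>
     (\<forall>y\<in>vcarrier W. linear_map V U (\<lambda>x. f x y))"

definition commute_on :: "'a set \<Rightarrow> ('a \<Rightarrow> 'a) \<Rightarrow> ('a \<Rightarrow> 'a) \<Rightarrow> bool" where
  "commute_on S f g \<longleftrightarrow> (\<forall>x\<in>S. f (g x) = g (f x))"

definition ipow :: "'a set \<Rightarrow> ('a \<Rightarrow> 'a) \<Rightarrow> int \<Rightarrow> 'a \<Rightarrow> 'a" where
  "ipow S f k = (if 0 \<le> k then f ^^ nat k else inv_into S f ^^ nat (- k))"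


section \<open>Tensor products\<close>

(* v \<otimes> w is realised as evaluation at (v, w) of the bilinear forms on V \<times> W, and
   V \<otimes> W as the span of these pure tensors. Over a field this is the tensor product:
   see bilinear_tens, tensor_lift_tens, linear_tensor_lift, tensor_lift_unique below. *)

type_synonym ('k, 'a, 'b) tensor = "('a \<Rightarrow> 'b \<Rightarrow> 'k) \<Rightarrow> 'k"

definition tens ::
  "('k::field, 'a::ab_group_add, 'x) vspace_scheme \<Rightarrow> ('k, 'b::ab_group_add, 'y) vspace_scheme \<Rightarrow>
   'a \<Rightarrow> 'b \<Rightarrow> ('k, 'a, 'b) tensor" where
  "tens V W v w = (\<lambda>B. if bilinear_map V W ground B then B v w else 0)"

abbreviation tens_syntax ("(_ \<otimes>\<^bsub>_,_\<^esub> _)" [71, 0, 0, 71] 70) where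
  "v \<otimes>\<^bsub>V,W\<^esub> w \<equiv> tens V W v w"

definition tensor_scale :: "'k::field \<Rightarrow> ('k, 'a, 'b) tensor \<Rightarrow> ('k, 'a, 'b) tensor" where
  "tensor_scale c t = (\<lambda>B. c * t B)"

definition tensor_space ::
  "('k::field, 'a::ab_group_add, 'x) vspace_scheme \<Rightarrow> ('k, 'b::ab_group_add, 'y) vspace_scheme \<Rightarrow>
   ('k, ('k, 'a, 'b) tensor) vspace" where
  "tensor_space V W =
     \<lparr>vcarrier = module.span tensor_scale {v \<otimes>\<^bsub>V,W\<^esub> w |v w. v \<in> vcarrier V \<and> w \<in> vcarrier W},
      vscale = tensor_scale\<rparr>"

(* Sweedler notation: if t = \<Sum> v \<otimes> w then tensor_lift V W t f = \<Sum> f v w.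
   For bilinear f the value does not depend on the chosen decomposition of t. *)

definition tensor_lift ::
  "('k::field, 'a::ab_group_add, 'x) vspace_scheme \<Rightarrow> ('k, 'b::ab_group_add, 'y) vspace_scheme \<Rightarrow>
   ('k, 'a, 'b) tensor \<Rightarrow> ('a \<Rightarrow> 'b \<Rightarrow> 'c::ab_group_add) \<Rightarrow> 'c" where
  "tensor_lift V W t f =
     (let xs = (SOME xs. set xs \<subseteq> vcarrier V \<times> vcarrier W \<and>
                         t = (\<Sum>(v, w)\<leftarrow>xs. v \<otimes>\<^bsub>V,W\<^esub> w))
      in \<Sum>(v, w)\<leftarrow>xs. f v w)"

lemma vector_space_tensor_scale:
  "vector_space (tensor_scale :: 'k::field \<Rightarrow> ('k, 'a, 'b) tensor \<Rightarrow> _)"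
  by unfold_locales (auto simp: tensor_scale_def fun_eq_iff algebra_simps)

lemma vec_space_tensor: "vec_space (tensor_space V W)"
  unfolding vec_space_def tensor_space_def
  using vector_space_tensor_scale
  by (auto simp: module.subspace_span module_iff_vector_space)

lemma linear_functional_nonzero:
  assumes "vector_space s" "u \<noteq> 0"
  shows "\<exists>g. Vector_Spaces.linear s (*) g \<and> g u \<noteq> (0::'k::field)"
proof -
  have "vector_space ((*) :: 'k \<Rightarrow> _)"
    by unfold_locales (auto simp: algebra_simps)
  with assms(1) interpret vector_space_pair s "(*) :: 'k \<Rightarrow> 'k \<Rightarrow> 'k"
    by (simp add: vector_space_pair_def)
  have "vs1.independent {u}"
    using assms(2) by simp
  from linear_independent_extend[OF this, of "\<lambda>_. 1"] show ?thesis
    by force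
qed

lemma linear_map_add: "linear_map V W f \<Longrightarrow> x \<in> vcarrier V \<Longrightarrow> y \<in> vcarrier V \<Longrightarrow> f (x + y) = f x + f y"
  and linear_map_scale: "linear_map V W f \<Longrightarrow> x \<in> vcarrier V \<Longrightarrow> f (vscale V c x) = vscale W c (f x)"
  and linear_map_closed: "linear_map V W f \<Longrightarrow> x \<in> vcarrier V \<Longrightarrow> f x \<in> vcarrier W"
  by (auto simp: linear_map_def)

lemma vec_space_closed:
  assumes "vec_space V"
  shows "0 \<in> vcarrier V"
    and "x \<in> vcarrier V \<Longrightarrow> y \<in> vcarrier V \<Longrightarrow> x + y \<in> vcarrier V"
    and "x \<in> vcarrier V \<Longrightarrow> vscale V c x \<in> vcarrier V"
proof -
  interpret vector_space "vscale V" using assms by (simp add: vec_space_def)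
  have S: "subspace (vcarrier V)" using assms by (simp add: vec_space_def)
  show "0 \<in> vcarrier V" by (rule subspace_0[OF S])
  show "x \<in> vcarrier V \<Longrightarrow> y \<in> vcarrier V \<Longrightarrow> x + y \<in> vcarrier V" by (rule subspace_add[OF S])
  show "x \<in> vcarrier V \<Longrightarrow> vscale V c x \<in> vcarrier V" by (rule subspace_scale[OF S])
qed

lemma bilinear_tens: "bilinear_map V W (tensor_space V W) (tens V W)"
proof -
  interpret T: vector_space "tensor_scale :: 'a::field \<Rightarrow> ('a, 'b, 'd) tensor \<Rightarrow> _"
    by (rule vector_space_tensor_scale)
  have cl: "v \<otimes>\<^bsub>V,W\<^esub> w \<in> vcarrier (tensor_space V W)"
    if "v \<in> vcarrier V" "w \<in> vcarrier W" for v w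
    using that by (auto simp: tensor_space_def intro!: T.span_base)
  have B: "B (x + x') y = B x y + B x' y" "B x (y + y') = B x y + B x y'"
    "B (vscale V c x) y = c * B x y" "B x (vscale W c y) = c * B x y"
    if "bilinear_map V W ground B" "x \<in> vcarrier V" "x' \<in> vcarrier V"
      "y \<in> vcarrier W" "y' \<in> vcarrier W" for B x x' y y' c
    using that by (auto simp: bilinear_map_def linear_map_def ground_def)
  show ?thesis
    unfolding bilinear_map_def[of V W "tensor_space V W"] linear_map_def[of _ "tensor_space V W"]
    using cl B by (auto simp: fun_eq_iff tens_def tensor_space_def tensor_scale_def)
qed

lemma tensor_decompose:
  assumes "vec_space V" "vec_space W"
    and "t \<in> vcarrier (tensor_space V W)"
  shows "\<exists>xs. set xs \<subseteq> vcarrier V \<times> vcarrier W \<and> t = (\<Sum>(v, w)\<leftarrow>xs. v \<otimes>\<^bsub>V,W\<^esub> w)"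
proof -
  interpret T: vector_space "tensor_scale :: 'a::field \<Rightarrow> ('a, 'b, 'd) tensor \<Rightarrow> _"
    by (rule vector_space_tensor_scale)
  have "t \<in> T.span {v \<otimes>\<^bsub>V,W\<^esub> w |v w. v \<in> vcarrier V \<and> w \<in> vcarrier W}"
    using assms(3) by (simp add: tensor_space_def)
  then show ?thesis
  proof (induction rule: T.span_induct_alt)
    case base
    show ?case by (rule exI[of _ "[]"]) auto
  next
    case (step c x y)
    then obtain v w xs where *: "x = v \<otimes>\<^bsub>V,W\<^esub> w" "v \<in> vcarrier V" "w \<in> vcarrier W"
      "set xs \<subseteq> vcarrier V \<times> vcarrier W" "y = (\<Sum>(v, w)\<leftarrow>xs. v \<otimes>\<^bsub>V,W\<^esub> w)"
      by auto
    have "linear_map V (tensor_space V W) (\<lambda>x. x \<otimes>\<^bsub>V,W\<^esub> w)"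
      using bilinear_tens[of V W] *(3) by (simp add: bilinear_map_def)
    from linear_map_scale[OF this *(2), of c]
    have "tensor_scale c x = vscale V c v \<otimes>\<^bsub>V,W\<^esub> w"
      by (simp add: *(1) tensor_space_def)
    then show ?case
      using * vec_space_closed[OF assms(1)] by (intro exI[of _ "(vscale V c v, w) # xs"]) auto
  qed
qed

lemma sum_list_tens_apply:
  assumes "bilinear_map V W ground B"
  shows "(\<Sum>(v, w)\<leftarrow>xs. v \<otimes>\<^bsub>V,W\<^esub> w) B = (\<Sum>(v, w)\<leftarrow>xs. B v w)"
  using assms by (induction xs) (auto simp: tens_def)

lemma sum_list_bilinear_cong:
  assumes "vec_space U" "bilinear_map V W U f"
    and xs: "set xs \<subseteq> vcarrier V \<times> vcarrier W" and ys: "set ys \<subseteq> vcarrier V \<times> vcarrier W"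
    and eq: "(\<Sum>(v, w)\<leftarrow>xs. v \<otimes>\<^bsub>V,W\<^esub> w) = (\<Sum>(v, w)\<leftarrow>ys. v \<otimes>\<^bsub>V,W\<^esub> w)"
  shows "(\<Sum>(v, w)\<leftarrow>xs. f v w) = (\<Sum>(v, w)\<leftarrow>ys. f v w)"
proof (rule ccontr)
  let ?X = "\<Sum>(v, w)\<leftarrow>xs. f v w" and ?Y = "\<Sum>(v, w)\<leftarrow>ys. f v w"
  assume "?X \<noteq> ?Y"
  then obtain g where g: "Vector_Spaces.linear (vscale U) (*) g" "g (?X - ?Y) \<noteq> 0"
    using linear_functional_nonzero[of "vscale U" "?X - ?Y"] assms(1) by (auto simp: vec_space_def)
  interpret g: Vector_Spaces.linear "vscale U" "(*)" g by fact
  have B: "bilinear_map V W ground (\<lambda>v w. g (f v w))"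
    using assms(2) by (auto simp: bilinear_map_def linear_map_def ground_def g.add g.scale)
  have sum: "g (\<Sum>(v, w)\<leftarrow>zs. f v w) = (\<Sum>(v, w)\<leftarrow>zs. g (f v w))" for zs
    by (induction zs) (auto simp: g.add g.zero)
  have "g ?X = g ?Y"
    using sum_list_tens_apply[OF B, of xs] sum_list_tens_apply[OF B, of ys] eq by (simp add: sum)
  with g(2) show False by (simp add: g.diff)
qed

lemma tensor_lift_eq:
  assumes "vec_space U" "bilinear_map V W U f" "set xs \<subseteq> vcarrier V \<times> vcarrier W"
  shows "tensor_lift V W (\<Sum>(v, w)\<leftarrow>xs. v \<otimes>\<^bsub>V,W\<^esub> w) f = (\<Sum>(v, w)\<leftarrow>xs. f v w)"
proof -
  let ?P = "\<lambda>ys. set ys \<subseteq> vcarrier V \<times> vcarrier W \<and>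
    (\<Sum>(v, w)\<leftarrow>xs. v \<otimes>\<^bsub>V,W\<^esub> w) = (\<Sum>(v, w)\<leftarrow>ys. v \<otimes>\<^bsub>V,W\<^esub> w)"
  have "?P (SOME ys. ?P ys)"
    using assms(3) by (intro someI[of ?P xs]) auto
  then show ?thesis
    unfolding tensor_lift_def Let_def
    using sum_list_bilinear_cong[OF assms(1,2,3)] by (metis (no_types, lifting))
qed

lemma tensor_lift_tens:
  assumes "vec_space U" "bilinear_map V W U f" "v \<in> vcarrier V" "w \<in> vcarrier W"
  shows "tensor_lift V W (v \<otimes>\<^bsub>V,W\<^esub> w) f = f v w"
  using tensor_lift_eq[OF assms(1,2), of "[(v, w)]"] assms(3,4) by simp

lemma linear_tensor_lift:
  assumes V: "vec_space V" and W: "vec_space W" and U: "vec_space U"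
    and f: "bilinear_map V W U f"
  shows "linear_map (tensor_space V W) U (\<lambda>t. tensor_lift V W t f)"
proof -
  note dec = tensor_decompose[OF V W]
  note lift = tensor_lift_eq[OF U f]
  have fcl: "f v w \<in> vcarrier U" if "v \<in> vcarrier V" "w \<in> vcarrier W" for v w
    using f that by (auto simp: bilinear_map_def linear_map_def)
  have closed: "(\<Sum>(v, w)\<leftarrow>xs. f v w) \<in> vcarrier U"
    if "set xs \<subseteq> vcarrier V \<times> vcarrier W" for xs
    using that by (induction xs) (auto simp: vec_space_closed[OF U] fcl)
  have scaleU: "vscale U c (x + y) = vscale U c x + vscale U c y" "vscale U c 0 = 0" for c x y
  proof -
    interpret vector_space "vscale U" using U by (simp add: vec_space_def)
    show "vscale U c (x + y) = vscale U c x + vscale U c y" "vscale U c 0 = 0"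
      by (simp_all add: scale_right_distrib)
  qed
  have scale: "tensor_scale c (\<Sum>(v, w)\<leftarrow>xs. v \<otimes>\<^bsub>V,W\<^esub> w) =
        (\<Sum>(v, w)\<leftarrow>map (\<lambda>(v, w). (vscale V c v, w)) xs. v \<otimes>\<^bsub>V,W\<^esub> w) \<and>
      vscale U c (\<Sum>(v, w)\<leftarrow>xs. f v w) =
        (\<Sum>(v, w)\<leftarrow>map (\<lambda>(v, w). (vscale V c v, w)) xs. f v w)"
    if "set xs \<subseteq> vcarrier V \<times> vcarrier W" for xs c
    using that
  proof (induction xs)
    case Nil
    then show ?case by (auto simp: scaleU tensor_scale_def)
  next
    case (Cons a xs)
    obtain v w where a: "a = (v, w)" by force
    have vw: "v \<in> vcarrier V" "w \<in> vcarrier W" using Cons.prems a by auto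
    have "f (vscale V c v) w = vscale U c (f v w)"
      using f vw by (auto simp: bilinear_map_def linear_map_def)
    moreover have "vscale V c v \<otimes>\<^bsub>V,W\<^esub> w = tensor_scale c (v \<otimes>\<^bsub>V,W\<^esub> w)"
      using bilinear_tens[of V W] vw
      by (auto simp: bilinear_map_def linear_map_def tensor_space_def)
    moreover have "tensor_scale c (x + y) = tensor_scale c x + tensor_scale c y"
      for x y :: "('a, 'b, 'd) tensor"
      by (auto simp: tensor_scale_def fun_eq_iff algebra_simps)
    ultimately show ?case using Cons a by (simp add: scaleU del: plus_fun_apply)
  qed
  show ?thesis
    unfolding linear_map_def
  proof (intro conjI ballI allI)
    fix s assume "s \<in> vcarrier (tensor_space V W)"
    with dec obtain xs where xs: "set xs \<subseteq> vcarrier V \<times> vcarrier W"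
      "s = (\<Sum>(v, w)\<leftarrow>xs. v \<otimes>\<^bsub>V,W\<^esub> w)" by blast
    show "tensor_lift V W s f \<in> vcarrier U"
      unfolding xs(2) lift[OF xs(1)] by (rule closed[OF xs(1)])
    show "tensor_lift V W (vscale (tensor_space V W) c s) f = vscale U c (tensor_lift V W s f)" for c
    proof -
      let ?ys = "map (\<lambda>(v, w). (vscale V c v, w)) xs"
      have ys: "set ?ys \<subseteq> vcarrier V \<times> vcarrier W"
        using xs(1) vec_space_closed(3)[OF V] by auto
      have "vscale (tensor_space V W) c s = (\<Sum>(v, w)\<leftarrow>?ys. v \<otimes>\<^bsub>V,W\<^esub> w)"
        using scale[OF xs(1)] xs(2) by (simp add: tensor_space_def)
      then show ?thesis
        using lift[OF ys] lift[OF xs(1)] scale[OF xs(1), of c] xs(2) by simp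
    qed
    fix t assume "t \<in> vcarrier (tensor_space V W)"
    with dec obtain ys where ys: "set ys \<subseteq> vcarrier V \<times> vcarrier W"
      "t = (\<Sum>(v, w)\<leftarrow>ys. v \<otimes>\<^bsub>V,W\<^esub> w)" by blast
    show "tensor_lift V W (s + t) f = tensor_lift V W s f + tensor_lift V W t f"
      using lift[of "xs @ ys"] lift[OF xs(1)] lift[OF ys(1)] xs ys by simp
  qed
qed

lemma tensor_lift_unique:
  assumes V: "vec_space V" and W: "vec_space W" and U: "vec_space U"
    and f: "bilinear_map V W U f" and g: "linear_map (tensor_space V W) U g"
    and eq: "\<And>v w. v \<in> vcarrier V \<Longrightarrow> w \<in> vcarrier W \<Longrightarrow> g (v \<otimes>\<^bsub>V,W\<^esub> w) = f v w"
    and t: "t \<in> vcarrier (tensor_space V W)"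
  shows "g t = tensor_lift V W t f"
proof -
  obtain xs where xs: "set xs \<subseteq> vcarrier V \<times> vcarrier W" "t = (\<Sum>(v, w)\<leftarrow>xs. v \<otimes>\<^bsub>V,W\<^esub> w)"
    using tensor_decompose[OF V W t] by blast
  note T = vec_space_tensor[of V W]
  have g0: "g 0 = 0"
    using linear_map_add[OF g vec_space_closed(1)[OF T] vec_space_closed(1)[OF T]] by simp
  have tcl: "v \<otimes>\<^bsub>V,W\<^esub> w \<in> vcarrier (tensor_space V W)"
    if "v \<in> vcarrier V" "w \<in> vcarrier W" for v w
    using bilinear_tens[of V W] that by (auto simp: bilinear_map_def linear_map_def)
  have "(\<Sum>(v, w)\<leftarrow>xs. v \<otimes>\<^bsub>V,W\<^esub> w) \<in> vcarrier (tensor_space V W) \<and>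
        g (\<Sum>(v, w)\<leftarrow>xs. v \<otimes>\<^bsub>V,W\<^esub> w) = (\<Sum>(v, w)\<leftarrow>xs. f v w)"
    using xs(1)
    by (induction xs)
       (auto simp: g0 eq tcl vec_space_closed[OF T] linear_map_add[OF g])
  then show ?thesis
    using tensor_lift_eq[OF U f xs(1)] xs(2) by simp
qed


section \<open>BiHom-algebras, BiHom-coalgebras, BiHom-bialgebras\<close>

record ('k, 'a) bihom = "('k, 'a) vspace" +
  bmult :: "'a \<Rightarrow> 'a \<Rightarrow> 'a" (infixl "\<cdot>\<index>" 75)
  bunit :: "'a" ("\<one>\<index>")
  bcomult :: "'a \<Rightarrow> ('k, 'a, 'a) tensor" ("\<Delta>\<index>")
  bcounit :: "'a \<Rightarrow> 'k" ("\<epsilon>\<index>")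
  balpha :: "'a \<Rightarrow> 'a" ("\<alpha>\<index>")
  bbeta :: "'a \<Rightarrow> 'a" ("\<beta>\<index>")
  bomega :: "'a \<Rightarrow> 'a" ("\<omega>\<index>")
  bpsi :: "'a \<Rightarrow> 'a" ("\<psi>\<index>")

definition twist ::
  "('k::field, 'a::ab_group_add, 'x) bihom_scheme \<Rightarrow> int \<Rightarrow> int \<Rightarrow> int \<Rightarrow> int \<Rightarrow> 'a \<Rightarrow> 'a" where
  "twist A i j k l x =
     ipow (vcarrier A) \<alpha>\<^bsub>A\<^esub> i (ipow (vcarrier A) \<beta>\<^bsub>A\<^esub> j
       (ipow (vcarrier A) \<omega>\<^bsub>A\<^esub> k (ipow (vcarrier A) \<psi>\<^bsub>A\<^esub> l x)))"

definition struct_pairs ::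
  "('k::field, 'a::ab_group_add, 'x) bihom_scheme \<Rightarrow> ('k, 'b::ab_group_add, 'y) bihom_scheme \<Rightarrow>
   (('a \<Rightarrow> 'a) \<times> ('b \<Rightarrow> 'b)) set" where
  "struct_pairs A B =
     {(\<alpha>\<^bsub>A\<^esub>, \<alpha>\<^bsub>B\<^esub>), (\<beta>\<^bsub>A\<^esub>, \<beta>\<^bsub>B\<^esub>), (\<omega>\<^bsub>A\<^esub>, \<omega>\<^bsub>B\<^esub>), (\<psi>\<^bsub>A\<^esub>, \<psi>\<^bsub>B\<^esub>)}"

locale bihom_structure =
  fixes M :: "('k::field, 'a::ab_group_add, 'x) bihom_scheme"
  assumes vec_space: "vec_space M"
    and linear_aut_struct:
      "linear_aut M \<alpha>\<^bsub>M\<^esub>" "linear_aut M \<beta>\<^bsub>M\<^esub>" "linear_aut M \<omega>\<^bsub>M\<^esub>" "linear_aut M \<psi>\<^bsub>M\<^esub>"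
    and commute_struct:
      "commute_on (vcarrier M) \<alpha>\<^bsub>M\<^esub> \<beta>\<^bsub>M\<^esub>" "commute_on (vcarrier M) \<alpha>\<^bsub>M\<^esub> \<omega>\<^bsub>M\<^esub>"
      "commute_on (vcarrier M) \<alpha>\<^bsub>M\<^esub> \<psi>\<^bsub>M\<^esub>" "commute_on (vcarrier M) \<beta>\<^bsub>M\<^esub> \<omega>\<^bsub>M\<^esub>"
      "commute_on (vcarrier M) \<beta>\<^bsub>M\<^esub> \<psi>\<^bsub>M\<^esub>" "commute_on (vcarrier M) \<omega>\<^bsub>M\<^esub> \<psi>\<^bsub>M\<^esub>"

(* bihom_algebra constrains only \<alpha>, \<beta> and bihom_coalgebra only \<omega>, \<psi>. *)

locale bihom_algebra =
  fixes A :: "('k::field, 'a::ab_group_add, 'x) bihom_scheme"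
  assumes vec_space: "vec_space A"
    and mult_bilinear: "bilinear_map A A A (bmult A)"
    and unit_closed: "\<one>\<^bsub>A\<^esub> \<in> vcarrier A"
    and alpha_aut: "linear_aut A \<alpha>\<^bsub>A\<^esub>"
    and beta_aut: "linear_aut A \<beta>\<^bsub>A\<^esub>"
    and alpha_beta_commute: "commute_on (vcarrier A) \<alpha>\<^bsub>A\<^esub> \<beta>\<^bsub>A\<^esub>"
    and alpha_mult: "\<lbrakk>a \<in> vcarrier A; b \<in> vcarrier A\<rbrakk> \<Longrightarrow> \<alpha>\<^bsub>A\<^esub> (a \<cdot>\<^bsub>A\<^esub> b) = \<alpha>\<^bsub>A\<^esub> a \<cdot>\<^bsub>A\<^esub> \<alpha>\<^bsub>A\<^esub> b"
    and beta_mult: "\<lbrakk>a \<in> vcarrier A; b \<in> vcarrier A\<rbrakk> \<Longrightarrow> \<beta>\<^bsub>A\<^esub> (a \<cdot>\<^bsub>A\<^esub> b) = \<beta>\<^bsub>A\<^esub> a \<cdot>\<^bsub>A\<^esub> \<beta>\<^bsub>A\<^esub> b"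
    and alpha_unit: "\<alpha>\<^bsub>A\<^esub> \<one>\<^bsub>A\<^esub> = \<one>\<^bsub>A\<^esub>"
    and beta_unit: "\<beta>\<^bsub>A\<^esub> \<one>\<^bsub>A\<^esub> = \<one>\<^bsub>A\<^esub>"
    and unit_right: "a \<in> vcarrier A \<Longrightarrow> a \<cdot>\<^bsub>A\<^esub> \<one>\<^bsub>A\<^esub> = \<alpha>\<^bsub>A\<^esub> a"
    and unit_left: "a \<in> vcarrier A \<Longrightarrow> \<one>\<^bsub>A\<^esub> \<cdot>\<^bsub>A\<^esub> a = \<beta>\<^bsub>A\<^esub> a"
    and bihom_assoc: "\<lbrakk>a \<in> vcarrier A; b \<in> vcarrier A; c \<in> vcarrier A\<rbrakk> \<Longrightarrow>
      \<alpha>\<^bsub>A\<^esub> a \<cdot>\<^bsub>A\<^esub> (b \<cdot>\<^bsub>A\<^esub> c) = (a \<cdot>\<^bsub>A\<^esub> b) \<cdot>\<^bsub>A\<^esub> \<beta>\<^bsub>A\<^esub> c"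

definition bihom_algebra_map ::
  "('k::field, 'a::ab_group_add, 'x) bihom_scheme \<Rightarrow> ('k, 'b::ab_group_add, 'y) bihom_scheme \<Rightarrow>
   ('a \<Rightarrow> 'b) \<Rightarrow> bool" where
  "bihom_algebra_map A B f \<longleftrightarrow>
     linear_map A B f \<and>
     (\<forall>a\<in>vcarrier A. f (\<alpha>\<^bsub>A\<^esub> a) = \<alpha>\<^bsub>B\<^esub> (f a)) \<and>
     (\<forall>a\<in>vcarrier A. f (\<beta>\<^bsub>A\<^esub> a) = \<beta>\<^bsub>B\<^esub> (f a)) \<and>
     (\<forall>a\<in>vcarrier A. \<forall>b\<in>vcarrier A. f (a \<cdot>\<^bsub>A\<^esub> b) = f a \<cdot>\<^bsub>B\<^esub> f b) \<and>
     f \<one>\<^bsub>A\<^esub> = \<one>\<^bsub>B\<^esub>"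

(* Triple tensors are bracketed as C \<otimes> (C \<otimes> C) throughout. *)

locale bihom_coalgebra =
  fixes C :: "('k::field, 'a::ab_group_add, 'x) bihom_scheme"
  assumes vec_space: "vec_space C"
    and comult_linear: "linear_map C (tensor_space C C) \<Delta>\<^bsub>C\<^esub>"
    and counit_linear: "linear_map C ground \<epsilon>\<^bsub>C\<^esub>"
    and omega_aut: "linear_aut C \<omega>\<^bsub>C\<^esub>"
    and psi_aut: "linear_aut C \<psi>\<^bsub>C\<^esub>"
    and omega_psi_commute: "commute_on (vcarrier C) \<omega>\<^bsub>C\<^esub> \<psi>\<^bsub>C\<^esub>"
    and counit_omega: "c \<in> vcarrier C \<Longrightarrow> \<epsilon>\<^bsub>C\<^esub> (\<omega>\<^bsub>C\<^esub> c) = \<epsilon>\<^bsub>C\<^esub> c"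
    and counit_psi: "c \<in> vcarrier C \<Longrightarrow> \<epsilon>\<^bsub>C\<^esub> (\<psi>\<^bsub>C\<^esub> c) = \<epsilon>\<^bsub>C\<^esub> c"
    and comult_omega: "c \<in> vcarrier C \<Longrightarrow>
      \<Delta>\<^bsub>C\<^esub> (\<omega>\<^bsub>C\<^esub> c) = tensor_lift C C (\<Delta>\<^bsub>C\<^esub> c) (\<lambda>c1 c2. \<omega>\<^bsub>C\<^esub> c1 \<otimes>\<^bsub>C,C\<^esub> \<omega>\<^bsub>C\<^esub> c2)"
    and comult_psi: "c \<in> vcarrier C \<Longrightarrow>
      \<Delta>\<^bsub>C\<^esub> (\<psi>\<^bsub>C\<^esub> c) = tensor_lift C C (\<Delta>\<^bsub>C\<^esub> c) (\<lambda>c1 c2. \<psi>\<^bsub>C\<^esub> c1 \<otimes>\<^bsub>C,C\<^esub> \<psi>\<^bsub>C\<^esub> c2)"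
    and counit_right: "c \<in> vcarrier C \<Longrightarrow>
      tensor_lift C C (\<Delta>\<^bsub>C\<^esub> c) (\<lambda>c1 c2. vscale C (\<epsilon>\<^bsub>C\<^esub> c2) c1) = \<omega>\<^bsub>C\<^esub> c"
    and counit_left: "c \<in> vcarrier C \<Longrightarrow>
      tensor_lift C C (\<Delta>\<^bsub>C\<^esub> c) (\<lambda>c1 c2. vscale C (\<epsilon>\<^bsub>C\<^esub> c1) c2) = \<psi>\<^bsub>C\<^esub> c"
    and bihom_coassoc: "c \<in> vcarrier C \<Longrightarrow>
      tensor_lift C C (\<Delta>\<^bsub>C\<^esub> c) (\<lambda>c1 c2. \<omega>\<^bsub>C\<^esub> c1 \<otimes>\<^bsub>C,tensor_space C C\<^esub> \<Delta>\<^bsub>C\<^esub> c2) =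
      tensor_lift C C (\<Delta>\<^bsub>C\<^esub> c) (\<lambda>c1 c2.
        tensor_lift C C (\<Delta>\<^bsub>C\<^esub> c1) (\<lambda>c11 c12.
          c11 \<otimes>\<^bsub>C,tensor_space C C\<^esub> (c12 \<otimes>\<^bsub>C,C\<^esub> \<psi>\<^bsub>C\<^esub> c2)))"

definition bihom_coalgebra_map ::
  "('k::field, 'a::ab_group_add, 'x) bihom_scheme \<Rightarrow> ('k, 'b::ab_group_add, 'y) bihom_scheme \<Rightarrow>
   ('a \<Rightarrow> 'b) \<Rightarrow> bool" where
  "bihom_coalgebra_map C D f \<longleftrightarrow>
     linear_map C D f \<and>
     (\<forall>c\<in>vcarrier C. f (\<omega>\<^bsub>C\<^esub> c) = \<omega>\<^bsub>D\<^esub> (f c)) \<and>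
     (\<forall>c\<in>vcarrier C. f (\<psi>\<^bsub>C\<^esub> c) = \<psi>\<^bsub>D\<^esub> (f c)) \<and>
     (\<forall>c\<in>vcarrier C. \<Delta>\<^bsub>D\<^esub> (f c) = tensor_lift C C (\<Delta>\<^bsub>C\<^esub> c) (\<lambda>c1 c2. f c1 \<otimes>\<^bsub>D,D\<^esub> f c2)) \<and>
     (\<forall>c\<in>vcarrier C. \<epsilon>\<^bsub>D\<^esub> (f c) = \<epsilon>\<^bsub>C\<^esub> c)"

locale bihom_bialgebra =
  bihom_structure H + bihom_algebra H + bihom_coalgebra H
  for H :: "('k::field, 'a::ab_group_add, 'x) bihom_scheme" +
  assumes comult_mult: "\<lbrakk>h \<in> vcarrier H; g \<in> vcarrier H\<rbrakk> \<Longrightarrow>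
      \<Delta>\<^bsub>H\<^esub> (h \<cdot>\<^bsub>H\<^esub> g) =
      tensor_lift H H (\<Delta>\<^bsub>H\<^esub> h) (\<lambda>h1 h2. tensor_lift H H (\<Delta>\<^bsub>H\<^esub> g) (\<lambda>g1 g2.
        (h1 \<cdot>\<^bsub>H\<^esub> g1) \<otimes>\<^bsub>H,H\<^esub> (h2 \<cdot>\<^bsub>H\<^esub> g2)))"
    and counit_mult: "\<lbrakk>h \<in> vcarrier H; g \<in> vcarrier H\<rbrakk> \<Longrightarrow>
      \<epsilon>\<^bsub>H\<^esub> (h \<cdot>\<^bsub>H\<^esub> g) = \<epsilon>\<^bsub>H\<^esub> h * \<epsilon>\<^bsub>H\<^esub> g"
    and comult_unit: "\<Delta>\<^bsub>H\<^esub> \<one>\<^bsub>H\<^esub> = \<one>\<^bsub>H\<^esub> \<otimes>\<^bsub>H,H\<^esub> \<one>\<^bsub>H\<^esub>"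
    and counit_unit: "\<epsilon>\<^bsub>H\<^esub> \<one>\<^bsub>H\<^esub> = 1"
    and alpha_coalgebra_map: "bihom_coalgebra_map H H \<alpha>\<^bsub>H\<^esub>"
    and beta_coalgebra_map: "bihom_coalgebra_map H H \<beta>\<^bsub>H\<^esub>"
    and omega_algebra_map: "bihom_algebra_map H H \<omega>\<^bsub>H\<^esub>"
    and psi_algebra_map: "bihom_algebra_map H H \<psi>\<^bsub>H\<^esub>"


section \<open>Modules and comodules\<close>

locale left_module = bihom_structure M
  for H :: "('k::field, 'h::ab_group_add, 'x) bihom_scheme"
    and M :: "('k, 'm::ab_group_add, 'y) bihom_scheme"
    and lact :: "'h \<Rightarrow> 'm \<Rightarrow> 'm" (infixr "\<triangleright>" 76) +
  assumes lact_bilinear: "bilinear_map H M M (\<triangleright>)"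
    and lact_struct: "\<lbrakk>(\<theta>M, \<theta>) \<in> struct_pairs M H; h \<in> vcarrier H; x \<in> vcarrier M\<rbrakk> \<Longrightarrow>
      \<theta>M (h \<triangleright> x) = \<theta> h \<triangleright> \<theta>M x"
    and lact_assoc: "\<lbrakk>h \<in> vcarrier H; g \<in> vcarrier H; x \<in> vcarrier M\<rbrakk> \<Longrightarrow>
      \<alpha>\<^bsub>H\<^esub> h \<triangleright> (g \<triangleright> x) = (h \<cdot>\<^bsub>H\<^esub> g) \<triangleright> \<beta>\<^bsub>M\<^esub> x"
    and lact_unit: "x \<in> vcarrier M \<Longrightarrow> \<one>\<^bsub>H\<^esub> \<triangleright> x = \<beta>\<^bsub>M\<^esub> x"

locale right_module = bihom_structure M
  for H :: "('k::field, 'h::ab_group_add, 'x) bihom_scheme"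
    and M :: "('k, 'm::ab_group_add, 'y) bihom_scheme"
    and ract :: "'m \<Rightarrow> 'h \<Rightarrow> 'm" (infixl "\<triangleleft>" 76) +
  assumes ract_bilinear: "bilinear_map M H M (\<triangleleft>)"
    and ract_struct: "\<lbrakk>(\<theta>M, \<theta>) \<in> struct_pairs M H; x \<in> vcarrier M; h \<in> vcarrier H\<rbrakk> \<Longrightarrow>
      \<theta>M (x \<triangleleft> h) = \<theta>M x \<triangleleft> \<theta> h"
    and ract_assoc: "\<lbrakk>x \<in> vcarrier M; h \<in> vcarrier H; g \<in> vcarrier H\<rbrakk> \<Longrightarrow>
      (x \<triangleleft> h) \<triangleleft> \<beta>\<^bsub>H\<^esub> g = \<alpha>\<^bsub>M\<^esub> x \<triangleleft> (h \<cdot>\<^bsub>H\<^esub> g)"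
    and ract_unit: "x \<in> vcarrier M \<Longrightarrow> x \<triangleleft> \<one>\<^bsub>H\<^esub> = \<alpha>\<^bsub>M\<^esub> x"

locale bimodule = left_module H M lact + right_module H M ract
  for H :: "('k::field, 'h::ab_group_add, 'x) bihom_scheme"
    and M :: "('k, 'm::ab_group_add, 'y) bihom_scheme"
    and lact :: "'h \<Rightarrow> 'm \<Rightarrow> 'm" (infixr "\<triangleright>" 76)
    and ract :: "'m \<Rightarrow> 'h \<Rightarrow> 'm" (infixl "\<triangleleft>" 76) +
  assumes bimodule_assoc: "\<lbrakk>a \<in> vcarrier H; x \<in> vcarrier M; b \<in> vcarrier H\<rbrakk> \<Longrightarrow>
      \<alpha>\<^bsub>H\<^esub> a \<triangleright> (x \<triangleleft> b) = (a \<triangleright> x) \<triangleleft> \<beta>\<^bsub>H\<^esub> b"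

locale bimodule_bihom_algebra = bihom_algebra D + bimodule H D lact ract
  for H :: "('k::field, 'h::ab_group_add, 'x) bihom_scheme"
    and D :: "('k, 'd::ab_group_add, 'y) bihom_scheme"
    and lact :: "'h \<Rightarrow> 'd \<Rightarrow> 'd" (infixr "\<triangleright>" 76)
    and ract :: "'d \<Rightarrow> 'h \<Rightarrow> 'd" (infixl "\<triangleleft>" 76) +
  assumes lact_mult: "\<lbrakk>h \<in> vcarrier H; a \<in> vcarrier D; b \<in> vcarrier D\<rbrakk> \<Longrightarrow>
      h \<triangleright> (a \<cdot>\<^bsub>D\<^esub> b) = tensor_lift H H (\<Delta>\<^bsub>H\<^esub> h) (\<lambda>h1 h2.
        (twist H (-1) 0 (-1) 0 h1 \<triangleright> a) \<cdot>\<^bsub>D\<^esub> (twist H 0 (-1) 0 (-1) h2 \<triangleright> b))"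
    and lact_one: "h \<in> vcarrier H \<Longrightarrow> h \<triangleright> \<one>\<^bsub>D\<^esub> = vscale D (\<epsilon>\<^bsub>H\<^esub> h) \<one>\<^bsub>D\<^esub>"
    and ract_mult: "\<lbrakk>h \<in> vcarrier H; a \<in> vcarrier D; b \<in> vcarrier D\<rbrakk> \<Longrightarrow>
      (a \<cdot>\<^bsub>D\<^esub> b) \<triangleleft> h = tensor_lift H H (\<Delta>\<^bsub>H\<^esub> h) (\<lambda>h1 h2.
        (a \<triangleleft> twist H (-1) 0 (-1) 0 h1) \<cdot>\<^bsub>D\<^esub> (b \<triangleleft> twist H 0 (-1) 0 (-1) h2))"
    and ract_one: "h \<in> vcarrier H \<Longrightarrow> \<one>\<^bsub>D\<^esub> \<triangleleft> h = vscale D (\<epsilon>\<^bsub>H\<^esub> h) \<one>\<^bsub>D\<^esub>"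

locale right_comodule = bihom_structure M
  for H :: "('k::field, 'h::ab_group_add, 'x) bihom_scheme"
    and M :: "('k, 'm::ab_group_add, 'y) bihom_scheme"
    and \<rho>R :: "'m \<Rightarrow> ('k, 'm, 'h) tensor" +
  assumes rcoact_linear: "linear_map M (tensor_space M H) \<rho>R"
    and rcoact_struct: "\<lbrakk>(\<theta>M, \<theta>) \<in> struct_pairs M H; x \<in> vcarrier M\<rbrakk> \<Longrightarrow>
      tensor_lift M H (\<rho>R x) (\<lambda>x0 x1. \<theta>M x0 \<otimes>\<^bsub>M,H\<^esub> \<theta> x1) = \<rho>R (\<theta>M x)"
    and rcoact_coassoc: "x \<in> vcarrier M \<Longrightarrow>
      tensor_lift M H (\<rho>R x) (\<lambda>x0 x1. \<omega>\<^bsub>M\<^esub> x0 \<otimes>\<^bsub>M,tensor_space H H\<^esub> \<Delta>\<^bsub>H\<^esub> x1) =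
      tensor_lift M H (\<rho>R x) (\<lambda>x0 x1. tensor_lift M H (\<rho>R x0) (\<lambda>x00 x01.
        x00 \<otimes>\<^bsub>M,tensor_space H H\<^esub> (x01 \<otimes>\<^bsub>H,H\<^esub> \<psi>\<^bsub>H\<^esub> x1)))"
    and rcoact_counit: "x \<in> vcarrier M \<Longrightarrow>
      tensor_lift M H (\<rho>R x) (\<lambda>x0 x1. vscale M (\<epsilon>\<^bsub>H\<^esub> x1) x0) = \<omega>\<^bsub>M\<^esub> x"

(* For a left coaction, y and x0 stand for x_[-1] and x_[0]. *)

locale left_comodule = bihom_structure M
  for H :: "('k::field, 'h::ab_group_add, 'x) bihom_scheme"
    and M :: "('k, 'm::ab_group_add, 'y) bihom_scheme"
    and \<rho>L :: "'m \<Rightarrow> ('k, 'h, 'm) tensor" +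
  assumes lcoact_linear: "linear_map M (tensor_space H M) \<rho>L"
    and lcoact_struct: "\<lbrakk>(\<theta>M, \<theta>) \<in> struct_pairs M H; x \<in> vcarrier M\<rbrakk> \<Longrightarrow>
      tensor_lift H M (\<rho>L x) (\<lambda>y x0. \<theta> y \<otimes>\<^bsub>H,M\<^esub> \<theta>M x0) = \<rho>L (\<theta>M x)"
    and lcoact_coassoc: "x \<in> vcarrier M \<Longrightarrow>
      tensor_lift H M (\<rho>L x) (\<lambda>y x0. tensor_lift H H (\<Delta>\<^bsub>H\<^esub> y) (\<lambda>y1 y2.
        y1 \<otimes>\<^bsub>H,tensor_space H M\<^esub> (y2 \<otimes>\<^bsub>H,M\<^esub> \<psi>\<^bsub>M\<^esub> x0))) =
      tensor_lift H M (\<rho>L x) (\<lambda>y x0. \<omega>\<^bsub>H\<^esub> y \<otimes>\<^bsub>H,tensor_space H M\<^esub> \<rho>L x0)"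
    and lcoact_counit: "x \<in> vcarrier M \<Longrightarrow>
      tensor_lift H M (\<rho>L x) (\<lambda>y x0. vscale M (\<epsilon>\<^bsub>H\<^esub> y) x0) = \<psi>\<^bsub>M\<^esub> x"

locale bicomodule = left_comodule H M \<rho>L + right_comodule H M \<rho>R
  for H :: "('k::field, 'h::ab_group_add, 'x) bihom_scheme"
    and M :: "('k, 'm::ab_group_add, 'y) bihom_scheme"
    and \<rho>L :: "'m \<Rightarrow> ('k, 'h, 'm) tensor"
    and \<rho>R :: "'m \<Rightarrow> ('k, 'm, 'h) tensor" +
  assumes bicomodule_coassoc: "x \<in> vcarrier M \<Longrightarrow>
      tensor_lift H M (\<rho>L x) (\<lambda>y x0. \<omega>\<^bsub>H\<^esub> y \<otimes>\<^bsub>H,tensor_space M H\<^esub> \<rho>R x0) =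
      tensor_lift M H (\<rho>R x) (\<lambda>x0 x1. tensor_lift H M (\<rho>L x0) (\<lambda>y x00.
        y \<otimes>\<^bsub>H,tensor_space M H\<^esub> (x00 \<otimes>\<^bsub>M,H\<^esub> \<psi>\<^bsub>H\<^esub> x1)))"

(* For a left coaction c1L, c10 stand for c_1[-1], c_1[0];
   for a right coaction c10, c11 stand for c_1(0), c_1(1); and so on. *)

locale bicomodule_bihom_coalgebra = bihom_coalgebra D + bicomodule H D \<rho>L \<rho>R
  for H :: "('k::field, 'h::ab_group_add, 'x) bihom_scheme"
    and D :: "('k, 'd::ab_group_add, 'y) bihom_scheme"
    and \<rho>L :: "'d \<Rightarrow> ('k, 'h, 'd) tensor"
    and \<rho>R :: "'d \<Rightarrow> ('k, 'd, 'h) tensor" +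
  assumes lcoact_comult: "c \<in> vcarrier D \<Longrightarrow>
      tensor_lift H D (\<rho>L c) (\<lambda>cL c0. cL \<otimes>\<^bsub>H,tensor_space D D\<^esub> \<Delta>\<^bsub>D\<^esub> c0) =
      tensor_lift D D (\<Delta>\<^bsub>D\<^esub> c) (\<lambda>c1 c2.
        tensor_lift H D (\<rho>L c1) (\<lambda>c1L c10. tensor_lift H D (\<rho>L c2) (\<lambda>c2L c20.
          (twist H (-1) 0 (-1) 0 c1L \<cdot>\<^bsub>H\<^esub> twist H 0 (-1) 0 (-1) c2L)
            \<otimes>\<^bsub>H,tensor_space D D\<^esub> (c10 \<otimes>\<^bsub>D,D\<^esub> c20))))"
    and lcoact_counitD: "c \<in> vcarrier D \<Longrightarrow>
      tensor_lift H D (\<rho>L c) (\<lambda>cL c0. vscale H (\<epsilon>\<^bsub>D\<^esub> c0) cL) = vscale H (\<epsilon>\<^bsub>D\<^esub> c) \<one>\<^bsub>H\<^esub>"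
    and rcoact_comult: "c \<in> vcarrier D \<Longrightarrow>
      tensor_lift D H (\<rho>R c) (\<lambda>c0 cR. tensor_lift D D (\<Delta>\<^bsub>D\<^esub> c0) (\<lambda>c01 c02.
        c01 \<otimes>\<^bsub>D,tensor_space D H\<^esub> (c02 \<otimes>\<^bsub>D,H\<^esub> cR))) =
      tensor_lift D D (\<Delta>\<^bsub>D\<^esub> c) (\<lambda>c1 c2.
        tensor_lift D H (\<rho>R c1) (\<lambda>c10 c11. tensor_lift D H (\<rho>R c2) (\<lambda>c20 c21.
          c10 \<otimes>\<^bsub>D,tensor_space D H\<^esub>
            (c20 \<otimes>\<^bsub>D,H\<^esub> (twist H (-1) 0 (-1) 0 c11 \<cdot>\<^bsub>H\<^esub> twist H 0 (-1) 0 (-1) c21)))))"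
    and rcoact_counitD: "c \<in> vcarrier D \<Longrightarrow>
      tensor_lift D H (\<rho>R c) (\<lambda>c0 cR. vscale H (\<epsilon>\<^bsub>D\<^esub> c0) cR) = vscale H (\<epsilon>\<^bsub>D\<^esub> c) \<one>\<^bsub>H\<^esub>"


section \<open>BiHom-L-R-admissible pairs and the BiHom-L-R-smash biproduct\<close>

locale LR_admissible_pair =
  bimodule_bihom_algebra H D lact ract + bicomodule_bihom_coalgebra H D \<rho>L \<rho>R
  for H :: "('k::field, 'h::ab_group_add, 'x) bihom_scheme"
    and D :: "('k, 'd::ab_group_add, 'y) bihom_scheme"
    and lact :: "'h \<Rightarrow> 'd \<Rightarrow> 'd" (infixr "\<triangleright>" 76)
    and ract :: "'d \<Rightarrow> 'h \<Rightarrow> 'd" (infixl "\<triangleleft>" 76)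
    and \<rho>L :: "'d \<Rightarrow> ('k, 'h, 'd) tensor"
    and \<rho>R :: "'d \<Rightarrow> ('k, 'd, 'h) tensor"
    and m n p q s t u v :: int +
  assumes alphaD_coalgebra_map: "bihom_coalgebra_map D D \<alpha>\<^bsub>D\<^esub>"
    and betaD_coalgebra_map: "bihom_coalgebra_map D D \<beta>\<^bsub>D\<^esub>"
    and omegaD_algebra_map: "bihom_algebra_map D D \<omega>\<^bsub>D\<^esub>"
    and psiD_algebra_map: "bihom_algebra_map D D \<psi>\<^bsub>D\<^esub>"
    and LR1_unit: "\<epsilon>\<^bsub>D\<^esub> \<one>\<^bsub>D\<^esub> = 1"
    and LR1_mult: "\<lbrakk>a \<in> vcarrier D; b \<in> vcarrier D\<rbrakk> \<Longrightarrow> \<epsilon>\<^bsub>D\<^esub> (a \<cdot>\<^bsub>D\<^esub> b) = \<epsilon>\<^bsub>D\<^esub> a * \<epsilon>\<^bsub>D\<^esub> b"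
    and LR2_left: "\<lbrakk>h \<in> vcarrier H; a \<in> vcarrier D\<rbrakk> \<Longrightarrow> \<epsilon>\<^bsub>D\<^esub> (h \<triangleright> a) = \<epsilon>\<^bsub>H\<^esub> h * \<epsilon>\<^bsub>D\<^esub> a"
    and LR2_right: "\<lbrakk>h \<in> vcarrier H; a \<in> vcarrier D\<rbrakk> \<Longrightarrow> \<epsilon>\<^bsub>D\<^esub> (a \<triangleleft> h) = \<epsilon>\<^bsub>H\<^esub> h * \<epsilon>\<^bsub>D\<^esub> a"
    and LR3_right: "\<rho>R \<one>\<^bsub>D\<^esub> = \<one>\<^bsub>D\<^esub> \<otimes>\<^bsub>D,H\<^esub> \<one>\<^bsub>H\<^esub>"
    and LR3_left: "\<rho>L \<one>\<^bsub>D\<^esub> = \<one>\<^bsub>H\<^esub> \<otimes>\<^bsub>H,D\<^esub> \<one>\<^bsub>D\<^esub>"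
    and LR4_right: "\<lbrakk>a \<in> vcarrier D; b \<in> vcarrier D\<rbrakk> \<Longrightarrow>
      \<rho>R (a \<cdot>\<^bsub>D\<^esub> b) =
      tensor_lift D H (\<rho>R a) (\<lambda>a0 a1. tensor_lift D H (\<rho>R b) (\<lambda>b0 b1.
        (a0 \<cdot>\<^bsub>D\<^esub> b0) \<otimes>\<^bsub>D,H\<^esub> (a1 \<cdot>\<^bsub>H\<^esub> b1)))"
    and LR4_left: "\<lbrakk>a \<in> vcarrier D; b \<in> vcarrier D\<rbrakk> \<Longrightarrow>
      \<rho>L (a \<cdot>\<^bsub>D\<^esub> b) =
      tensor_lift H D (\<rho>L a) (\<lambda>aL a0. tensor_lift H D (\<rho>L b) (\<lambda>bL b0.
        (aL \<cdot>\<^bsub>H\<^esub> bL) \<otimes>\<^bsub>H,D\<^esub> (a0 \<cdot>\<^bsub>D\<^esub> b0)))"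
    and LR5: "\<Delta>\<^bsub>D\<^esub> \<one>\<^bsub>D\<^esub> = \<one>\<^bsub>D\<^esub> \<otimes>\<^bsub>D,D\<^esub> \<one>\<^bsub>D\<^esub>"
    and LR6_left: "\<lbrakk>h \<in> vcarrier H; a \<in> vcarrier D\<rbrakk> \<Longrightarrow>
      \<Delta>\<^bsub>D\<^esub> (h \<triangleright> a) =
      tensor_lift H H (\<Delta>\<^bsub>H\<^esub> h) (\<lambda>h1 h2. tensor_lift D D (\<Delta>\<^bsub>D\<^esub> a) (\<lambda>a1 a2.
        (h1 \<triangleright> a1) \<otimes>\<^bsub>D,D\<^esub> (h2 \<triangleright> a2)))"
    and LR6_right: "\<lbrakk>h \<in> vcarrier H; a \<in> vcarrier D\<rbrakk> \<Longrightarrow>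
      \<Delta>\<^bsub>D\<^esub> (a \<triangleleft> h) =
      tensor_lift D D (\<Delta>\<^bsub>D\<^esub> a) (\<lambda>a1 a2. tensor_lift H H (\<Delta>\<^bsub>H\<^esub> h) (\<lambda>h1 h2.
        (a1 \<triangleleft> h1) \<otimes>\<^bsub>D,D\<^esub> (a2 \<triangleleft> h2)))"
    and LR7: "\<lbrakk>a \<in> vcarrier D; b \<in> vcarrier D\<rbrakk> \<Longrightarrow>
      \<Delta>\<^bsub>D\<^esub> (a \<cdot>\<^bsub>D\<^esub> b) =
      tensor_lift D D (\<Delta>\<^bsub>D\<^esub> a) (\<lambda>a1 a2. tensor_lift D D (\<Delta>\<^bsub>D\<^esub> b) (\<lambda>b1 b2.
        tensor_lift H D (\<rho>L a2) (\<lambda>a2L a20. tensor_lift D H (\<rho>R b1) (\<lambda>b10 b11.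
          (a1 \<cdot>\<^bsub>D\<^esub> (twist H (s + 1) p (q + 1) t a2L \<triangleright> twist D 0 (-1) (-1) 0 b10))
          \<otimes>\<^bsub>D,D\<^esub>
          ((twist D (-1) 0 0 (-1) a20 \<triangleleft> twist H m (u + 1) v (n + 1) b11) \<cdot>\<^bsub>D\<^esub> b2)))))"
    and LR8: "\<lbrakk>h \<in> vcarrier H; b \<in> vcarrier D\<rbrakk> \<Longrightarrow>
      tensor_lift H H (\<Delta>\<^bsub>H\<^esub> h) (\<lambda>h1 h2.
        tensor_lift H D (\<rho>L (twist H s (p + 1) q (t + 1) h1 \<triangleright> b)) (\<lambda>xL x0.
          (xL \<cdot>\<^bsub>H\<^esub> twist H 1 (-1) 1 (-1) h2) \<otimes>\<^bsub>H,D\<^esub> x0)) =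
      tensor_lift H H (\<Delta>\<^bsub>H\<^esub> h) (\<lambda>h1 h2. tensor_lift H D (\<rho>L b) (\<lambda>bL b0.
        (h1 \<cdot>\<^bsub>H\<^esub> \<alpha>\<^bsub>H\<^esub> bL) \<otimes>\<^bsub>H,D\<^esub> (twist H s (p + 1) (q + 1) (t + 1) h2 \<triangleright> b0)))"
    and LR9: "\<lbrakk>h \<in> vcarrier H; b \<in> vcarrier D\<rbrakk> \<Longrightarrow>
      \<rho>R (h \<triangleright> b) =
      tensor_lift D H (\<rho>R b) (\<lambda>b0 b1. (\<omega>\<^bsub>H\<^esub> h \<triangleright> b0) \<otimes>\<^bsub>D,H\<^esub> \<beta>\<^bsub>H\<^esub> b1)"
    and LR10: "\<lbrakk>a \<in> vcarrier D; g \<in> vcarrier H\<rbrakk> \<Longrightarrow>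
      tensor_lift H H (\<Delta>\<^bsub>H\<^esub> g) (\<lambda>g1 g2.
        tensor_lift D H (\<rho>R (a \<triangleleft> twist H (m + 1) u (v + 1) n g2)) (\<lambda>x0 x1.
          x0 \<otimes>\<^bsub>D,H\<^esub> (twist H (-1) 1 (-1) 1 g1 \<cdot>\<^bsub>H\<^esub> x1))) =
      tensor_lift D H (\<rho>R a) (\<lambda>a0 a1. tensor_lift H H (\<Delta>\<^bsub>H\<^esub> g) (\<lambda>g1 g2.
        (a0 \<triangleleft> twist H (m + 1) u (v + 1) (n + 1) g1) \<otimes>\<^bsub>D,H\<^esub> (\<beta>\<^bsub>H\<^esub> a1 \<cdot>\<^bsub>H\<^esub> g2)))"
    and LR11: "\<lbrakk>a \<in> vcarrier D; g \<in> vcarrier H\<rbrakk> \<Longrightarrow>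
      \<rho>L (a \<triangleleft> g) =
      tensor_lift H D (\<rho>L a) (\<lambda>aL a0. \<alpha>\<^bsub>H\<^esub> aL \<otimes>\<^bsub>H,D\<^esub> (a0 \<triangleleft> \<psi>\<^bsub>H\<^esub> g))"
    and LR12: "\<lbrakk>a \<in> vcarrier D; b \<in> vcarrier D\<rbrakk> \<Longrightarrow>
      tensor_lift D H (\<rho>R a) (\<lambda>a0 a1. tensor_lift H D (\<rho>L b) (\<lambda>bL b0.
        (twist D (-1) 0 (-1) 0 a0 \<triangleleft> twist H (m + s + 1) 0 1 (n + t) bL)
        \<otimes>\<^bsub>D,D\<^esub>
        (twist H 0 (p + u + 1) (q + v) 1 a1 \<triangleright> twist D 0 (-1) 0 (-1) b0))) =
      a \<otimes>\<^bsub>D,D\<^esub> b"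

definition LR_biproduct ::
  "('k::field, 'h::ab_group_add, 'x) bihom_scheme \<Rightarrow> ('k, 'd::ab_group_add, 'y) bihom_scheme \<Rightarrow>
   ('h \<Rightarrow> 'd \<Rightarrow> 'd) \<Rightarrow> ('d \<Rightarrow> 'h \<Rightarrow> 'd) \<Rightarrow>
   ('d \<Rightarrow> ('k, 'h, 'd) tensor) \<Rightarrow> ('d \<Rightarrow> ('k, 'd, 'h) tensor) \<Rightarrow>
   int \<Rightarrow> int \<Rightarrow> int \<Rightarrow> int \<Rightarrow> int \<Rightarrow> int \<Rightarrow> int \<Rightarrow> int \<Rightarrow>
   ('k, ('k, 'd, 'h) tensor) bihom" where
  "LR_biproduct H D lact ract \<rho>L \<rho>R m n p q s t u v =
    \<lparr>vcarrier = vcarrier (tensor_space D H),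
     vscale = vscale (tensor_space D H),
     bmult = (\<lambda>x y.
       tensor_lift D H x (\<lambda>a h. tensor_lift D H y (\<lambda>b g.
         tensor_lift H H (\<Delta>\<^bsub>H\<^esub> h) (\<lambda>h1 h2. tensor_lift H H (\<Delta>\<^bsub>H\<^esub> g) (\<lambda>g1 g2.
           (ract (twist D (-1) 0 0 0 a) (twist H m 0 0 n g2) \<cdot>\<^bsub>D\<^esub>
            lact (twist H 0 p q 0 h1) (twist D 0 (-1) 0 0 b))
           \<otimes>\<^bsub>D,H\<^esub>
           (twist H 0 0 0 (-1) h2 \<cdot>\<^bsub>H\<^esub> twist H 0 0 (-1) 0 g1)))))),
     bunit = \<one>\<^bsub>D\<^esub> \<otimes>\<^bsub>D,H\<^esub> \<one>\<^bsub>H\<^esub>,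
     bcomult = (\<lambda>x.
       tensor_lift D H x (\<lambda>c h.
         tensor_lift D D (\<Delta>\<^bsub>D\<^esub> c) (\<lambda>c1 c2. tensor_lift H H (\<Delta>\<^bsub>H\<^esub> h) (\<lambda>h1 h2.
           tensor_lift D H (\<rho>R c1) (\<lambda>c10 c11. tensor_lift H D (\<rho>L c2) (\<lambda>c2L c20.
             (twist D 0 0 (-1) 0 c10 \<otimes>\<^bsub>D,H\<^esub>
               (twist H s 0 0 t c2L \<cdot>\<^bsub>H\<^esub> twist H 0 (-1) 0 0 h1))
             \<otimes>\<^bsub>tensor_space D H,tensor_space D H\<^esub>
             (twist D 0 0 0 (-1) c20 \<otimes>\<^bsub>D,H\<^esub>
               (twist H (-1) 0 0 0 h2 \<cdot>\<^bsub>H\<^esub> twist H 0 u v 0 c11)))))))),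
     bcounit = (\<lambda>x. tensor_lift D H x (\<lambda>d h. \<epsilon>\<^bsub>D\<^esub> d * \<epsilon>\<^bsub>H\<^esub> h)),
     balpha = (\<lambda>x. tensor_lift D H x (\<lambda>d h. \<alpha>\<^bsub>D\<^esub> d \<otimes>\<^bsub>D,H\<^esub> \<alpha>\<^bsub>H\<^esub> h)),
     bbeta = (\<lambda>x. tensor_lift D H x (\<lambda>d h. \<beta>\<^bsub>D\<^esub> d \<otimes>\<^bsub>D,H\<^esub> \<beta>\<^bsub>H\<^esub> h)),
     bomega = (\<lambda>x. tensor_lift D H x (\<lambda>d h. \<omega>\<^bsub>D\<^esub> d \<otimes>\<^bsub>D,H\<^esub> \<omega>\<^bsub>H\<^esub> h)),
     bpsi = (\<lambda>x. tensor_lift D H x (\<lambda>d h. \<psi>\<^bsub>D\<^esub> d \<otimes>\<^bsub>D,H\<^esub> \<psi>\<^bsub>H\<^esub> h))\<rparr>"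

end

theory Submission
  imports Defs
begin

text \<open>
  All structure maps are invertible, so every BiHom-structure in the statement is a twist of an
  ordinary one. Put \<open>a * b = \<alpha>\<^sup>-\<^sup>1(a) \<beta>\<^sup>-\<^sup>1(b)\<close> and replace \<open>\<Delta>\<close> by \<open>(\<omega>\<^sup>-\<^sup>1 \<otimes> \<psi>\<^sup>-\<^sup>1) \<Delta>\<close>. Then \<open>H\<close> becomes an
  ordinary bialgebra with four commuting bialgebra automorphisms, and \<open>D\<close> an ordinary algebra and
  coalgebra. The actions and coactions can be untwisted in the same way, and in doing so they may
  be composed with further powers of the automorphisms. For the powers that turn the formulas of
  the biproduct into the ordinary ones below, all exponents \<open>m, ..., v\<close> disappear from the
  compatibility conditions as well: \<open>(H, D)\<close> becomes an ordinary L-R-admissible pair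
  (\<open>LR_pair_untwist\<close>).

  For an ordinary pair the product and the coproduct on \<open>D \<otimes> H\<close> are
  \<open>(a \<otimes> h)(b \<otimes> g) = (a \<triangleleft> g\<^sub>2)(h\<^sub>1 \<triangleright> b) \<otimes> h\<^sub>2 g\<^sub>1\<close> and
  \<open>c \<otimes> h \<mapsto> (c\<^sub>1\<^sub>(\<^sub>0\<^sub>) \<otimes> c\<^sub>2\<^sub>[\<^sub>-\<^sub>1\<^sub>] h\<^sub>1) \<otimes> (c\<^sub>2\<^sub>[\<^sub>0\<^sub>] \<otimes> h\<^sub>2 c\<^sub>1\<^sub>(\<^sub>1\<^sub>))\<close>.
  The first is associative because \<open>D\<close> is a bimodule algebra (\<open>smash_assoc\<close>), the second is
  coassociative because \<open>D\<close> is a bicomodule coalgebra (\<open>cosmash_coassoc\<close>). The heart of the matter is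
  that the coproduct is multiplicative (\<open>cosmash_smash\<close>). On one side, the formula for \<open>\<Delta>\<^sub>D(XY)\<close> with
  \<open>X = a \<triangleleft> g\<^sub>2\<close>, \<open>Y = h\<^sub>1 \<triangleright> b\<close> and the rules for coactions of products and of acted-upon elements move
  all components of \<open>g\<close> and \<open>h\<close> to their places. The other side contains in addition
  \<open>a\<^sub>(\<^sub>0\<^sub>) \<triangleleft> b\<^sub>[\<^sub>-\<^sub>1\<^sub>] \<otimes> a\<^sub>(\<^sub>1\<^sub>) \<triangleright> b\<^sub>[\<^sub>0\<^sub>]\<close>, which is \<open>a \<otimes> b\<close> by the last condition on the pair; after this
  cancellation both sides agree.

  Finally the BiHom-biproduct is the twist of this ordinary bialgebra by the automorphisms
  \<open>\<alpha>\<^sub>D \<otimes> \<alpha>\<close>, ..., \<open>\<psi>\<^sub>D \<otimes> \<psi>\<close> (\<open>mE_tens\<close>, \<open>cE_tens\<close>), and each BiHom-axiom follows from its ordinary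
  counterpart and the naturality of product and coproduct under these automorphisms.

  Sweedler computations are carried out with scalars: an element of \<open>V \<otimes> W\<close> is determined by its
  values on bilinear forms, and such a value is a finite sum over a list of pairs (\<open>sw\<close>). Sums over
  lists that do not depend on each other can be interchanged, so the reordering of Sweedler
  components is unconditional, and linearity only matters where an axiom is applied.
\<close>


section \<open>Multilinear forms and Sweedler sums\<close>

definition trilinear_form where
  "trilinear_form A B C f \<longleftrightarrow>
     (\<forall>a\<in>vcarrier A. bilinear_map B C ground (f a)) \<and>
     (\<forall>b\<in>vcarrier B. \<forall>c\<in>vcarrier C. linear_map A ground (\<lambda>a. f a b c))"

definition quadrilinear_form where
  "quadrilinear_form A B C D f \<longleftrightarrow>
     (\<forall>a\<in>vcarrier A. trilinear_form B C D (f a)) \<and>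
     (\<forall>b\<in>vcarrier B. \<forall>c\<in>vcarrier C. \<forall>d\<in>vcarrier D. linear_map A ground (\<lambda>a. f a b c d))"

definition quinquelinear_form where
  "quinquelinear_form A B C D E f \<longleftrightarrow>
     (\<forall>a\<in>vcarrier A. quadrilinear_form B C D E (f a)) \<and>
     (\<forall>b\<in>vcarrier B. \<forall>c\<in>vcarrier C. \<forall>d\<in>vcarrier D. \<forall>e\<in>vcarrier E.
        linear_map A ground (\<lambda>a. f a b c d e))"

definition sexalinear_form where
  "sexalinear_form A B C D E F f \<longleftrightarrow>
     (\<forall>a\<in>vcarrier A. quinquelinear_form B C D E F (f a)) \<and>
     (\<forall>b\<in>vcarrier B. \<forall>c\<in>vcarrier C. \<forall>d\<in>vcarrier D. \<forall>e\<in>vcarrier E. \<forall>g\<in>vcarrier F.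
        linear_map A ground (\<lambda>a. f a b c d e g))"

lemmas multilinear_defs = bilinear_map_def trilinear_form_def quadrilinear_form_def
  quinquelinear_form_def sexalinear_form_def

lemma linear_map_compose:
  "linear_map B C f \<Longrightarrow> linear_map A B g \<Longrightarrow> linear_map A C (\<lambda>x. f (g x))"
  by (auto simp: linear_map_def)

lemma linear_map_id: "linear_map A A (\<lambda>x. x)"
  by (auto simp: linear_map_def)

lemma bilinear_closed:
  "bilinear_map A B C f \<Longrightarrow> a \<in> vcarrier A \<Longrightarrow> b \<in> vcarrier B \<Longrightarrow> f a b \<in> vcarrier C"
  by (auto simp: bilinear_map_def linear_map_def)

lemma bilinear_lin:
  assumes "bilinear_map A B C f"
  shows "\<And>V g b. linear_map V A g \<Longrightarrow> b \<in> vcarrier B \<Longrightarrow> linear_map V C (\<lambda>x. f (g x) b)"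
    and "\<And>V g a. linear_map V B g \<Longrightarrow> a \<in> vcarrier A \<Longrightarrow> linear_map V C (\<lambda>x. f a (g x))"
  subgoal for V g b using assms
    by (intro linear_map_compose[of A _ "\<lambda>z. f z b" V g]) (auto simp: bilinear_map_def)
  subgoal for V g a using assms
    by (intro linear_map_compose[of B _ "f a" V g]) (auto simp: bilinear_map_def)
  done

lemma trilinear_lin:
  assumes "trilinear_form A B C f"
  shows "\<And>V g b c. linear_map V A g \<Longrightarrow> b \<in> vcarrier B \<Longrightarrow> c \<in> vcarrier C \<Longrightarrow>
      linear_map V ground (\<lambda>x. f (g x) b c)"
    and "\<And>V g a c. linear_map V B g \<Longrightarrow> a \<in> vcarrier A \<Longrightarrow> c \<in> vcarrier C \<Longrightarrow>
      linear_map V ground (\<lambda>x. f a (g x) c)"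
    and "\<And>V g a b. linear_map V C g \<Longrightarrow> a \<in> vcarrier A \<Longrightarrow> b \<in> vcarrier B \<Longrightarrow>
      linear_map V ground (\<lambda>x. f a b (g x))"
  subgoal for V g b c using assms
    by (intro linear_map_compose[of A _ "\<lambda>z. f z b c" V g]) (auto simp: trilinear_form_def)
  subgoal for V g a using assms
    by (intro bilinear_lin(1)[where f = "f a"]) (auto simp: trilinear_form_def)
  subgoal for V g a using assms
    by (intro bilinear_lin(2)[where f = "f a"]) (auto simp: trilinear_form_def)
  done

lemma quadrilinear_lin:
  assumes "quadrilinear_form A B C D f"
  shows "\<And>V g b c d. linear_map V A g \<Longrightarrow> b \<in> vcarrier B \<Longrightarrow> c \<in> vcarrier C \<Longrightarrow> d \<in> vcarrier D \<Longrightarrow>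
      linear_map V ground (\<lambda>x. f (g x) b c d)"
    and "\<And>V g a c d. linear_map V B g \<Longrightarrow> a \<in> vcarrier A \<Longrightarrow> c \<in> vcarrier C \<Longrightarrow> d \<in> vcarrier D \<Longrightarrow>
      linear_map V ground (\<lambda>x. f a (g x) c d)"
    and "\<And>V g a b d. linear_map V C g \<Longrightarrow> a \<in> vcarrier A \<Longrightarrow> b \<in> vcarrier B \<Longrightarrow> d \<in> vcarrier D \<Longrightarrow>
      linear_map V ground (\<lambda>x. f a b (g x) d)"
    and "\<And>V g a b c. linear_map V D g \<Longrightarrow> a \<in> vcarrier A \<Longrightarrow> b \<in> vcarrier B \<Longrightarrow> c \<in> vcarrier C \<Longrightarrow>
      linear_map V ground (\<lambda>x. f a b c (g x))"
  subgoal for V g b c d using assms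
    by (intro linear_map_compose[of A _ "\<lambda>z. f z b c d" V g]) (auto simp: quadrilinear_form_def)
  subgoal for V g a using assms
    by (intro trilinear_lin(1)[where f = "f a"]) (auto simp: quadrilinear_form_def)
  subgoal for V g a using assms
    by (intro trilinear_lin(2)[where f = "f a"]) (auto simp: quadrilinear_form_def)
  subgoal for V g a using assms
    by (intro trilinear_lin(3)[where f = "f a"]) (auto simp: quadrilinear_form_def)
  done

lemma quinquelinear_lin:
  assumes "quinquelinear_form A B C D E f"
  shows "\<And>V g b c d e. linear_map V A g \<Longrightarrow> b \<in> vcarrier B \<Longrightarrow> c \<in> vcarrier C \<Longrightarrow> d \<in> vcarrier D \<Longrightarrow>
      e \<in> vcarrier E \<Longrightarrow> linear_map V ground (\<lambda>x. f (g x) b c d e)"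
    and "\<And>V g a c d e. linear_map V B g \<Longrightarrow> a \<in> vcarrier A \<Longrightarrow> c \<in> vcarrier C \<Longrightarrow> d \<in> vcarrier D \<Longrightarrow>
      e \<in> vcarrier E \<Longrightarrow> linear_map V ground (\<lambda>x. f a (g x) c d e)"
    and "\<And>V g a b d e. linear_map V C g \<Longrightarrow> a \<in> vcarrier A \<Longrightarrow> b \<in> vcarrier B \<Longrightarrow> d \<in> vcarrier D \<Longrightarrow>
      e \<in> vcarrier E \<Longrightarrow> linear_map V ground (\<lambda>x. f a b (g x) d e)"
    and "\<And>V g a b c e. linear_map V D g \<Longrightarrow> a \<in> vcarrier A \<Longrightarrow> b \<in> vcarrier B \<Longrightarrow> c \<in> vcarrier C \<Longrightarrow>
      e \<in> vcarrier E \<Longrightarrow> linear_map V ground (\<lambda>x. f a b c (g x) e)"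
    and "\<And>V g a b c d. linear_map V E g \<Longrightarrow> a \<in> vcarrier A \<Longrightarrow> b \<in> vcarrier B \<Longrightarrow> c \<in> vcarrier C \<Longrightarrow>
      d \<in> vcarrier D \<Longrightarrow> linear_map V ground (\<lambda>x. f a b c d (g x))"
  subgoal for V g b c d e using assms
    by (intro linear_map_compose[of A _ "\<lambda>z. f z b c d e" V g]) (auto simp: quinquelinear_form_def)
  subgoal for V g a using assms
    by (intro quadrilinear_lin(1)[where f = "f a"]) (auto simp: quinquelinear_form_def)
  subgoal for V g a using assms
    by (intro quadrilinear_lin(2)[where f = "f a"]) (auto simp: quinquelinear_form_def)
  subgoal for V g a using assms
    by (intro quadrilinear_lin(3)[where f = "f a"]) (auto simp: quinquelinear_form_def)
  subgoal for V g a using assms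
    by (intro quadrilinear_lin(4)[where f = "f a"]) (auto simp: quinquelinear_form_def)
  done

lemma sexalinear_lin:
  assumes "sexalinear_form A B C D E F f"
  shows "\<And>V g b c d e y. linear_map V A g \<Longrightarrow> b \<in> vcarrier B \<Longrightarrow> c \<in> vcarrier C \<Longrightarrow> d \<in> vcarrier D \<Longrightarrow>
      e \<in> vcarrier E \<Longrightarrow> y \<in> vcarrier F \<Longrightarrow> linear_map V ground (\<lambda>x. f (g x) b c d e y)"
    and "\<And>V g a c d e y. linear_map V B g \<Longrightarrow> a \<in> vcarrier A \<Longrightarrow> c \<in> vcarrier C \<Longrightarrow> d \<in> vcarrier D \<Longrightarrow>
      e \<in> vcarrier E \<Longrightarrow> y \<in> vcarrier F \<Longrightarrow> linear_map V ground (\<lambda>x. f a (g x) c d e y)"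
    and "\<And>V g a b d e y. linear_map V C g \<Longrightarrow> a \<in> vcarrier A \<Longrightarrow> b \<in> vcarrier B \<Longrightarrow> d \<in> vcarrier D \<Longrightarrow>
      e \<in> vcarrier E \<Longrightarrow> y \<in> vcarrier F \<Longrightarrow> linear_map V ground (\<lambda>x. f a b (g x) d e y)"
    and "\<And>V g a b c e y. linear_map V D g \<Longrightarrow> a \<in> vcarrier A \<Longrightarrow> b \<in> vcarrier B \<Longrightarrow> c \<in> vcarrier C \<Longrightarrow>
      e \<in> vcarrier E \<Longrightarrow> y \<in> vcarrier F \<Longrightarrow> linear_map V ground (\<lambda>x. f a b c (g x) e y)"
    and "\<And>V g a b c d y. linear_map V E g \<Longrightarrow> a \<in> vcarrier A \<Longrightarrow> b \<in> vcarrier B \<Longrightarrow> c \<in> vcarrier C \<Longrightarrow>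
      d \<in> vcarrier D \<Longrightarrow> y \<in> vcarrier F \<Longrightarrow> linear_map V ground (\<lambda>x. f a b c d (g x) y)"
    and "\<And>V g a b c d e. linear_map V F g \<Longrightarrow> a \<in> vcarrier A \<Longrightarrow> b \<in> vcarrier B \<Longrightarrow> c \<in> vcarrier C \<Longrightarrow>
      d \<in> vcarrier D \<Longrightarrow> e \<in> vcarrier E \<Longrightarrow> linear_map V ground (\<lambda>x. f a b c d e (g x))"
  subgoal for V g b c d e y using assms
    by (intro linear_map_compose[of A _ "\<lambda>z. f z b c d e y" V g]) (auto simp: sexalinear_form_def)
  subgoal for V g a using assms
    by (intro quinquelinear_lin(1)[where f = "f a"]) (auto simp: sexalinear_form_def)
  subgoal for V g a using assms
    by (intro quinquelinear_lin(2)[where f = "f a"]) (auto simp: sexalinear_form_def)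
  subgoal for V g a using assms
    by (intro quinquelinear_lin(3)[where f = "f a"]) (auto simp: sexalinear_form_def)
  subgoal for V g a using assms
    by (intro quinquelinear_lin(4)[where f = "f a"]) (auto simp: sexalinear_form_def)
  subgoal for V g a using assms
    by (intro quinquelinear_lin(5)[where f = "f a"]) (auto simp: sexalinear_form_def)
  done

lemma linear_form_scale:
  "linear_map V ground f \<Longrightarrow> linear_map V ground (\<lambda>x. f x * c)"
  "linear_map V ground f \<Longrightarrow> linear_map V ground (\<lambda>x. c * f x)"
  by (auto simp: linear_map_def ground_def algebra_simps)

text \<open>A list of pairs stands for the sum of its pure tensors, and \<open>sw A B t f\<close> is the value of this
  tensor at the form \<open>f\<close>. Pairs outside the carriers are skipped; this makes the congruence rule
  unconditional, so that the simplifier may use the membership of Sweedler components under every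
  such sum.\<close>
definition sw ::
  "('k, 'a, 'x) vspace_scheme \<Rightarrow> ('k, 'b, 'y) vspace_scheme \<Rightarrow> ('a \<times> 'b) list \<Rightarrow>
   ('a \<Rightarrow> 'b \<Rightarrow> 'k) \<Rightarrow> 'k::field" where
  "sw A B t f = (\<Sum>(a, b)\<leftarrow>filter (\<lambda>(a, b). a \<in> vcarrier A \<and> b \<in> vcarrier B) t. f a b)"

text \<open>For a map that chooses a list for every vector this is the linearity of the induced map into
  \<open>A \<otimes> B\<close>; the chosen lists themselves need not depend linearly on the vector.\<close>
definition sweedler_map where
  "sweedler_map V A B d \<longleftrightarrow>
     (\<forall>f. bilinear_map A B ground f \<longrightarrow> linear_map V ground (\<lambda>x. sw A B (d x) f))"

lemma sw_cong [cong]: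
  "A = A' \<Longrightarrow> B = B' \<Longrightarrow> t = t' \<Longrightarrow>
    (\<And>a b. a \<in> vcarrier A' \<Longrightarrow> b \<in> vcarrier B' \<Longrightarrow> f a b = g a b) \<Longrightarrow> sw A B t f = sw A' B' t' g"
  unfolding sw_def by (auto intro!: arg_cong[where f = sum_list] map_cong)

lemma sw_Nil [simp]: "sw A B [] f = 0"
  by (simp add: sw_def)

lemma sw_Cons: "sw A B (x # t) f =
    (if fst x \<in> vcarrier A \<and> snd x \<in> vcarrier B then f (fst x) (snd x) else 0) + sw A B t f"
  by (auto simp: sw_def split: prod.splits)

lemma sw_add: "sw A B t (\<lambda>a b. f a b + g a b) = sw A B t f + sw A B t g"
  by (induction t) (simp_all add: sw_Cons)

lemma sw_mult:
  "sw A B t (\<lambda>a b. f a b * c) = sw A B t f * c"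
  "sw A B t (\<lambda>a b. c * f a b) = c * sw A B t f"
  by (induction t) (simp_all add: sw_Cons algebra_simps)

lemma sw_zero: "sw A B t (\<lambda>a b. 0) = 0"
  by (induction t) (simp_all add: sw_Cons)

text \<open>The interchange of finite sums is what permits the reordering of independent Sweedler components.
  As a rewrite rule it would loop; with \<open>t\<close> or \<open>u\<close> instantiated to the list of a particular element
  it moves that one sum inwards or outwards past all sums on which it does not depend.\<close>
lemma sw_swap:
  "sw A B t (\<lambda>a b. sw C D u (f a b)) = sw C D u (\<lambda>c d. sw A B t (\<lambda>a b. f a b c d))"
proof (induction t)
  case (Cons x t)
  then show ?case
    by (cases "fst x \<in> vcarrier A"; cases "snd x \<in> vcarrier B") (simp_all add: sw_Cons sw_add)
qed (simp add: sw_zero)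

lemma linear_sw_body:
  assumes "\<And>a b. a \<in> vcarrier A \<Longrightarrow> b \<in> vcarrier B \<Longrightarrow> linear_map V ground (\<lambda>x. f x a b)"
  shows "linear_map V ground (\<lambda>x. sw A B t (f x))"
proof (induction t)
  case (Cons x t)
  then show ?case using assms[of "fst x" "snd x"]
    by (cases "fst x \<in> vcarrier A"; cases "snd x \<in> vcarrier B")
      (simp_all add: sw_Cons linear_map_def ground_def distrib_left)
qed (simp add: linear_map_def ground_def)

lemma linear_sw_arg:
  assumes "sweedler_map W A B d" "linear_map V W g" "bilinear_map A B ground f"
  shows "linear_map V ground (\<lambda>x. sw A B (d (g x)) f)"
  using assms linear_map_compose[of W ground "\<lambda>x. sw A B (d x) f"]
  by (auto simp: sweedler_map_def)

text \<open>Three- and fourfold coproducts are single sums, so that they can be moved as a block. The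
  fourfold coproduct is bracketed as \<open>((x\<^sub>1, x\<^sub>2), (x\<^sub>3, x\<^sub>4))\<close> because this is the shape in which it
  arises when both halves of a coproduct are split again.\<close>
definition sw3 where
  "sw3 V d x f = sw V V (d x) (\<lambda>x1 y. sw V V (d y) (\<lambda>x2 x3. f x1 x2 x3))"

definition sw4 where
  "sw4 V d x f = sw V V (d x) (\<lambda>y z. sw V V (d y) (\<lambda>x1 x2. sw V V (d z) (\<lambda>x3 x4. f x1 x2 x3 x4)))"

lemma sw3_cong [cong]:
  "V = V' \<Longrightarrow> d = d' \<Longrightarrow> x = x' \<Longrightarrow>
    (\<And>a b c. a \<in> vcarrier V' \<Longrightarrow> b \<in> vcarrier V' \<Longrightarrow> c \<in> vcarrier V' \<Longrightarrow> f a b c = g a b c) \<Longrightarrow>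
    sw3 V d x f = sw3 V' d' x' g"
  unfolding sw3_def by (auto intro!: sw_cong)

lemma sw4_cong [cong]:
  "V = V' \<Longrightarrow> d = d' \<Longrightarrow> x = x' \<Longrightarrow>
    (\<And>a b c e. a \<in> vcarrier V' \<Longrightarrow> b \<in> vcarrier V' \<Longrightarrow> c \<in> vcarrier V' \<Longrightarrow> e \<in> vcarrier V' \<Longrightarrow>
      f a b c e = g a b c e) \<Longrightarrow>
    sw4 V d x f = sw4 V' d' x' g"
  unfolding sw4_def by (auto intro!: sw_cong)

lemma sw3_swap:
  "sw3 V d x (\<lambda>x1 x2 x3. sw A B t (f x1 x2 x3)) = sw A B t (\<lambda>a b. sw3 V d x (\<lambda>x1 x2 x3. f x1 x2 x3 a b))"
  unfolding sw3_def by (simp only: sw_swap[where u = t])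

lemma sw3_swap3:
  "sw3 V d x (\<lambda>x1 x2 x3. sw3 W c y (f x1 x2 x3)) =
    sw3 W c y (\<lambda>y1 y2 y3. sw3 V d x (\<lambda>x1 x2 x3. f x1 x2 x3 y1 y2 y3))"
  unfolding sw3_def[of W] by (simp only: sw3_swap)

lemma sw4_swap:
  "sw4 V d x (\<lambda>x1 x2 x3 x4. sw A B t (f x1 x2 x3 x4)) =
    sw A B t (\<lambda>a b. sw4 V d x (\<lambda>x1 x2 x3 x4. f x1 x2 x3 x4 a b))"
  unfolding sw4_def by (simp only: sw_swap[where u = t])

lemma sw4_swap4:
  "sw4 V d x (\<lambda>x1 x2 x3 x4. sw4 W c y (f x1 x2 x3 x4)) =
    sw4 W c y (\<lambda>y1 y2 y3 y4. sw4 V d x (\<lambda>x1 x2 x3 x4. f x1 x2 x3 x4 y1 y2 y3 y4))"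
  unfolding sw4_def[of W] by (simp only: sw4_swap)

lemma linear_sw3_body:
  assumes "\<And>a b c. a \<in> vcarrier W \<Longrightarrow> b \<in> vcarrier W \<Longrightarrow> c \<in> vcarrier W \<Longrightarrow>
    linear_map V ground (\<lambda>x. f x a b c)"
  shows "linear_map V ground (\<lambda>x. sw3 W d y (f x))"
  unfolding sw3_def by (intro linear_sw_body assms)

lemma linear_sw4_body:
  assumes "\<And>a b c e. a \<in> vcarrier W \<Longrightarrow> b \<in> vcarrier W \<Longrightarrow> c \<in> vcarrier W \<Longrightarrow> e \<in> vcarrier W \<Longrightarrow>
    linear_map V ground (\<lambda>x. f x a b c e)"
  shows "linear_map V ground (\<lambda>x. sw4 W d y (f x))"
  unfolding sw4_def by (intro linear_sw_body assms)

section \<open>Ordinary L-R-admissible pairs\<close>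

locale assoc_algebra =
  fixes V :: "('k::field, 'a::ab_group_add, 'x) vspace_scheme"
    and mul :: "'a \<Rightarrow> 'a \<Rightarrow> 'a" and one :: 'a
  assumes vec_space: "vec_space V"
    and mul_bilinear: "bilinear_map V V V mul"
    and one_closed: "one \<in> vcarrier V"
    and mul_assoc: "\<lbrakk>x \<in> vcarrier V; y \<in> vcarrier V; z \<in> vcarrier V\<rbrakk> \<Longrightarrow>
      mul (mul x y) z = mul x (mul y z)"
    and mul_one: "x \<in> vcarrier V \<Longrightarrow> mul x one = x"
    and one_mul: "x \<in> vcarrier V \<Longrightarrow> mul one x = x"

text \<open>The coalgebra axioms are stated for all forms \<open>f\<close>, that is, after pairing both sides with an
  arbitrary form on the target.\<close>
locale sweedler_coalgebra =
  fixes V :: "('k::field, 'a::ab_group_add, 'x) vspace_scheme"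
    and d :: "'a \<Rightarrow> ('a \<times> 'a) list" and e :: "'a \<Rightarrow> 'k"
  assumes d_sweedler: "sweedler_map V V V d"
    and e_linear: "linear_map V ground e"
    and d_counit_right: "\<lbrakk>linear_map V ground fV; x \<in> vcarrier V\<rbrakk> \<Longrightarrow>
      sw V V (d x) (\<lambda>x1 x2. fV x1 * e x2) = fV x"
    and d_counit_left: "\<lbrakk>linear_map V ground fV; x \<in> vcarrier V\<rbrakk> \<Longrightarrow>
      sw V V (d x) (\<lambda>x1 x2. e x1 * fV x2) = fV x"
    and d_coassoc: "\<lbrakk>trilinear_form V V V fVVV; x \<in> vcarrier V\<rbrakk> \<Longrightarrow>
      sw V V (d x) (\<lambda>x1 x2. sw V V (d x1) (\<lambda>x11 x12. fVVV x11 x12 x2)) =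
      sw V V (d x) (\<lambda>x1 x2. sw V V (d x2) (\<lambda>x21 x22. fVVV x1 x21 x22))"

begin

lemma sw3_left:
  "\<lbrakk>trilinear_form V V V f; x \<in> vcarrier V\<rbrakk> \<Longrightarrow>
    sw V V (d x) (\<lambda>y x3. sw V V (d y) (\<lambda>x1 x2. f x1 x2 x3)) = sw3 V d x f"
  using d_coassoc[of f x] by (simp add: sw3_def)

lemma sw3_right:
  "sw V V (d x) (\<lambda>x1 y. sw V V (d y) (\<lambda>x2 x3. f x1 x2 x3)) = sw3 V d x f"
  by (simp add: sw3_def)

text \<open>Rebracketing by coassociativity puts the two inner components side by side; this is where the
  twisted coaction conditions apply.\<close>
lemma sw4_middle:
  assumes "quadrilinear_form V V V V f" "x \<in> vcarrier V"
  shows "sw4 V d x f = sw3 V d x (\<lambda>x1 y x4. sw V V (d y) (\<lambda>x2 x3. f x1 x2 x3 x4))"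
proof -
  note l = linear_map_id linear_sw_arg[OF d_sweedler] linear_sw_body quadrilinear_lin[OF assms(1)]
    multilinear_defs assms(2)
  have "sw4 V d x f = sw V V (d x) (\<lambda>y z. sw V V (d y) (\<lambda>x1 x2.
      (\<lambda>x1 x2 z. sw V V (d z) (f x1 x2)) x1 x2 z))"
    by (simp add: sw4_def)
  also have "\<dots> = sw V V (d x) (\<lambda>x1 y. sw V V (d y) (\<lambda>x2 z. sw V V (d z) (f x1 x2)))"
    by (subst d_coassoc) (simp_all add: l)
  also have "\<dots> = sw V V (d x) (\<lambda>x1 y. sw V V (d y) (\<lambda>z x4. sw V V (d z) (\<lambda>x2 x3. f x1 x2 x3 x4)))"
    by (simp add: d_coassoc l)
  finally show ?thesis by (simp add: sw3_def)
qed

end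

text \<open>The conditions on an admissible pair without structure maps and exponents. They are the axioms
  of a bialgebra and the conditions of \<open>LR_admissible_pair\<close> for identity structure maps; identities
  between tensors are evaluated at arbitrary forms.\<close>
locale LR_pair =
  HA: assoc_algebra H mH uH + HC: sweedler_coalgebra H dH eH +
  DA: assoc_algebra D mD uD + DC: sweedler_coalgebra D dD eD
  for H :: "('k::field, 'h::ab_group_add, 'x) vspace_scheme"
    and mH :: "'h \<Rightarrow> 'h \<Rightarrow> 'h" (infixl "\<odot>" 75) and uH dH eH
    and D :: "('k, 'd::ab_group_add, 'y) vspace_scheme"
    and mD :: "'d \<Rightarrow> 'd \<Rightarrow> 'd" (infixl "\<star>" 75) and uD dD eD +
  fixes lact :: "'h \<Rightarrow> 'd \<Rightarrow> 'd" (infixr "\<triangleright>" 76)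
    and ract :: "'d \<Rightarrow> 'h \<Rightarrow> 'd" (infixl "\<triangleleft>" 76)
    and dL :: "'d \<Rightarrow> ('h \<times> 'd) list" and dR :: "'d \<Rightarrow> ('d \<times> 'h) list"
  assumes dH_mult: "\<lbrakk>bilinear_map H H ground fHH; h \<in> vcarrier H; g \<in> vcarrier H\<rbrakk> \<Longrightarrow>
      sw H H (dH (h \<odot> g)) fHH =
      sw H H (dH h) (\<lambda>h1 h2. sw H H (dH g) (\<lambda>g1 g2. fHH (h1 \<odot> g1) (h2 \<odot> g2)))"
    and dH_one: "bilinear_map H H ground fHH \<Longrightarrow> sw H H (dH uH) fHH = fHH uH uH"
    and eH_mult: "\<lbrakk>h \<in> vcarrier H; g \<in> vcarrier H\<rbrakk> \<Longrightarrow> eH (h \<odot> g) = eH h * eH g"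
    and eH_one: "eH uH = 1"
    and lact_bilinear: "bilinear_map H D D lact"
    and ract_bilinear: "bilinear_map D H D ract"
    and lact_lact: "\<lbrakk>h \<in> vcarrier H; g \<in> vcarrier H; a \<in> vcarrier D\<rbrakk> \<Longrightarrow>
      h \<triangleright> (g \<triangleright> a) = (h \<odot> g) \<triangleright> a"
    and lact_one: "a \<in> vcarrier D \<Longrightarrow> uH \<triangleright> a = a"
    and ract_ract: "\<lbrakk>a \<in> vcarrier D; h \<in> vcarrier H; g \<in> vcarrier H\<rbrakk> \<Longrightarrow>
      (a \<triangleleft> h) \<triangleleft> g = a \<triangleleft> (h \<odot> g)"
    and ract_one: "a \<in> vcarrier D \<Longrightarrow> a \<triangleleft> uH = a"
    and lact_ract: "\<lbrakk>a \<in> vcarrier D; h \<in> vcarrier H; g \<in> vcarrier H\<rbrakk> \<Longrightarrow>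
      (h \<triangleright> a) \<triangleleft> g = h \<triangleright> (a \<triangleleft> g)"
    and lact_mult: "\<lbrakk>linear_map D ground fD; h \<in> vcarrier H; a \<in> vcarrier D; b \<in> vcarrier D\<rbrakk> \<Longrightarrow>
      fD (h \<triangleright> (a \<star> b)) = sw H H (dH h) (\<lambda>h1 h2. fD ((h1 \<triangleright> a) \<star> (h2 \<triangleright> b)))"
    and ract_mult: "\<lbrakk>linear_map D ground fD; h \<in> vcarrier H; a \<in> vcarrier D; b \<in> vcarrier D\<rbrakk> \<Longrightarrow>
      fD ((a \<star> b) \<triangleleft> h) = sw H H (dH h) (\<lambda>h1 h2. fD ((a \<triangleleft> h1) \<star> (b \<triangleleft> h2)))"
    and lact_unit: "h \<in> vcarrier H \<Longrightarrow> h \<triangleright> uD = vscale D (eH h) uD"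
    and ract_unit: "h \<in> vcarrier H \<Longrightarrow> uD \<triangleleft> h = vscale D (eH h) uD"
    and dL_sweedler: "sweedler_map D H D dL"
    and dR_sweedler: "sweedler_map D D H dR"
    and dL_coassoc: "\<lbrakk>trilinear_form H H D fHHD; a \<in> vcarrier D\<rbrakk> \<Longrightarrow>
      sw H D (dL a) (\<lambda>aL a0. sw H H (dH aL) (\<lambda>aL1 aL2. fHHD aL1 aL2 a0)) =
      sw H D (dL a) (\<lambda>aL a0. sw H D (dL a0) (\<lambda>a0L a00. fHHD aL a0L a00))"
    and dR_coassoc: "\<lbrakk>trilinear_form D H H fDHH; a \<in> vcarrier D\<rbrakk> \<Longrightarrow>
      sw D H (dR a) (\<lambda>a0 a1. sw H H (dH a1) (\<lambda>a11 a12. fDHH a0 a11 a12)) =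
      sw D H (dR a) (\<lambda>a0 a1. sw D H (dR a0) (\<lambda>a00 a01. fDHH a00 a01 a1))"
    and dL_dR: "\<lbrakk>trilinear_form H D H fHDH; a \<in> vcarrier D\<rbrakk> \<Longrightarrow>
      sw H D (dL a) (\<lambda>aL a0. sw D H (dR a0) (\<lambda>a00 a01. fHDH aL a00 a01)) =
      sw D H (dR a) (\<lambda>a0 a1. sw H D (dL a0) (\<lambda>a0L a00. fHDH a0L a00 a1))"
    and dL_counit: "\<lbrakk>linear_map D ground fD; a \<in> vcarrier D\<rbrakk> \<Longrightarrow>
      sw H D (dL a) (\<lambda>aL a0. eH aL * fD a0) = fD a"
    and dR_counit: "\<lbrakk>linear_map D ground fD; a \<in> vcarrier D\<rbrakk> \<Longrightarrow>
      sw D H (dR a) (\<lambda>a0 a1. fD a0 * eH a1) = fD a"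
    and dL_comult: "\<lbrakk>trilinear_form H D D fHDD; c \<in> vcarrier D\<rbrakk> \<Longrightarrow>
      sw H D (dL c) (\<lambda>cL c0. sw D D (dD c0) (\<lambda>c01 c02. fHDD cL c01 c02)) =
      sw D D (dD c) (\<lambda>c1 c2. sw H D (dL c1) (\<lambda>c1L c10. sw H D (dL c2) (\<lambda>c2L c20.
        fHDD (c1L \<odot> c2L) c10 c20)))"
    and dR_comult: "\<lbrakk>trilinear_form D D H fDDH; c \<in> vcarrier D\<rbrakk> \<Longrightarrow>
      sw D H (dR c) (\<lambda>c0 cR. sw D D (dD c0) (\<lambda>c01 c02. fDDH c01 c02 cR)) =
      sw D D (dD c) (\<lambda>c1 c2. sw D H (dR c1) (\<lambda>c10 c11. sw D H (dR c2) (\<lambda>c20 c21.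
        fDDH c10 c20 (c11 \<odot> c21))))"
    and dL_counitD: "\<lbrakk>linear_map H ground fH; c \<in> vcarrier D\<rbrakk> \<Longrightarrow>
      sw H D (dL c) (\<lambda>cL c0. fH cL * eD c0) = eD c * fH uH"
    and dR_counitD: "\<lbrakk>linear_map H ground fH; c \<in> vcarrier D\<rbrakk> \<Longrightarrow>
      sw D H (dR c) (\<lambda>c0 cR. eD c0 * fH cR) = eD c * fH uH"
    and eD_one: "eD uD = 1"
    and eD_mult: "\<lbrakk>a \<in> vcarrier D; b \<in> vcarrier D\<rbrakk> \<Longrightarrow> eD (a \<star> b) = eD a * eD b"
    and eD_lact: "\<lbrakk>h \<in> vcarrier H; a \<in> vcarrier D\<rbrakk> \<Longrightarrow> eD (h \<triangleright> a) = eH h * eD a"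
    and eD_ract: "\<lbrakk>h \<in> vcarrier H; a \<in> vcarrier D\<rbrakk> \<Longrightarrow> eD (a \<triangleleft> h) = eH h * eD a"
    and dL_one: "bilinear_map H D ground fHD \<Longrightarrow> sw H D (dL uD) fHD = fHD uH uD"
    and dR_one: "bilinear_map D H ground fDH \<Longrightarrow> sw D H (dR uD) fDH = fDH uD uH"
    and dL_mult: "\<lbrakk>bilinear_map H D ground fHD; a \<in> vcarrier D; b \<in> vcarrier D\<rbrakk> \<Longrightarrow>
      sw H D (dL (a \<star> b)) fHD =
      sw H D (dL a) (\<lambda>aL a0. sw H D (dL b) (\<lambda>bL b0. fHD (aL \<odot> bL) (a0 \<star> b0)))"
    and dR_mult: "\<lbrakk>bilinear_map D H ground fDH; a \<in> vcarrier D; b \<in> vcarrier D\<rbrakk> \<Longrightarrow>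
      sw D H (dR (a \<star> b)) fDH =
      sw D H (dR a) (\<lambda>a0 a1. sw D H (dR b) (\<lambda>b0 b1. fDH (a0 \<star> b0) (a1 \<odot> b1)))"
    and dD_one: "bilinear_map D D ground fDD \<Longrightarrow> sw D D (dD uD) fDD = fDD uD uD"
    and dD_lact: "\<lbrakk>bilinear_map D D ground fDD; h \<in> vcarrier H; a \<in> vcarrier D\<rbrakk> \<Longrightarrow>
      sw D D (dD (h \<triangleright> a)) fDD =
      sw H H (dH h) (\<lambda>h1 h2. sw D D (dD a) (\<lambda>a1 a2. fDD (h1 \<triangleright> a1) (h2 \<triangleright> a2)))"
    and dD_ract: "\<lbrakk>bilinear_map D D ground fDD; h \<in> vcarrier H; a \<in> vcarrier D\<rbrakk> \<Longrightarrow>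
      sw D D (dD (a \<triangleleft> h)) fDD =
      sw D D (dD a) (\<lambda>a1 a2. sw H H (dH h) (\<lambda>h1 h2. fDD (a1 \<triangleleft> h1) (a2 \<triangleleft> h2)))"
    and dD_mult: "\<lbrakk>bilinear_map D D ground fDD; a \<in> vcarrier D; b \<in> vcarrier D\<rbrakk> \<Longrightarrow>
      sw D D (dD (a \<star> b)) fDD =
      sw D D (dD a) (\<lambda>a1 a2. sw D D (dD b) (\<lambda>b1 b2.
        sw H D (dL a2) (\<lambda>a2L a20. sw D H (dR b1) (\<lambda>b10 b11.
          fDD (a1 \<star> (a2L \<triangleright> b10)) ((a20 \<triangleleft> b11) \<star> b2)))))"
    and dL_lact: "\<lbrakk>bilinear_map H D ground fHD; h \<in> vcarrier H; b \<in> vcarrier D\<rbrakk> \<Longrightarrow>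
      sw H H (dH h) (\<lambda>h1 h2. sw H D (dL (h1 \<triangleright> b)) (\<lambda>xL x0. fHD (xL \<odot> h2) x0)) =
      sw H H (dH h) (\<lambda>h1 h2. sw H D (dL b) (\<lambda>bL b0. fHD (h1 \<odot> bL) (h2 \<triangleright> b0)))"
    and dR_lact: "\<lbrakk>bilinear_map D H ground fDH; h \<in> vcarrier H; b \<in> vcarrier D\<rbrakk> \<Longrightarrow>
      sw D H (dR (h \<triangleright> b)) fDH = sw D H (dR b) (\<lambda>b0 b1. fDH (h \<triangleright> b0) b1)"
    and dR_ract: "\<lbrakk>bilinear_map D H ground fDH; g \<in> vcarrier H; a \<in> vcarrier D\<rbrakk> \<Longrightarrow>
      sw H H (dH g) (\<lambda>g1 g2. sw D H (dR (a \<triangleleft> g2)) (\<lambda>x0 x1. fDH x0 (g1 \<odot> x1))) =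
      sw D H (dR a) (\<lambda>a0 a1. sw H H (dH g) (\<lambda>g1 g2. fDH (a0 \<triangleleft> g1) (a1 \<odot> g2)))"
    and dL_ract: "\<lbrakk>bilinear_map H D ground fHD; g \<in> vcarrier H; a \<in> vcarrier D\<rbrakk> \<Longrightarrow>
      sw H D (dL (a \<triangleleft> g)) fHD = sw H D (dL a) (\<lambda>aL a0. fHD aL (a0 \<triangleleft> g))"
    and dR_dL_trivial: "\<lbrakk>bilinear_map D D ground fDD; a \<in> vcarrier D; b \<in> vcarrier D\<rbrakk> \<Longrightarrow>
      sw D H (dR a) (\<lambda>a0 a1. sw H D (dL b) (\<lambda>bL b0. fDD (a0 \<triangleleft> bL) (a1 \<triangleright> b0))) = fDD a b"
begin

lemmas closed = bilinear_closed[OF HA.mul_bilinear] bilinear_closed[OF DA.mul_bilinear]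
  bilinear_closed[OF lact_bilinear] bilinear_closed[OF ract_bilinear] HA.one_closed DA.one_closed

text \<open>Rules that reduce the multilinearity of a composite Sweedler expression to its innermost
  operations: every variable occurs exactly once, so a linearity goal is decomposed along the path
  to that occurrence.\<close>
lemmas lin_intros = linear_map_id bilinear_lin[OF HA.mul_bilinear] bilinear_lin[OF DA.mul_bilinear]
  bilinear_lin[OF lact_bilinear] bilinear_lin[OF ract_bilinear]
  linear_map_compose[OF HC.e_linear] linear_map_compose[OF DC.e_linear] linear_form_scale
  linear_sw_arg[OF HC.d_sweedler] linear_sw_arg[OF DC.d_sweedler]
  linear_sw_arg[OF dL_sweedler] linear_sw_arg[OF dR_sweedler]
  linear_sw_body linear_sw3_body linear_sw4_body

lemmas lin = lin_intros closed multilinear_defs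

abbreviation cH where "cH h \<equiv> sw H H (dH h)"
abbreviation cD where "cD c \<equiv> sw D D (dD c)"
abbreviation cL where "cL c \<equiv> sw H D (dL c)"
abbreviation cR where "cR c \<equiv> sw D H (dR c)"
abbreviation cH3 where "cH3 h \<equiv> sw3 H dH h"
abbreviation cH4 where "cH4 h \<equiv> sw4 H dH h"

text \<open>The product \<open>(a \<otimes> h)(b \<otimes> g)\<close> of the L-R-smash product, evaluated at the form \<open>F\<close>.\<close>
definition smash where
  "smash a h b g F = cH h (\<lambda>h1 h2. cH g (\<lambda>g1 g2. F ((a \<triangleleft> g2) \<star> (h1 \<triangleright> b)) (h2 \<odot> g1)))"

text \<open>The L-R-smash coproduct of \<open>c \<otimes> h\<close>, evaluated at the form \<open>F\<close> in four arguments.\<close>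
definition cosmash where
  "cosmash c h F = cH h (\<lambda>h1 h2. cD c (\<lambda>c1 c2. cR c1 (\<lambda>c10 c11. cL c2 (\<lambda>c2L c20.
     F c10 (c2L \<odot> h1) c20 (h2 \<odot> c11)))))"

text \<open>Both bracketings are brought to the form with threefold coproducts of \<open>h\<close>, \<open>g\<close> and \<open>k\<close>: the left
  one by splitting \<open>k\<^sub>2\<close> over a product of two elements of \<open>D\<close>, the right one by splitting \<open>h\<^sub>1\<close>.
  The bimodule laws then identify the two.\<close>
lemma smash_assoc:
  assumes F: "bilinear_map D H ground F"
    and mem: "a \<in> vcarrier D" "b \<in> vcarrier D" "c \<in> vcarrier D"
      "h \<in> vcarrier H" "g \<in> vcarrier H" "k \<in> vcarrier H"
  shows "smash a h b g (\<lambda>x y. smash x y c k F) = smash b g c k (\<lambda>x y. smash a h x y F)"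
proof -
  note l = lin bilinear_lin[OF F] mem
  have "smash a h b g (\<lambda>x y. smash x y c k F) =
    cH h (\<lambda>h1 h2. cH g (\<lambda>g1 g2. cH h2 (\<lambda>h21 h22. cH g1 (\<lambda>g11 g12. cH k (\<lambda>k1 k2. cH k2 (\<lambda>k21 k22.
      F ((((a \<triangleleft> g2) \<triangleleft> k21) \<star> ((h1 \<triangleright> b) \<triangleleft> k22)) \<star> ((h21 \<odot> g11) \<triangleright> c)) ((h22 \<odot> g12) \<odot> k1)))))))"
    by (simp add: smash_def dH_mult ract_mult[where fD = "\<lambda>z. F (z \<star> _) _"] l)
  also have "\<dots> = cH h (\<lambda>h1 h2. cH h2 (\<lambda>h21 h22. cH g (\<lambda>g1 g2. cH g1 (\<lambda>g11 g12. cH k (\<lambda>k1 k2. cH k2 (\<lambda>k21 k22.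
      F ((((a \<triangleleft> g2) \<triangleleft> k21) \<star> ((h1 \<triangleright> b) \<triangleleft> k22)) \<star> ((h21 \<odot> g11) \<triangleright> c)) ((h22 \<odot> g12) \<odot> k1)))))))"
    by (simp only: sw_swap[where t = "dH g"])
  also have "\<dots> = cH3 h (\<lambda>h1 h2 h3. cH3 g (\<lambda>g1 g2 g3. cH3 k (\<lambda>k1 k2 k3.
      F ((a \<triangleleft> (g3 \<odot> k2)) \<star> (((h1 \<triangleright> b) \<triangleleft> k3) \<star> ((h2 \<odot> g1) \<triangleright> c))) (h3 \<odot> (g2 \<odot> k1)))))"
    by (simp add: HC.sw3_left HC.sw3_right l DA.mul_assoc HA.mul_assoc ract_ract)
  finally have left: "smash a h b g (\<lambda>x y. smash x y c k F) = \<dots>" .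
  have "smash b g c k (\<lambda>x y. smash a h x y F) =
    cH g (\<lambda>g1 g2. cH k (\<lambda>k1 k2. cH h (\<lambda>h1 h2. cH g2 (\<lambda>g21 g22. cH k1 (\<lambda>k11 k12. cH h1 (\<lambda>h11 h12.
      F ((a \<triangleleft> (g22 \<odot> k12)) \<star> ((h11 \<triangleright> (b \<triangleleft> k2)) \<star> (h12 \<triangleright> (g1 \<triangleright> c)))) (h2 \<odot> (g21 \<odot> k11))))))))"
    by (simp add: smash_def dH_mult lact_mult[where fD = "\<lambda>z. F (_ \<star> z) _"] l)
  also have "\<dots> = cH g (\<lambda>g1 g2. cH g2 (\<lambda>g21 g22. cH k (\<lambda>k1 k2. cH k1 (\<lambda>k11 k12. cH h (\<lambda>h1 h2. cH h1 (\<lambda>h11 h12.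
      F ((a \<triangleleft> (g22 \<odot> k12)) \<star> ((h11 \<triangleright> (b \<triangleleft> k2)) \<star> (h12 \<triangleright> (g1 \<triangleright> c)))) (h2 \<odot> (g21 \<odot> k11))))))))"
    by (simp only: sw_swap[where t = "dH h"]) (simp only: sw_swap[where t = "dH k"])
  also have "\<dots> = cH3 g (\<lambda>g1 g2 g3. cH3 k (\<lambda>k1 k2 k3. cH3 h (\<lambda>h1 h2 h3.
      F ((a \<triangleleft> (g3 \<odot> k2)) \<star> (((h1 \<triangleright> b) \<triangleleft> k3) \<star> ((h2 \<odot> g1) \<triangleright> c))) (h3 \<odot> (g2 \<odot> k1)))))"
    by (simp add: HC.sw3_left HC.sw3_right l lact_lact lact_ract)
  also have "\<dots> = cH3 h (\<lambda>h1 h2 h3. cH3 g (\<lambda>g1 g2 g3. cH3 k (\<lambda>k1 k2 k3.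
      F ((a \<triangleleft> (g3 \<odot> k2)) \<star> (((h1 \<triangleright> b) \<triangleleft> k3) \<star> ((h2 \<odot> g1) \<triangleright> c))) (h3 \<odot> (g2 \<odot> k1)))))"
    by (simp only: sw3_swap3[where y = h])
  finally show ?thesis using left by simp
qed

text \<open>An action on \<open>1\<^sub>D\<close> is multiplication by the counit, which absorbs one component of the coproduct
  of \<open>h\<close>.\<close>
lemma smash_one:
  assumes F: "bilinear_map D H ground F" and mem: "a \<in> vcarrier D" "h \<in> vcarrier H"
  shows "smash a h uD uH F = F a h" "smash uD uH a h F = F a h"
proof -
  interpret D: vector_space "vscale D" using DA.vec_space by (simp add: vec_space_def)
  note l = lin bilinear_lin[OF F] mem
  have sc: "x \<star> vscale D r uD = vscale D r x" "vscale D r uD \<star> x = vscale D r x"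
    "F (vscale D r x) y = F x y * r"
    if "x \<in> vcarrier D" "y \<in> vcarrier H" for x y r
    using DA.mul_bilinear F that DA.mul_one[of x] DA.one_mul[of x] DA.one_closed
    by (simp_all add: bilinear_map_def linear_map_def ground_def)
  show "smash a h uD uH F = F a h"
    by (simp add: smash_def dH_one l ract_one lact_unit sc HA.mul_one HC.d_counit_left mult.commute)
  show "smash uD uH a h F = F a h"
    by (simp add: smash_def dH_one l lact_one ract_unit sc HA.one_mul HC.d_counit_right)
qed

lemma cosmash_counit:
  assumes F: "bilinear_map D H ground F" and mem: "c \<in> vcarrier D" "h \<in> vcarrier H"
  shows "cosmash c h (\<lambda>d k d' k'. F d k * (eD d' * eH k')) = F c h"
    and "cosmash c h (\<lambda>d k d' k'. eD d * eH k * F d' k') = F c h"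
proof -
  note l = lin bilinear_lin[OF F] mem
  have "cosmash c h (\<lambda>d k d' k'. F d k * (eD d' * eH k')) =
     cH h (\<lambda>h1 h2. cD c (\<lambda>c1 c2.
       cR c1 (\<lambda>c10 c11. cL c2 (\<lambda>c2L c20. F c10 (c2L \<odot> h1) * eD c20) * eH c11)) * eH h2)"
    by (simp add: cosmash_def eH_mult l sw_mult[symmetric] mult_ac)
  also have "\<dots> = cH h (\<lambda>h1 h2. cD c (\<lambda>c1 c2. eD c2 * F c1 h1) * eH h2)"
    by (simp add: dL_counitD dR_counit l HA.one_mul)
  also have "\<dots> = cH h (\<lambda>h1 h2. cD c (\<lambda>c1 c2. F c1 h1 * eD c2) * eH h2)"
    by (simp add: mult.commute)
  also have "\<dots> = F c h"
    by (simp add: HC.d_counit_right DC.d_counit_right l)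
  finally show "cosmash c h (\<lambda>d k d' k'. F d k * (eD d' * eH k')) = F c h" .
  have "cosmash c h (\<lambda>d k d' k'. eD d * eH k * F d' k') =
     cH h (\<lambda>h1 h2. eH h1 * cD c (\<lambda>c1 c2.
       cL c2 (\<lambda>c2L c20. eH c2L * cR c1 (\<lambda>c10 c11. eD c10 * F c20 (h2 \<odot> c11)))))"
    by (simp add: cosmash_def eH_mult l sw_mult[symmetric] mult_ac sw_swap[where u = "dL _"])
  also have "\<dots> = cH h (\<lambda>h1 h2. eH h1 * cD c (\<lambda>c1 c2. eD c1 * F c2 h2))"
    by (simp add: dR_counitD dL_counit l HA.mul_one)
  also have "\<dots> = F c h"
    by (simp add: HC.d_counit_left DC.d_counit_left l)
  finally show "cosmash c h (\<lambda>d k d' k'. eD d * eH k * F d' k') = F c h" .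
qed

lemma smash_counit:
  assumes mem: "a \<in> vcarrier D" "h \<in> vcarrier H" "b \<in> vcarrier D" "g \<in> vcarrier H"
  shows "smash a h b g (\<lambda>d k. eD d * eH k) = (eD a * eH h) * (eD b * eH g)"
proof -
  note l = lin mem
  have "smash a h b g (\<lambda>d k. eD d * eH k) =
    cH h (\<lambda>h1 h2. eH h1 * eH h2) * cH g (\<lambda>g1 g2. eH g1 * eH g2) * (eD a * eD b)"
    by (simp add: smash_def eD_mult eD_lact eD_ract eH_mult l sw_mult[symmetric] mult_ac)
  also have "\<dots> = (eD a * eH h) * (eD b * eH g)"
    by (simp add: HC.d_counit_left HC.e_linear l mult_ac)
  finally show ?thesis .
qed

lemma cosmash_one:
  assumes F: "quadrilinear_form D H D H F"
  shows "cosmash uD uH F = F uD uH uD uH"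
  by (simp add: cosmash_def dH_one dD_one dL_one dR_one lin quadrilinear_lin[OF F] HA.mul_one)

text \<open>In both iterated coproducts the coaction on a component of \<open>c\<close> meets a coproduct of \<open>D\<close>; the
  compatibility of coactions and coproduct produces the threefold coproduct \<open>c\<^sub>1, c\<^sub>2, c\<^sub>3\<close>. The common
  form has an iterated right coaction on \<open>c\<^sub>1\<close>, a right and a left one on \<open>c\<^sub>2\<close>, and an iterated left
  coaction on \<open>c\<^sub>3\<close>.\<close>
lemma cosmash_coassoc:
  assumes F: "sexalinear_form D H D H D H F" and mem: "c \<in> vcarrier D" "h \<in> vcarrier H"
  shows "cosmash c h (\<lambda>d k d' k'. cosmash d k (\<lambda>e l e' l'. F e l e' l' d' k')) =
    cosmash c h (\<lambda>d k d' k'. cosmash d' k' (\<lambda>e l e' l'. F d k e l e' l'))"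
proof -
  note l = lin sexalinear_lin[OF F] mem
  let ?N = "\<lambda>c1 c2 c3 h1 h2 h3. cR c1 (\<lambda>x c12. cR x (\<lambda>c10 c11. cR c2 (\<lambda>y c21. cL y (\<lambda>c2L c20.
      cL c3 (\<lambda>c3L z. cL z (\<lambda>c3M c30.
        F c10 (c2L \<odot> (c3L \<odot> h1)) c20 (c3M \<odot> (h2 \<odot> c11)) c30 (h3 \<odot> (c12 \<odot> c21))))))))"
  have "cosmash c h (\<lambda>d k d' k'. cosmash d' k' (\<lambda>e l e' l'. F d k e l e' l')) =
    cH h (\<lambda>h1 h'. cD c (\<lambda>c1 c'. cR c1 (\<lambda>c10 y. cL c' (\<lambda>w c''. cH h' (\<lambda>h2 h3. cH y (\<lambda>y1 y2.
      cD c'' (\<lambda>c2 c3. cR c2 (\<lambda>c20 c21. cL c3 (\<lambda>c3L c30.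
        F c10 (w \<odot> h1) c20 (c3L \<odot> (h2 \<odot> y1)) c30 ((h3 \<odot> y2) \<odot> c21))))))))))"
    by (simp add: cosmash_def dH_mult l)
  also have "\<dots> =
    cH h (\<lambda>h1 h'. cD c (\<lambda>c1 c'. cR c1 (\<lambda>c10 y. cL c' (\<lambda>w c''. cD c'' (\<lambda>c2 c3.
      cH h' (\<lambda>h2 h3. cH y (\<lambda>y1 y2. cR c2 (\<lambda>c20 c21. cL c3 (\<lambda>c3L c30.
        F c10 (w \<odot> h1) c20 (c3L \<odot> (h2 \<odot> y1)) c30 ((h3 \<odot> y2) \<odot> c21))))))))))"
    by (simp only: sw_swap[of H H _ D D])
  also have "\<dots> =
    cH h (\<lambda>h1 h'. cD c (\<lambda>c1 c'. cR c1 (\<lambda>c10 y. cD c' (\<lambda>c2 c3. cL c2 (\<lambda>c2L x. cL c3 (\<lambda>z w.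
      cH h' (\<lambda>h2 h3. cH y (\<lambda>y1 y2. cR x (\<lambda>c20 c21. cL w (\<lambda>c3L c30.
        F c10 ((c2L \<odot> z) \<odot> h1) c20 (c3L \<odot> (h2 \<odot> y1)) c30 ((h3 \<odot> y2) \<odot> c21)))))))))))"
    by (simp add: dL_comult l)
  also have "\<dots> =
    cD c (\<lambda>c1 c'. cD c' (\<lambda>c2 c3. cH h (\<lambda>h1 h'. cH h' (\<lambda>h2 h3.
      cR c1 (\<lambda>c10 y. cH y (\<lambda>y1 y2. cL c2 (\<lambda>c2L x. cR x (\<lambda>c20 c21. cL c3 (\<lambda>z w. cL w (\<lambda>c3L c30.
        F c10 ((c2L \<odot> z) \<odot> h1) c20 (c3L \<odot> (h2 \<odot> y1)) c30 ((h3 \<odot> y2) \<odot> c21)))))))))))"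
    by (simp only: sw_swap[of _ _ _ D D])
      (simp only: sw_swap[of D H _ H H] sw_swap[of H D _ H H] sw_swap[of H D _ D H])
  also have "\<dots> = sw3 D dD c (\<lambda>c1 c2 c3. cH3 h (?N c1 c2 c3))"
    by (simp add: DC.sw3_right HC.sw3_right dL_dR dR_coassoc HA.mul_assoc l)
  finally have right: "cosmash c h (\<lambda>d k d' k'. cosmash d' k' (\<lambda>e l e' l'. F d k e l e' l')) = \<dots>" .
  have "cosmash c h (\<lambda>d k d' k'. cosmash d k (\<lambda>e l e' l'. F e l e' l' d' k')) =
    cH h (\<lambda>h' h3. cD c (\<lambda>c' c3. cR c' (\<lambda>x w. cL c3 (\<lambda>y c30. cH y (\<lambda>y1 y2. cH h' (\<lambda>h1 h2.
      cD x (\<lambda>c1 c2. cR c1 (\<lambda>c10 c11. cL c2 (\<lambda>c2L c20.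
        F c10 (c2L \<odot> (y1 \<odot> h1)) c20 ((y2 \<odot> h2) \<odot> c11) c30 (h3 \<odot> w))))))))))"
    by (simp add: cosmash_def dH_mult l)
  also have "\<dots> =
    cH h (\<lambda>h' h3. cD c (\<lambda>c' c3. cR c' (\<lambda>x w. cD x (\<lambda>c1 c2. cL c3 (\<lambda>y c30. cH y (\<lambda>y1 y2. cH h' (\<lambda>h1 h2.
      cR c1 (\<lambda>c10 c11. cL c2 (\<lambda>c2L c20.
        F c10 (c2L \<odot> (y1 \<odot> h1)) c20 ((y2 \<odot> h2) \<odot> c11) c30 (h3 \<odot> w))))))))))"
    by (simp only: sw_swap[of H H _ D D] sw_swap[of H D _ D D])
  also have "\<dots> =
    cH h (\<lambda>h' h3. cD c (\<lambda>c' c3. cD c' (\<lambda>c1 c2. cR c1 (\<lambda>x1 u. cR c2 (\<lambda>x2 v. cL c3 (\<lambda>y c30. cH y (\<lambda>y1 y2. cH h' (\<lambda>h1 h2.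
      cR x1 (\<lambda>c10 c11. cL x2 (\<lambda>c2L c20.
        F c10 (c2L \<odot> (y1 \<odot> h1)) c20 ((y2 \<odot> h2) \<odot> c11) c30 (h3 \<odot> (u \<odot> v))))))))))))"
    by (simp add: dR_comult l)
  also have "\<dots> =
    cD c (\<lambda>c' c3. cD c' (\<lambda>c1 c2. cH h (\<lambda>h' h3. cR c1 (\<lambda>x1 u. cR c2 (\<lambda>x2 v. cL c3 (\<lambda>y c30.
      cH y (\<lambda>y1 y2. cH h' (\<lambda>h1 h2. cR x1 (\<lambda>c10 c11. cL x2 (\<lambda>c2L c20.
        F c10 (c2L \<odot> (y1 \<odot> h1)) c20 ((y2 \<odot> h2) \<odot> c11) c30 (h3 \<odot> (u \<odot> v))))))))))))"
    by (simp only: sw_swap[of _ _ _ D D])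
  also have "\<dots> = cD c (\<lambda>c' c3. cD c' (\<lambda>c1 c2. cH h (\<lambda>h' h3. cH h' (\<lambda>h1 h2. ?N c1 c2 c3 h1 h2 h3))))"
  proof (intro sw_cong refl)
    fix c' c1 c2 c3 h' h3
    assume m: "c1 \<in> vcarrier D" "c2 \<in> vcarrier D" "c3 \<in> vcarrier D"
      "h' \<in> vcarrier H" "h3 \<in> vcarrier H"
    have "cR c1 (\<lambda>x1 u. cR c2 (\<lambda>x2 v. cL c3 (\<lambda>y c30. cH y (\<lambda>y1 y2. cH h' (\<lambda>h1 h2. cR x1 (\<lambda>c10 c11. cL x2 (\<lambda>c2L c20.
        F c10 (c2L \<odot> (y1 \<odot> h1)) c20 ((y2 \<odot> h2) \<odot> c11) c30 (h3 \<odot> (u \<odot> v))))))))) =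
      cH h' (\<lambda>h1 h2. cR c1 (\<lambda>x1 u. cR x1 (\<lambda>c10 c11. cR c2 (\<lambda>x2 v. cL x2 (\<lambda>c2L c20. cL c3 (\<lambda>y c30. cH y (\<lambda>y1 y2.
        F c10 (c2L \<odot> (y1 \<odot> h1)) c20 ((y2 \<odot> h2) \<odot> c11) c30 (h3 \<odot> (u \<odot> v)))))))))"
      by (simp only: sw_swap[where t = "dH h'"]) (simp only: sw_swap[of H H _ H D] sw_swap[of H H _ D H],
         simp only: sw_swap[where t = "dL c3"], simp only: sw_swap[where t = "dR c2"])
    also have "\<dots> = cH h' (\<lambda>h1 h2. ?N c1 c2 c3 h1 h2 h3)"
      by (simp add: dL_coassoc HA.mul_assoc l m)
    finally show "cR c1 (\<lambda>x1 u. cR c2 (\<lambda>x2 v. cL c3 (\<lambda>y c30. cH y (\<lambda>y1 y2. cH h' (\<lambda>h1 h2. cR x1 (\<lambda>c10 c11. cL x2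
        (\<lambda>c2L c20.
        F c10 (c2L \<odot> (y1 \<odot> h1)) c20 ((y2 \<odot> h2) \<odot> c11) c30 (h3 \<odot> (u \<odot> v))))))))) = \<dots>" .
  qed
  also have "\<dots> = sw3 D dD c (\<lambda>c1 c2 c3. cH3 h (?N c1 c2 c3))"
    by (simp add: DC.sw3_left HC.sw3_left l)
  finally show ?thesis using right by simp
qed

text \<open>The components of \<open>\<Delta>\<^sub>D(xy)\<close> are products whose factors are again acted upon. The right coaction passes
  through the left action and the left coaction through the right action, hence only iterated
  coactions on \<open>x\<^sub>2\<close> and \<open>y\<^sub>1\<close> remain, and coassociativity turns them into coproducts in \<open>H\<close>.\<close>
lemma coact_dD_mult:
  assumes F: "quadrilinear_form D H H D F" and mem: "x \<in> vcarrier D" "y \<in> vcarrier D"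
  shows "cD (x \<star> y) (\<lambda>z1 z2. cR z1 (\<lambda>z10 z11. cL z2 (\<lambda>z2L z20. F z10 z11 z2L z20))) =
    cD x (\<lambda>x1 x2. cD y (\<lambda>y1 y2. cR x1 (\<lambda>x10 x11. cL x2 (\<lambda>x2L x20. cR y1 (\<lambda>y10 y11. cL y2 (\<lambda>y2L y20.
      cH y11 (\<lambda>w1 w2. cH x2L (\<lambda>v1 v2.
        F (x10 \<star> (v1 \<triangleright> y10)) (x11 \<odot> w1) (v2 \<odot> y2L) ((x20 \<triangleleft> w2) \<star> y20)))))))))"
proof -
  note l = lin quadrilinear_lin[OF F] mem
  have "cD (x \<star> y) (\<lambda>z1 z2. cR z1 (\<lambda>z10 z11. cL z2 (\<lambda>z2L z20. F z10 z11 z2L z20))) =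
    cD x (\<lambda>x1 x2. cD y (\<lambda>y1 y2. cL x2 (\<lambda>v x2'. cR y1 (\<lambda>y1' w.
      cR x1 (\<lambda>x10 x11. cR y1' (\<lambda>y10 y11. cL x2' (\<lambda>x2L x20. cL y2 (\<lambda>y2L y20.
        F (x10 \<star> (v \<triangleright> y10)) (x11 \<odot> y11) (x2L \<odot> y2L) ((x20 \<triangleleft> w) \<star> y20)))))))))"
    by (simp add: dD_mult dR_mult dR_lact dL_mult dL_ract l)
  also have "\<dots> = cD x (\<lambda>x1 x2. cD y (\<lambda>y1 y2. cR x1 (\<lambda>x10 x11. cL x2 (\<lambda>x2L x20. cR y1 (\<lambda>y10 y11. cL y2 (\<lambda>y2L y20.
      cH y11 (\<lambda>w1 w2. cH x2L (\<lambda>v1 v2.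
        F (x10 \<star> (v1 \<triangleright> y10)) (x11 \<odot> w1) (v2 \<odot> y2L) ((x20 \<triangleleft> w2) \<star> y20)))))))))"
  proof (intro sw_cong refl)
    fix x1 x2 y1 y2 assume m: "x1 \<in> vcarrier D" "x2 \<in> vcarrier D" "y1 \<in> vcarrier D" "y2 \<in> vcarrier D"
    have "cL x2 (\<lambda>v x2'. cR y1 (\<lambda>y1' w.
      cR x1 (\<lambda>x10 x11. cR y1' (\<lambda>y10 y11. cL x2' (\<lambda>x2L x20. cL y2 (\<lambda>y2L y20.
        F (x10 \<star> (v \<triangleright> y10)) (x11 \<odot> y11) (x2L \<odot> y2L) ((x20 \<triangleleft> w) \<star> y20))))))) =
      cR x1 (\<lambda>x10 x11. cL y2 (\<lambda>y2L y20. cR y1 (\<lambda>y1' w. cR y1' (\<lambda>y10 y11. cL x2 (\<lambda>v x2'. cL x2' (\<lambda>x2L x20.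
        F (x10 \<star> (v \<triangleright> y10)) (x11 \<odot> y11) (x2L \<odot> y2L) ((x20 \<triangleleft> w) \<star> y20)))))))"
      by (simp only: sw_swap[where u = "dL y2"])
        (simp only: sw_swap[where u = "dR x1"], simp only: sw_swap[where t = "dL x2"])
    also have "\<dots> = cR x1 (\<lambda>x10 x11. cL y2 (\<lambda>y2L y20. cR y1 (\<lambda>y10 y11. cH y11 (\<lambda>w1 w2. cL x2 (\<lambda>x2L x20. cH x2L (\<lambda>v1 v2.
        F (x10 \<star> (v1 \<triangleright> y10)) (x11 \<odot> w1) (v2 \<odot> y2L) ((x20 \<triangleleft> w2) \<star> y20)))))))"
      by (simp add: dL_coassoc dR_coassoc l m)
    also have "\<dots> = cR x1 (\<lambda>x10 x11. cL x2 (\<lambda>x2L x20. cR y1 (\<lambda>y10 y11. cL y2 (\<lambda>y2L y20.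
      cH y11 (\<lambda>w1 w2. cH x2L (\<lambda>v1 v2.
        F (x10 \<star> (v1 \<triangleright> y10)) (x11 \<odot> w1) (v2 \<odot> y2L) ((x20 \<triangleleft> w2) \<star> y20)))))))"
      by (simp only: sw_swap[where t = "dL y2"]) (simp only: sw_swap[of H H _ H D] sw_swap[of H D _ D H])
    finally show "cL x2 (\<lambda>v x2'. cR y1 (\<lambda>y1' w.
      cR x1 (\<lambda>x10 x11. cR y1' (\<lambda>y10 y11. cL x2' (\<lambda>x2L x20. cL y2 (\<lambda>y2L y20.
        F (x10 \<star> (v \<triangleright> y10)) (x11 \<odot> y11) (x2L \<odot> y2L) ((x20 \<triangleleft> w) \<star> y20))))))) = \<dots>" .
  qed
  finally show ?thesis .
qed

text \<open>The right coaction of \<open>a \<triangleleft> g\<^sub>3\<close> is only known in the presence of the factor \<open>g\<^sub>2\<close>, so the two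
  inner components of \<open>g\<close> are first brought together. The left coaction of \<open>b \<triangleleft> g\<^sub>4\<close> needs no such
  factor.\<close>
lemma coact_ract_twisted:
  assumes F: "quinquelinear_form H H D H D F"
    and mem: "g \<in> vcarrier H" "a \<in> vcarrier D" "b \<in> vcarrier D"
  shows "cH4 g (\<lambda>g1 g2 g3 g4. cR (a \<triangleleft> g3) (\<lambda>a0 a1. cL (b \<triangleleft> g4) (\<lambda>bL b0.
      F g1 (g2 \<odot> a1) a0 bL b0))) =
    cR a (\<lambda>a0 a1. cL b (\<lambda>bL b0. cH4 g (\<lambda>g1 g2 g3 g4. F g1 (a1 \<odot> g3) (a0 \<triangleleft> g2) bL (b0 \<triangleleft> g4))))"
proof -
  note l = lin quinquelinear_lin[OF F] mem
  have "cH4 g (\<lambda>g1 g2 g3 g4. cR (a \<triangleleft> g3) (\<lambda>a0 a1. cL (b \<triangleleft> g4) (\<lambda>bL b0.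
      F g1 (g2 \<odot> a1) a0 bL b0))) =
    cH3 g (\<lambda>g1 y g4. cH y (\<lambda>g2 g3. cR (a \<triangleleft> g3) (\<lambda>a0 a1. cL b (\<lambda>bL b0.
      F g1 (g2 \<odot> a1) a0 bL (b0 \<triangleleft> g4)))))"
    by (simp add: HC.sw4_middle dL_ract l)
  also have "\<dots> = cH3 g (\<lambda>g1 y g4. cR a (\<lambda>a0 a1. cH y (\<lambda>g2 g3. cL b (\<lambda>bL b0.
      F g1 (a1 \<odot> g3) (a0 \<triangleleft> g2) bL (b0 \<triangleleft> g4)))))"
    by (simp add: dR_ract[where fDH = "\<lambda>x0 z. cL b (\<lambda>bL b0. F _ z x0 bL (b0 \<triangleleft> _))"] l)
  also have "\<dots> = cR a (\<lambda>a0 a1. cL b (\<lambda>bL b0. cH3 g (\<lambda>g1 y g4. cH y (\<lambda>g2 g3.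
      F g1 (a1 \<odot> g3) (a0 \<triangleleft> g2) bL (b0 \<triangleleft> g4)))))"
    by (simp only: sw_swap[where u = "dL b"] sw3_swap)
      (simp only: sw_swap[where u = "dR a"] sw3_swap)?
  also have "\<dots> = cR a (\<lambda>a0 a1. cL b (\<lambda>bL b0. cH4 g (\<lambda>g1 g2 g3 g4.
      F g1 (a1 \<odot> g3) (a0 \<triangleleft> g2) bL (b0 \<triangleleft> g4))))"
    by (simp add: HC.sw4_middle l)
  finally show ?thesis .
qed

text \<open>The mirror image: now the left coaction of \<open>h\<^sub>2 \<triangleright> b\<close> needs the factor \<open>h\<^sub>3\<close>.\<close>
lemma coact_lact_twisted:
  assumes F: "quinquelinear_form D H H D H F"
    and mem: "h \<in> vcarrier H" "a \<in> vcarrier D" "b \<in> vcarrier D"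
  shows "cH4 h (\<lambda>h1 h2 h3 h4. cR (h1 \<triangleright> a) (\<lambda>a0 a1. cL (h2 \<triangleright> b) (\<lambda>bL b0.
      F a0 a1 (bL \<odot> h3) b0 h4))) =
    cR a (\<lambda>a0 a1. cL b (\<lambda>bL b0. cH4 h (\<lambda>h1 h2 h3 h4. F (h1 \<triangleright> a0) a1 (h2 \<odot> bL) (h3 \<triangleright> b0) h4)))"
proof -
  note l = lin quinquelinear_lin[OF F] mem
  have "cH4 h (\<lambda>h1 h2 h3 h4. cR (h1 \<triangleright> a) (\<lambda>a0 a1. cL (h2 \<triangleright> b) (\<lambda>bL b0.
      F a0 a1 (bL \<odot> h3) b0 h4))) =
    cH3 h (\<lambda>h1 y h4. cH y (\<lambda>h2 h3. cR a (\<lambda>a0 a1. cL (h2 \<triangleright> b) (\<lambda>bL b0.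
      F (h1 \<triangleright> a0) a1 (bL \<odot> h3) b0 h4))))"
    by (simp add: HC.sw4_middle dR_lact l)
  also have "\<dots> = cH3 h (\<lambda>h1 y h4. cR a (\<lambda>a0 a1. cH y (\<lambda>h2 h3. cL (h2 \<triangleright> b) (\<lambda>bL b0.
      F (h1 \<triangleright> a0) a1 (bL \<odot> h3) b0 h4))))"
    by (simp only: sw_swap[where u = "dR a"])
  also have "\<dots> = cH3 h (\<lambda>h1 y h4. cR a (\<lambda>a0 a1. cH y (\<lambda>h2 h3. cL b (\<lambda>bL b0.
      F (h1 \<triangleright> a0) a1 (h2 \<odot> bL) (h3 \<triangleright> b0) h4))))"
    by (simp add: dL_lact[where fHD = "\<lambda>z x0. F _ _ z x0 _"] l)
  also have "\<dots> = cR a (\<lambda>a0 a1. cL b (\<lambda>bL b0. cH3 h (\<lambda>h1 y h4. cH y (\<lambda>h2 h3.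
      F (h1 \<triangleright> a0) a1 (h2 \<odot> bL) (h3 \<triangleright> b0) h4))))"
    by (simp only: sw_swap[of H H _ H D] sw3_swap)
  also have "\<dots> = cR a (\<lambda>a0 a1. cL b (\<lambda>bL b0. cH4 h (\<lambda>h1 h2 h3 h4.
      F (h1 \<triangleright> a0) a1 (h2 \<odot> bL) (h3 \<triangleright> b0) h4)))"
    by (simp add: HC.sw4_middle l)
  finally show ?thesis .
qed

text \<open>Coassociativity of the coactions puts next to each other the two components to which the
  condition \<open>a\<^sub>(\<^sub>0\<^sub>) \<triangleleft> b\<^sub>[\<^sub>-\<^sub>1\<^sub>] \<otimes> a\<^sub>(\<^sub>1\<^sub>) \<triangleright> b\<^sub>[\<^sub>0\<^sub>] = a \<otimes> b\<close> applies; the outer components stay free.\<close>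
lemma dR_dL_trivial_coassoc:
  assumes F: "quadrilinear_form D D H H F" and mem: "a \<in> vcarrier D" "b \<in> vcarrier D"
  shows "cR a (\<lambda>a0 a1. cL b (\<lambda>bL b0. cH a1 (\<lambda>a11 a12. cH bL (\<lambda>bL1 bL2.
      F (a0 \<triangleleft> bL2) (a11 \<triangleright> b0) bL1 a12)))) =
    cR a (\<lambda>a0 a1. cL b (\<lambda>bL b0. F a0 b0 bL a1))"
proof -
  note l = lin quadrilinear_lin[OF F] mem
  have "cR a (\<lambda>a0 a1. cL b (\<lambda>bL b0. cH a1 (\<lambda>a11 a12. cH bL (\<lambda>bL1 bL2.
      F (a0 \<triangleleft> bL2) (a11 \<triangleright> b0) bL1 a12)))) =
    cR a (\<lambda>a0 a1. cH a1 (\<lambda>a11 a12. cL b (\<lambda>bL b0. cH bL (\<lambda>bL1 bL2.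
      F (a0 \<triangleleft> bL2) (a11 \<triangleright> b0) bL1 a12))))"
    by (simp only: sw_swap[where t = "dL b"])
  also have "\<dots> = cR a (\<lambda>a' a1. cR a' (\<lambda>a0 a01. cL b (\<lambda>bL b'. cL b' (\<lambda>b0L b0.
      F (a0 \<triangleleft> b0L) (a01 \<triangleright> b0) bL a1))))"
    by (simp add: dR_coassoc dL_coassoc l)
  also have "\<dots> = cR a (\<lambda>a' a1. cL b (\<lambda>bL b'. cR a' (\<lambda>a0 a01. cL b' (\<lambda>b0L b0.
      F (a0 \<triangleleft> b0L) (a01 \<triangleright> b0) bL a1))))"
    by (simp only: sw_swap[where t = "dL b"])
  also have "\<dots> = cR a (\<lambda>a0 a1. cL b (\<lambda>bL b0. F a0 b0 bL a1))"
    by (simp add: dR_dL_trivial[where fDD = "\<lambda>x y. F x y _ _"] l)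
  finally show ?thesis .
qed

text \<open>Multiplicativity of the coproduct. Both sides are rewritten to sums over the coproducts of \<open>a\<close>
  and \<open>b\<close>, the fourfold coproducts of \<open>h\<close> and \<open>g\<close>, one coaction on each of \<open>a\<^sub>1, a\<^sub>2, b\<^sub>1, b\<^sub>2\<close>, and the
  coproducts of \<open>a\<^sub>2\<^sub>[\<^sub>-\<^sub>1\<^sub>]\<close> and \<open>b\<^sub>1\<^sub>(\<^sub>1\<^sub>)\<close>; the summand is the one in \<open>?N\<close>.\<close>
theorem cosmash_smash:
  assumes F: "quadrilinear_form D H D H F"
    and mem: "a \<in> vcarrier D" "h \<in> vcarrier H" "b \<in> vcarrier D" "g \<in> vcarrier H"
  shows "smash a h b g (\<lambda>c k. cosmash c k F) =
    cosmash a h (\<lambda>a' h' a'' h''. cosmash b g (\<lambda>b' g' b'' g''.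
      smash a' h' b' g' (\<lambda>x y. smash a'' h'' b'' g'' (\<lambda>z w. F x y z w))))"
proof -
  note l = lin quadrilinear_lin[OF F] mem
  let ?N = "\<lambda>a1 a2 b1 b2. cR a1 (\<lambda>a10 a11. cL a2 (\<lambda>a2L a20. cR b1 (\<lambda>b10 b11. cL b2 (\<lambda>b2L b20.
    cH4 h (\<lambda>h1 h2 h3 h4. cH b11 (\<lambda>w1 w2. cH a2L (\<lambda>v1 v2. cH4 g (\<lambda>g1 g2 g3 g4.
      F ((a10 \<triangleleft> g2) \<star> ((v1 \<odot> h1) \<triangleright> b10)) (v2 \<odot> (h2 \<odot> (b2L \<odot> g1)))
        ((a20 \<triangleleft> (g4 \<odot> w2)) \<star> (h3 \<triangleright> b20)) (h4 \<odot> (a11 \<odot> (g3 \<odot> w1)))))))))))"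
  \<comment> \<open>The left side: \<open>p, q\<close> and \<open>r, s\<close> are the halves of \<open>\<Delta>(h)\<close> and \<open>\<Delta>(g)\<close>; each half is split
    once more, \<open>q\<close> and \<open>r\<close> by \<open>\<Delta>(h\<^sub>2 g\<^sub>1)\<close>, \<open>p\<close> and \<open>s\<close> by the actions.\<close>
  have "smash a h b g (\<lambda>c k. cosmash c k F) =
    cH h (\<lambda>p q. cH g (\<lambda>r s. cH q (\<lambda>h3 h4. cH r (\<lambda>g1 g2. cD a (\<lambda>a1 a2. cH s (\<lambda>g3 g4. cH p (\<lambda>h1 h2.
      cD b (\<lambda>b1 b2. cR (a1 \<triangleleft> g3) (\<lambda>x0 x1. cL (a2 \<triangleleft> g4) (\<lambda>xL x20.
      cR (h1 \<triangleright> b1) (\<lambda>y0 y1. cL (h2 \<triangleright> b2) (\<lambda>yL y20. cH y1 (\<lambda>w1 w2. cH xL (\<lambda>v1 v2.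
        F (x0 \<star> (v1 \<triangleright> y0)) ((v2 \<odot> yL) \<odot> (h3 \<odot> g1)) ((x20 \<triangleleft> w2) \<star> y20) ((h4 \<odot> g2) \<odot> (x1 \<odot> w1))))))))))))))))"
    by (simp add: smash_def cosmash_def dH_mult coact_dD_mult dD_ract dD_lact l)
  also have "\<dots> = cD a (\<lambda>a1 a2. cD b (\<lambda>b1 b2. cH h (\<lambda>p q. cH g (\<lambda>r s. cH q (\<lambda>h3 h4. cH r (\<lambda>g1 g2. cH s
      (\<lambda>g3 g4. cH p (\<lambda>h1 h2.
      cR (a1 \<triangleleft> g3) (\<lambda>x0 x1. cL (a2 \<triangleleft> g4) (\<lambda>xL x20.
      cR (h1 \<triangleright> b1) (\<lambda>y0 y1. cL (h2 \<triangleright> b2) (\<lambda>yL y20. cH y1 (\<lambda>w1 w2. cH xL (\<lambda>v1 v2.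
        F (x0 \<star> (v1 \<triangleright> y0)) (v2 \<odot> ((yL \<odot> h3) \<odot> g1)) ((x20 \<triangleleft> w2) \<star> y20) (h4 \<odot> ((g2 \<odot> x1) \<odot> w1))))))))))))))))"
    \<comment> \<open>Associativity isolates \<open>y\<^sub>2\<^sub>[\<^sub>-\<^sub>1\<^sub>] h\<^sub>3\<close> and \<open>g\<^sub>2 x\<^sub>1\<^sub>(\<^sub>1\<^sub>)\<close>, the factors in the twisted coaction rules.\<close>
    by (simp only: sw_swap[of H H _ D D]) (simp add: HA.mul_assoc closed)
  also have "\<dots> = cD a (\<lambda>a1 a2. cD b (\<lambda>b1 b2. cH4 h (\<lambda>h1 h2 h3 h4. cH4 g (\<lambda>g1 g2 g3 g4.
      cR (a1 \<triangleleft> g3) (\<lambda>x0 x1. cL (a2 \<triangleleft> g4) (\<lambda>xL x20.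
      cR (h1 \<triangleright> b1) (\<lambda>y0 y1. cL (h2 \<triangleright> b2) (\<lambda>yL y20. cH y1 (\<lambda>w1 w2. cH xL (\<lambda>v1 v2.
        F (x0 \<star> (v1 \<triangleright> y0)) (v2 \<odot> ((yL \<odot> h3) \<odot> g1)) ((x20 \<triangleleft> w2) \<star> y20) (h4 \<odot> ((g2 \<odot> x1) \<odot> w1))))))))))))"
    unfolding sw4_def
  proof (rule sw_cong[OF refl refl refl], rule sw_cong[OF refl refl refl], rule sw_cong[OF refl refl refl],
      goal_cases)
    case (1 a1 a2 b1 b2 p q)
    show ?case by (simp only: sw_swap[where u = "dH q"]) (simp only: sw_swap[where u = "dH p"])
  qed
  also have "\<dots> = cD a (\<lambda>a1 a2. cD b (\<lambda>b1 b2. cH4 h (\<lambda>h1 h2 h3 h4.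
      cR a1 (\<lambda>x0 x1. cL a2 (\<lambda>xL x20. cH4 g (\<lambda>g1 g2 g3 g4.
      cR (h1 \<triangleright> b1) (\<lambda>y0 y1. cL (h2 \<triangleright> b2) (\<lambda>yL y20. cH y1 (\<lambda>w1 w2. cH xL (\<lambda>v1 v2.
        F ((x0 \<triangleleft> g2) \<star> (v1 \<triangleright> y0)) (v2 \<odot> ((yL \<odot> h3) \<odot> g1)) (((x20 \<triangleleft> g4) \<triangleleft> w2) \<star> y20) (h4 \<odot> ((x1 \<odot> g3) \<odot> w1))))))))))))"
    by (simp add: l coact_ract_twisted[where F = "\<lambda>g1 z x0 xL x20.
      cR _ (\<lambda>y0 y1. cL _ (\<lambda>yL y20. cH y1 (\<lambda>w1 w2. cH xL (\<lambda>v1 v2.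
        F (x0 \<star> (v1 \<triangleright> y0)) (v2 \<odot> ((yL \<odot> _) \<odot> g1)) ((x20 \<triangleleft> w2) \<star> y20) (_ \<odot> (z \<odot> w1))))))"])
  also have "\<dots> = cD a (\<lambda>a1 a2. cD b (\<lambda>b1 b2. cR a1 (\<lambda>x0 x1. cL a2 (\<lambda>xL x20. cH4 h (\<lambda>h1 h2 h3 h4.
      cR (h1 \<triangleright> b1) (\<lambda>y0 y1. cL (h2 \<triangleright> b2) (\<lambda>yL y20. cH y1 (\<lambda>w1 w2. cH xL (\<lambda>v1 v2. cH4 g (\<lambda>g1 g2 g3 g4.
        F ((x0 \<triangleleft> g2) \<star> (v1 \<triangleright> y0)) (v2 \<odot> ((yL \<odot> h3) \<odot> g1)) (((x20 \<triangleleft> g4) \<triangleleft> w2) \<star> y20) (h4 \<odot> ((x1 \<odot> g3) \<odot> w1))))))))))))"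
    by (simp only: sw4_swap)
  also have "\<dots> = cD a (\<lambda>a1 a2. cD b (\<lambda>b1 b2. cR a1 (\<lambda>x0 x1. cL a2 (\<lambda>xL x20. cR b1 (\<lambda>y0 y1. cL b2 (\<lambda>yL y20.
      cH4 h (\<lambda>h1 h2 h3 h4. cH y1 (\<lambda>w1 w2. cH xL (\<lambda>v1 v2. cH4 g (\<lambda>g1 g2 g3 g4.
        F ((x0 \<triangleleft> g2) \<star> (v1 \<triangleright> (h1 \<triangleright> y0))) (v2 \<odot> ((h2 \<odot> yL) \<odot> g1)) (((x20 \<triangleleft> g4) \<triangleleft> w2) \<star> (h3 \<triangleright> y20)) (h4 \<odot> ((x1 \<odot>
            g3) \<odot> w1))))))))))))"
    by (simp add: l coact_lact_twisted[where F = "\<lambda>y0 y1 z y20 h4. cH y1 (\<lambda>w1 w2. cH _ (\<lambda>v1 v2. cH4 g (\<lambda>g1 g2 g3 g4.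
        F ((_ \<triangleleft> g2) \<star> (v1 \<triangleright> y0)) (v2 \<odot> (z \<odot> g1)) (((_ \<triangleleft> g4) \<triangleleft> w2) \<star> y20) (h4 \<odot> ((_ \<odot> g3) \<odot> w1)))))"])
  also have "\<dots> = cD a (\<lambda>a1 a2. cD b (\<lambda>b1 b2. ?N a1 a2 b1 b2))"
    by (simp add: closed HA.mul_assoc lact_lact ract_ract)
  finally have left: "smash a h b g (\<lambda>c k. cosmash c k F) = \<dots>" .
  \<comment> \<open>The right side: here also \<open>a\<^sub>1\<^sub>(\<^sub>1\<^sub>)\<close> and \<open>b\<^sub>2\<^sub>[\<^sub>-\<^sub>1\<^sub>]\<close> are split, into \<open>u\<^sub>1, u\<^sub>2\<close> and \<open>z\<^sub>1, z\<^sub>2\<close>.\<close>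
  have "cosmash a h (\<lambda>a' h' a'' h''. cosmash b g (\<lambda>b' g' b'' g''.
      smash a' h' b' g' (\<lambda>x y. smash a'' h'' b'' g'' (\<lambda>z w. F x y z w)))) =
    cH h (\<lambda>p q. cD a (\<lambda>a1 a2. cR a1 (\<lambda>a10 a11. cL a2 (\<lambda>a2L a20.
      cH g (\<lambda>r s. cD b (\<lambda>b1 b2. cR b1 (\<lambda>b10 b11. cL b2 (\<lambda>b2L b20.
        cH a2L (\<lambda>v1 v2. cH p (\<lambda>h1 h2. cH b2L (\<lambda>z1 z2. cH r (\<lambda>g1 g2.
          cH q (\<lambda>h3 h4. cH a11 (\<lambda>u1 u2. cH s (\<lambda>g3 g4. cH b11 (\<lambda>w1 w2.
      F ((a10 \<triangleleft> (z2 \<odot> g2)) \<star> ((v1 \<odot> h1) \<triangleright> b10)) ((v2 \<odot> h2) \<odot> (z1 \<odot> g1))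
        ((a20 \<triangleleft> (g4 \<odot> w2)) \<star> ((h3 \<odot> u1) \<triangleright> b20)) ((h4 \<odot> u2) \<odot> (g3 \<odot> w1))))))))))))))))))"
    by (simp add: smash_def cosmash_def dH_mult l)
  also have "\<dots> =
    cD a (\<lambda>a1 a2. cD b (\<lambda>b1 b2. cH h (\<lambda>p q. cR a1 (\<lambda>a10 a11. cL a2 (\<lambda>a2L a20.
      cH g (\<lambda>r s. cR b1 (\<lambda>b10 b11. cL b2 (\<lambda>b2L b20.
        cH a2L (\<lambda>v1 v2. cH p (\<lambda>h1 h2. cH b2L (\<lambda>z1 z2. cH r (\<lambda>g1 g2.
          cH q (\<lambda>h3 h4. cH a11 (\<lambda>u1 u2. cH s (\<lambda>g3 g4. cH b11 (\<lambda>w1 w2.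
      F (((a10 \<triangleleft> z2) \<triangleleft> g2) \<star> ((v1 \<odot> h1) \<triangleright> b10)) (v2 \<odot> (h2 \<odot> (z1 \<odot> g1)))
        ((a20 \<triangleleft> (g4 \<odot> w2)) \<star> (h3 \<triangleright> (u1 \<triangleright> b20))) (h4 \<odot> (u2 \<odot> (g3 \<odot> w1)))))))))))))))))))"
    by (simp only: sw_swap[of H H _ D D] sw_swap[of H D _ D D] sw_swap[of D H _ D D])
      (simp add: closed HA.mul_assoc lact_lact ract_ract)
  also have "\<dots> = cD a (\<lambda>a1 a2. cD b (\<lambda>b1 b2. ?N a1 a2 b1 b2))"
  proof (intro sw_cong refl)
    fix a1 a2 b1 b2
    assume m: "a1 \<in> vcarrier D" "a2 \<in> vcarrier D" "b1 \<in> vcarrier D" "b2 \<in> vcarrier D"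
    let ?B = "\<lambda>a10 u1 u2 z1 z2 b20 a20 b10 h1 h2 h3 h4 g1 g2 g3 g4 v1 v2 w1 w2.
      F (((a10 \<triangleleft> z2) \<triangleleft> g2) \<star> ((v1 \<odot> h1) \<triangleright> b10)) (v2 \<odot> (h2 \<odot> (z1 \<odot> g1)))
        ((a20 \<triangleleft> (g4 \<odot> w2)) \<star> (h3 \<triangleright> (u1 \<triangleright> b20))) (h4 \<odot> (u2 \<odot> (g3 \<odot> w1)))"
    have "cH h (\<lambda>p q. cR a1 (\<lambda>a10 a11. cL a2 (\<lambda>a2L a20. cH g (\<lambda>r s. cR b1 (\<lambda>b10 b11. cL b2 (\<lambda>b2L b20.
        cH a2L (\<lambda>v1 v2. cH p (\<lambda>h1 h2. cH b2L (\<lambda>z1 z2. cH r (\<lambda>g1 g2.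
          cH q (\<lambda>h3 h4. cH a11 (\<lambda>u1 u2. cH s (\<lambda>g3 g4. cH b11 (\<lambda>w1 w2.
          ?B a10 u1 u2 z1 z2 b20 a20 b10 h1 h2 h3 h4 g1 g2 g3 g4 v1 v2 w1 w2)))))))))))))) =
      cH g (\<lambda>r s. cH h (\<lambda>p q. cR a1 (\<lambda>a10 a11. cL a2 (\<lambda>a2L a20. cR b1 (\<lambda>b10 b11. cL b2 (\<lambda>b2L b20.
        cH a2L (\<lambda>v1 v2. cH p (\<lambda>h1 h2. cH b2L (\<lambda>z1 z2. cH r (\<lambda>g1 g2.
          cH q (\<lambda>h3 h4. cH a11 (\<lambda>u1 u2. cH s (\<lambda>g3 g4. cH b11 (\<lambda>w1 w2.
          ?B a10 u1 u2 z1 z2 b20 a20 b10 h1 h2 h3 h4 g1 g2 g3 g4 v1 v2 w1 w2))))))))))))))"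
      by (simp only: sw_swap[where u = "dH g"])
    also have "\<dots> = cH g (\<lambda>r s. cH h (\<lambda>p q. cH r (\<lambda>g1 g2. cH s (\<lambda>g3 g4. cH p (\<lambda>h1 h2. cH q (\<lambda>h3 h4.
        cL a2 (\<lambda>a2L a20. cR b1 (\<lambda>b10 b11. cR a1 (\<lambda>a10 a11. cL b2 (\<lambda>b2L b20.
        cH a2L (\<lambda>v1 v2. cH b2L (\<lambda>z1 z2. cH a11 (\<lambda>u1 u2. cH b11 (\<lambda>w1 w2.
          ?B a10 u1 u2 z1 z2 b20 a20 b10 h1 h2 h3 h4 g1 g2 g3 g4 v1 v2 w1 w2))))))))))))))"
    proof (rule sw_cong[OF refl refl refl], rule sw_cong[OF refl refl refl], goal_cases)
      case (1 r s p q)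
      show ?case
        by (simp only: sw_swap[where u = "dR b1"], simp only: sw_swap[where u = "dL a2"],
          simp only: sw_swap[where u = "dH q"], simp only: sw_swap[where u = "dH p"],
          simp only: sw_swap[where u = "dH s"], simp only: sw_swap[where u = "dH r"])
    qed
    also have "\<dots> = cH4 g (\<lambda>g1 g2 g3 g4. cH4 h (\<lambda>h1 h2 h3 h4. cL a2 (\<lambda>a2L a20. cR b1 (\<lambda>b10 b11.
        cH b11 (\<lambda>w1 w2. cH a2L (\<lambda>v1 v2. cR a1 (\<lambda>a10 a11. cL b2 (\<lambda>b2L b20. cH a11 (\<lambda>u1 u2. cH b2L (\<lambda>z1 z2.
          ?B a10 u1 u2 z1 z2 b20 a20 b10 h1 h2 h3 h4 g1 g2 g3 g4 v1 v2 w1 w2))))))))))"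
      unfolding sw4_def
    proof (simp only: sw_swap[where t = "dH g"] sw_swap[where t = "dH h"], intro sw_cong refl, goal_cases)
      case (1 r s g1 g2 g3 g4 p q h1 h2 h3 h4 a2L a20 b10 b11)
      have "cR a1 (\<lambda>a10 a11. cL b2 (\<lambda>b2L b20. cH b2L (\<lambda>z1 z2. cH a11 (f a10 a11 b2L b20 z1 z2)))) =
        cR a1 (\<lambda>a10 a11. cL b2 (\<lambda>b2L b20. cH a11 (\<lambda>u1 u2. cH b2L (\<lambda>z1 z2. f a10 a11 b2L b20 z1 z2 u1 u2))))" for f
        by (intro sw_cong refl sw_swap)
      then show ?case
        by (simp only: sw_swap[where u = "dH a2L"], simp only: sw_swap[where u = "dH b11"])
    qed
    \<comment> \<open>With the coactions on \<open>a\<^sub>1\<close> and \<open>b\<^sub>2\<close> innermost, \<open>u\<^sub>1\<close> and \<open>z\<^sub>2\<close> cancel.\<close>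
    also have "\<dots> = cH4 g (\<lambda>g1 g2 g3 g4. cH4 h (\<lambda>h1 h2 h3 h4. cL a2 (\<lambda>a2L a20. cR b1 (\<lambda>b10 b11.
        cH b11 (\<lambda>w1 w2. cH a2L (\<lambda>v1 v2. cR a1 (\<lambda>a10 a11. cL b2 (\<lambda>b2L b20.
        F ((a10 \<triangleleft> g2) \<star> ((v1 \<odot> h1) \<triangleright> b10)) (v2 \<odot> (h2 \<odot> (b2L \<odot> g1)))
        ((a20 \<triangleleft> (g4 \<odot> w2)) \<star> (h3 \<triangleright> b20)) (h4 \<odot> (a11 \<odot> (g3 \<odot> w1)))))))))))"
      by (simp add: l m dR_dL_trivial_coassoc[where F = "\<lambda>x y z1 u2. F ((x \<triangleleft> _) \<star> (_ \<triangleright> _)) (_ \<odot> (_ \<odot> (z1 \<odot> _)))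
        (_ \<star> (_ \<triangleright> y)) (_ \<odot> (u2 \<odot> _))"])
    also have "\<dots> = ?N a1 a2 b1 b2"
      by (simp only: sw4_swap4[where y = h], simp only: sw4_swap,
        simp only: sw_swap[where t = "dR a1"], simp only: sw_swap[where t = "dL b2"])
    finally show "cH h (\<lambda>p q. cR a1 (\<lambda>a10 a11. cL a2 (\<lambda>a2L a20. cH g (\<lambda>r s. cR b1 (\<lambda>b10 b11. cL b2 (\<lambda>b2L b20.
        cH a2L (\<lambda>v1 v2. cH p (\<lambda>h1 h2. cH b2L (\<lambda>z1 z2. cH r (\<lambda>g1 g2.
          cH q (\<lambda>h3 h4. cH a11 (\<lambda>u1 u2. cH s (\<lambda>g3 g4. cH b11 (\<lambda>w1 w2.
          ?B a10 u1 u2 z1 z2 b20 a20 b10 h1 h2 h3 h4 g1 g2 g3 g4 v1 v2 w1 w2)))))))))))))) = \<dots>" .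
  qed
  finally show ?thesis using left by simp
qed

end

section \<open>Endomorphisms of an ordinary pair\<close>

text \<open>After untwisting, equal powers of the structure maps of \<open>H\<close> and \<open>D\<close> are pairs of this kind.\<close>
locale LR_endomorphism = LR_pair +
  fixes \<theta> :: "'b \<Rightarrow> 'b" and \<eta> :: "'d \<Rightarrow> 'd"
  assumes theta_linear: "linear_map H H \<theta>"
    and eta_linear: "linear_map D D \<eta>"
    and theta_mul: "\<lbrakk>h \<in> vcarrier H; g \<in> vcarrier H\<rbrakk> \<Longrightarrow> \<theta> (h \<odot> g) = \<theta> h \<odot> \<theta> g"
    and eta_mul: "\<lbrakk>a \<in> vcarrier D; b \<in> vcarrier D\<rbrakk> \<Longrightarrow> \<eta> (a \<star> b) = \<eta> a \<star> \<eta> b"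
    and eta_lact: "\<lbrakk>h \<in> vcarrier H; a \<in> vcarrier D\<rbrakk> \<Longrightarrow> \<eta> (h \<triangleright> a) = \<theta> h \<triangleright> \<eta> a"
    and eta_ract: "\<lbrakk>h \<in> vcarrier H; a \<in> vcarrier D\<rbrakk> \<Longrightarrow> \<eta> (a \<triangleleft> h) = \<eta> a \<triangleleft> \<theta> h"
    and cH_theta: "\<lbrakk>bilinear_map H H ground fHH; h \<in> vcarrier H\<rbrakk> \<Longrightarrow>
      cH (\<theta> h) fHH = cH h (\<lambda>h1 h2. fHH (\<theta> h1) (\<theta> h2))"
    and cD_eta: "\<lbrakk>bilinear_map D D ground fDD; a \<in> vcarrier D\<rbrakk> \<Longrightarrow>
      cD (\<eta> a) fDD = cD a (\<lambda>a1 a2. fDD (\<eta> a1) (\<eta> a2))"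
    and cL_eta: "\<lbrakk>bilinear_map H D ground fHD; a \<in> vcarrier D\<rbrakk> \<Longrightarrow>
      cL (\<eta> a) fHD = cL a (\<lambda>aL a0. fHD (\<theta> aL) (\<eta> a0))"
    and cR_eta: "\<lbrakk>bilinear_map D H ground fDH; a \<in> vcarrier D\<rbrakk> \<Longrightarrow>
      cR (\<eta> a) fDH = cR a (\<lambda>a0 a1. fDH (\<eta> a0) (\<theta> a1))"
begin

lemmas endo_lin = lin linear_map_compose[OF theta_linear] linear_map_compose[OF eta_linear]
  linear_map_closed[OF theta_linear] linear_map_closed[OF eta_linear]

lemma smash_natural:
  assumes F: "bilinear_map D H ground F"
    and mem: "a \<in> vcarrier D" "h \<in> vcarrier H" "b \<in> vcarrier D" "g \<in> vcarrier H"
  shows "smash (\<eta> a) (\<theta> h) (\<eta> b) (\<theta> g) F = smash a h b g (\<lambda>x y. F (\<eta> x) (\<theta> y))"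
  by (simp add: smash_def cH_theta theta_mul eta_mul eta_lact eta_ract endo_lin bilinear_lin[OF F] mem)

lemma cosmash_natural:
  assumes F: "quadrilinear_form D H D H F" and mem: "c \<in> vcarrier D" "h \<in> vcarrier H"
  shows "cosmash (\<eta> c) (\<theta> h) F = cosmash c h (\<lambda>d k d' k'. F (\<eta> d) (\<theta> k) (\<eta> d') (\<theta> k'))"
  by (simp add: cosmash_def cH_theta cD_eta cL_eta cR_eta theta_mul endo_lin quadrilinear_lin[OF F] mem)

end

section \<open>Powers of the structure automorphisms\<close>

text \<open>A relation between three maps that is preserved by composition with the generators and with their
  inverses holds between equal integer powers. This transfers the compatibilities of the structure
  maps to all \<open>twist\<close>s.\<close>
lemma ipow_induct3:
  assumes "R id id id"
    and "\<And>u v w. R u v w \<Longrightarrow> R (f \<circ> u) (g \<circ> v) (h \<circ> w)"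
    and "\<And>u v w. R u v w \<Longrightarrow> R (inv_into S f \<circ> u) (inv_into T g \<circ> v) (inv_into U h \<circ> w)"
  shows "R (ipow S f k) (ipow T g k) (ipow U h k)"
proof -
  have "R (f ^^ n) (g ^^ n) (h ^^ n)" for n
    using assms(1,2) by (induction n) (auto simp: id_def)
  moreover have "R (inv_into S f ^^ n) (inv_into T g ^^ n) (inv_into U h ^^ n)" for n
    using assms(1,3) by (induction n) (auto simp: id_def)
  ultimately show ?thesis by (simp add: ipow_def)
qed

lemma linear_map_cong_on:
  assumes "vec_space X" "linear_map X U g" and eq: "\<And>x. x \<in> vcarrier X \<Longrightarrow> h x = g x"
  shows "linear_map X U h"
  using assms(2) vec_space_closed(2,3)[OF assms(1)] eq by (simp add: linear_map_def)

lemma linear_aut_inv: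
  assumes V: "vec_space V" and "linear_aut V f"
  shows "linear_map V V (inv_into (vcarrier V) f)"
    and "\<And>x. x \<in> vcarrier V \<Longrightarrow> f (inv_into (vcarrier V) f x) = x"
    and "\<And>x. x \<in> vcarrier V \<Longrightarrow> inv_into (vcarrier V) f (f x) = x"
    and "\<And>x. x \<in> vcarrier V \<Longrightarrow> inv_into (vcarrier V) f x \<in> vcarrier V"
    and "\<And>x. x \<in> vcarrier V \<Longrightarrow> f x \<in> vcarrier V"
proof -
  have b: "bij_betw f (vcarrier V) (vcarrier V)" and l: "linear_map V V f"
    using assms by (auto simp: linear_aut_def)
  let ?g = "inv_into (vcarrier V) f"
  show r: "f (?g x) = x" if "x \<in> vcarrier V" for x
    using bij_betw_inv_into_right[OF b that] .
  show i: "?g (f x) = x" if "x \<in> vcarrier V" for x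
    using bij_betw_inv_into_left[OF b that] .
  show c: "?g x \<in> vcarrier V" if "x \<in> vcarrier V" for x
    using bij_betwE[OF bij_betw_inv_into[OF b]] that by blast
  show "f x \<in> vcarrier V" if "x \<in> vcarrier V" for x
    using l that by (auto simp: linear_map_def)
  show "linear_map V V ?g"
    unfolding linear_map_def
  proof (intro conjI ballI allI)
    fix x y assume xy: "x \<in> vcarrier V" "y \<in> vcarrier V"
    have "f (?g x + ?g y) = x + y"
      using l xy by (simp add: linear_map_def c r)
    then show "?g (x + y) = ?g x + ?g y"
      using i[OF vec_space_closed(2)[OF V c[OF xy(1)] c[OF xy(2)]]] by simp
  next
    fix r' x assume x: "x \<in> vcarrier V"
    have "f (vscale V r' (?g x)) = vscale V r' x"
      using l x by (simp add: linear_map_def c r)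
    then show "?g (vscale V r' x) = vscale V r' (?g x)"
      using i[OF vec_space_closed(3)[OF V c[OF x]]] by metis
  qed (rule c)
qed

lemma ipow_succ:
  assumes "bij_betw f S S" "x \<in> S"
  shows "ipow S f (k + 1) x = f (ipow S f k x)"
proof (cases "0 \<le> k")
  case True
  then have "nat (k + 1) = Suc (nat k)" by simp
  then show ?thesis using True by (simp add: ipow_def)
next
  case False
  have carrier: "(inv_into S f ^^ n) x \<in> S" for n
    using assms(2) bij_betwE[OF bij_betw_inv_into[OF assms(1)]] by (induction n) auto
  have "nat (- k) = Suc (nat (- (k + 1)))" using False by simp
  moreover have "ipow S f (k + 1) x = (inv_into S f ^^ nat (- (k + 1))) x"
    using False by (auto simp: ipow_def)
  ultimately show ?thesis
    using False bij_betw_inv_into_right[OF assms(1) carrier] by (simp add: ipow_def)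
qed

lemma ipow_closed:
  assumes "bij_betw f S S" "x \<in> S"
  shows "ipow S f k x \<in> S"
proof -
  have "\<forall>x\<in>S. ipow S f k x \<in> S"
    by (rule ipow_induct3[where R = "\<lambda>u v w. \<forall>x\<in>S. u x \<in> S"])
      (use bij_betwE[OF assms(1)] bij_betwE[OF bij_betw_inv_into[OF assms(1)]] in auto)
  with assms(2) show ?thesis by blast
qed

lemma ipow_pred:
  assumes "bij_betw f S S" "x \<in> S"
  shows "ipow S f (k - 1) x = inv_into S f (ipow S f k x)"
  using ipow_succ[OF assms, of "k - 1"] bij_betw_inv_into_left[OF assms(1) ipow_closed[OF assms]] by simp

lemma ipow_add:
  assumes "bij_betw f S S" "x \<in> S"
  shows "ipow S f i (ipow S f j x) = ipow S f (i + j) x"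
proof (induction i rule: int_induct[where k = 0])
  case base
  show ?case by (simp add: ipow_def)
next
  case (step1 i)
  then show ?case
    using ipow_succ[OF assms, of "i + j"] ipow_succ[OF assms(1) ipow_closed[OF assms], of i j]
    by (simp add: add.assoc add.commute[of 1])
next
  case (step2 i)
  then show ?case
    using ipow_pred[OF assms, of "i + j"] ipow_pred[OF assms(1) ipow_closed[OF assms], of i j]
    by (simp add: algebra_simps)
qed

text \<open>If \<open>g\<close> commutes with \<open>f\<close>, it commutes with the inverse of \<open>f\<close>.\<close>
lemma ipow_commute1:
  assumes "bij_betw f S S" "commute_on S f g" "\<And>x. x \<in> S \<Longrightarrow> g x \<in> S" "x \<in> S"
  shows "ipow S f k (g x) = g (ipow S f k x)"
proof -
  note inv = bij_betw_inv_into_left[OF assms(1)] bij_betw_inv_into_right[OF assms(1)]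
    bij_betwE[OF assms(1)] bij_betwE[OF bij_betw_inv_into[OF assms(1)]]
  have gi: "inv_into S f (g y) = g (inv_into S f y)" if "y \<in> S" for y
    using assms(2,3) inv that unfolding commute_on_def by metis
  have "\<forall>x\<in>S. ipow S f k x \<in> S \<and> ipow S f k (g x) = g (ipow S f k x)"
    by (rule ipow_induct3[where R = "\<lambda>u v w. \<forall>x\<in>S. u x \<in> S \<and> u (g x) = g (u x)"])
      (use assms(2) inv gi in \<open>auto simp: commute_on_def\<close>)
  with assms(4) show ?thesis by blast
qed

lemma ipow_commute:
  assumes "bij_betw f S S" "bij_betw g S S" "commute_on S f g" "x \<in> S"
  shows "ipow S g j (ipow S f i x) = ipow S f i (ipow S g j x)"
proof (rule ipow_commute1[OF assms(2) _ _ assms(4)])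
  show "commute_on S g (ipow S f i)"
    unfolding commute_on_def
    using ipow_commute1[OF assms(1,3)] bij_betwE[OF assms(2)] by auto
qed (rule ipow_closed[OF assms(1)])

context bihom_structure
begin

lemma struct_bij:
  "bij_betw \<alpha>\<^bsub>M\<^esub> (vcarrier M) (vcarrier M)" "bij_betw \<beta>\<^bsub>M\<^esub> (vcarrier M) (vcarrier M)"
  "bij_betw \<omega>\<^bsub>M\<^esub> (vcarrier M) (vcarrier M)" "bij_betw \<psi>\<^bsub>M\<^esub> (vcarrier M) (vcarrier M)"
  using linear_aut_struct by (auto simp: linear_aut_def)

lemma twist_closed: "x \<in> vcarrier M \<Longrightarrow> twist M i j k l x \<in> vcarrier M"
  unfolding twist_def by (intro ipow_closed struct_bij)

lemma twist_twist:
  "x \<in> vcarrier M \<Longrightarrow>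
    twist M i j k l (twist M i' j' k' l' x) = twist M (i + i') (j + j') (k + k') (l + l') x"
  using commute_struct struct_bij
  by (simp add: twist_def ipow_closed ipow_commute[of "\<alpha>\<^bsub>M\<^esub>" _ "\<beta>\<^bsub>M\<^esub>"] ipow_commute[of "\<alpha>\<^bsub>M\<^esub>" _ "\<omega>\<^bsub>M\<^esub>"]
    ipow_commute[of "\<alpha>\<^bsub>M\<^esub>" _ "\<psi>\<^bsub>M\<^esub>"] ipow_commute[of "\<beta>\<^bsub>M\<^esub>" _ "\<omega>\<^bsub>M\<^esub>"]
    ipow_commute[of "\<beta>\<^bsub>M\<^esub>" _ "\<psi>\<^bsub>M\<^esub>"] ipow_commute[of "\<omega>\<^bsub>M\<^esub>" _ "\<psi>\<^bsub>M\<^esub>"] ipow_add)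

lemma twist_zero [simp]: "twist M 0 0 0 0 x = x"
  by (simp add: twist_def ipow_def)

lemma struct_twist:
  "\<alpha>\<^bsub>M\<^esub> x = twist M 1 0 0 0 x" "\<beta>\<^bsub>M\<^esub> x = twist M 0 1 0 0 x"
  "\<omega>\<^bsub>M\<^esub> x = twist M 0 0 1 0 x" "\<psi>\<^bsub>M\<^esub> x = twist M 0 0 0 1 x"
  by (simp_all add: twist_def ipow_def)

end

text \<open>Naturality of a binary operation and of a map into a tensor product (evaluated at forms) under a
  triple of endomorphisms.\<close>
definition op_natural where
  "op_natural A B C m u v w \<longleftrightarrow> linear_map A A u \<and> linear_map B B v \<and> linear_map C C w \<and>
     (\<forall>a\<in>vcarrier A. \<forall>b\<in>vcarrier B. w (m a b) = m (u a) (v b))"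

definition coop_natural where
  "coop_natural X A B \<rho> u v w \<longleftrightarrow> linear_map X X u \<and> linear_map A A v \<and> linear_map B B w \<and>
     (\<forall>x\<in>vcarrier X. \<forall>f. bilinear_map A B ground f \<longrightarrow> \<rho> (u x) f = \<rho> x (\<lambda>a b. f (v a) (w b)))"

lemma linear_map_comp: "linear_map B C f \<Longrightarrow> linear_map A B g \<Longrightarrow> linear_map A C (f \<circ> g)"
  by (auto simp: linear_map_def)

lemma op_natural_comp:
  "op_natural A B C m f g h \<Longrightarrow> op_natural A B C m u v w \<Longrightarrow>
    op_natural A B C m (f \<circ> u) (g \<circ> v) (h \<circ> w)"
  unfolding op_natural_def by (auto intro: linear_map_comp) (auto simp: linear_map_def)

lemma bilinear_map_compose:
  assumes "bilinear_map A B C f" "linear_map A A v" "linear_map B B w"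
  shows "bilinear_map A B C (\<lambda>a b. f (v a) (w b))"
  using assms by (auto simp: bilinear_map_def linear_map_def)

lemma coop_natural_comp:
  "coop_natural X A B \<rho> f g h \<Longrightarrow> coop_natural X A B \<rho> u v w \<Longrightarrow>
    coop_natural X A B \<rho> (f \<circ> u) (g \<circ> v) (h \<circ> w)"
  unfolding coop_natural_def
  by (auto intro: linear_map_comp simp: bilinear_map_compose linear_map_closed)

lemma op_natural_ipow:
  assumes "vec_space A" "vec_space B" "vec_space C" "bilinear_map A B C m"
    and aut: "linear_aut A f" "linear_aut B g" "linear_aut C h"
    and nat: "\<And>a b. a \<in> vcarrier A \<Longrightarrow> b \<in> vcarrier B \<Longrightarrow> h (m a b) = m (f a) (g b)"
  shows "op_natural A B C m (ipow (vcarrier A) f k) (ipow (vcarrier B) g k) (ipow (vcarrier C) h k)"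
proof (rule ipow_induct3[where R = "op_natural A B C m"])
  note A = linear_aut_inv[OF assms(1) aut(1)] and B = linear_aut_inv[OF assms(2) aut(2)]
    and C = linear_aut_inv[OF assms(3) aut(3)]
  show "op_natural A B C m id id id"
    by (auto simp: op_natural_def linear_map_def)
  have gen: "op_natural A B C m f g h"
    using aut nat by (auto simp: op_natural_def linear_aut_def)
  then show "op_natural A B C m (f \<circ> u) (g \<circ> v) (h \<circ> w)" if "op_natural A B C m u v w" for u v w
    using that by (rule op_natural_comp)
  have "inv_into (vcarrier C) h (m a b) = m (inv_into (vcarrier A) f a) (inv_into (vcarrier B) g b)"
    if "a \<in> vcarrier A" "b \<in> vcarrier B" for a b
    using nat[OF A(4) B(4), OF that] A(2)[OF that(1)] B(2)[OF that(2)]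
      C(3)[OF bilinear_closed[OF assms(4) A(4) B(4), OF that]] by metis
  then have "op_natural A B C m (inv_into (vcarrier A) f) (inv_into (vcarrier B) g) (inv_into (vcarrier C) h)"
    using A(1) B(1) C(1) by (auto simp: op_natural_def)
  then show "op_natural A B C m (inv_into (vcarrier A) f \<circ> u) (inv_into (vcarrier B) g \<circ> v) (inv_into (vcarrier
      C) h \<circ> w)"
    if "op_natural A B C m u v w" for u v w
    using that by (rule op_natural_comp)
qed

text \<open>For an inverse, apply the hypothesis to \<open>F\<close> composed with the inverses: the generators cancel
  against them. The last hypothesis says that the values of \<open>\<rho>\<close> depend on a form only through its
  restriction to the carriers.\<close>
lemma coop_natural_ipow:
  assumes "vec_space X" "vec_space A" "vec_space B"
    and aut: "linear_aut X f" "linear_aut A g" "linear_aut B h"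
    and nat: "\<And>x F. x \<in> vcarrier X \<Longrightarrow> bilinear_map A B ground F \<Longrightarrow>
      \<rho> (f x) F = \<rho> x (\<lambda>a b. F (g a) (h b))"
    and loc: "\<And>x F G. x \<in> vcarrier X \<Longrightarrow> bilinear_map A B ground F \<Longrightarrow> bilinear_map A B ground G \<Longrightarrow>
      (\<And>a b. a \<in> vcarrier A \<Longrightarrow> b \<in> vcarrier B \<Longrightarrow> F a b = G a b) \<Longrightarrow> \<rho> x F = \<rho> x G"
  shows "coop_natural X A B \<rho> (ipow (vcarrier X) f k) (ipow (vcarrier A) g k) (ipow (vcarrier B) h k)"
proof (rule ipow_induct3[where R = "coop_natural X A B \<rho>"])
  note X = linear_aut_inv[OF assms(1) aut(1)] and A = linear_aut_inv[OF assms(2) aut(2)]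
    and B = linear_aut_inv[OF assms(3) aut(3)]
  show "coop_natural X A B \<rho> id id id"
    by (auto simp: coop_natural_def linear_map_def)
  have gen: "coop_natural X A B \<rho> f g h"
    using aut nat by (auto simp: coop_natural_def linear_aut_def)
  then show "coop_natural X A B \<rho> (f \<circ> u) (g \<circ> v) (h \<circ> w)" if "coop_natural X A B \<rho> u v w" for u v w
    using that by (rule coop_natural_comp)
  have "\<rho> (inv_into (vcarrier X) f x) F =
      \<rho> x (\<lambda>a b. F (inv_into (vcarrier A) g a) (inv_into (vcarrier B) h b))"
    if x: "x \<in> vcarrier X" and F: "bilinear_map A B ground F" for x F
  proof -
    let ?G = "\<lambda>a b. F (inv_into (vcarrier A) g a) (inv_into (vcarrier B) h b)"
    have G: "bilinear_map A B ground ?G"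
      by (rule bilinear_map_compose[OF F A(1) B(1)])
    have "\<rho> x ?G = \<rho> (f (inv_into (vcarrier X) f x)) ?G"
      using X(2)[OF x] by simp
    also have "\<dots> = \<rho> (inv_into (vcarrier X) f x) (\<lambda>a b. ?G (g a) (h b))"
      by (rule nat[OF X(4)[OF x] G])
    also have "\<dots> = \<rho> (inv_into (vcarrier X) f x) F"
      using aut by (intro loc X(4) x F bilinear_map_compose[OF G]) (auto simp: linear_aut_def A(3) B(3))
    finally show ?thesis by simp
  qed
  then have "coop_natural X A B \<rho> (inv_into (vcarrier X) f) (inv_into (vcarrier A) g) (inv_into (vcarrier B) h)"
    using X(1) A(1) B(1) by (auto simp: coop_natural_def)
  then show "coop_natural X A B \<rho> (inv_into (vcarrier X) f \<circ> u) (inv_into (vcarrier A) g \<circ> v) (inv_into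
      (vcarrier B) h \<circ> w)"
    if "coop_natural X A B \<rho> u v w" for u v w
    using that by (rule coop_natural_comp)
qed

lemma twist_comp:
  "twist A i j k l = ipow (vcarrier A) \<alpha>\<^bsub>A\<^esub> i \<circ> (ipow (vcarrier A) \<beta>\<^bsub>A\<^esub> j \<circ>
     (ipow (vcarrier A) \<omega>\<^bsub>A\<^esub> k \<circ> ipow (vcarrier A) \<psi>\<^bsub>A\<^esub> l))"
  by (simp add: fun_eq_iff twist_def)

lemma op_natural_twist:
  assumes "bihom_structure A" "bihom_structure B" "bihom_structure C" "bilinear_map A B C m"
    and "\<And>a b. a \<in> vcarrier A \<Longrightarrow> b \<in> vcarrier B \<Longrightarrow> \<alpha>\<^bsub>C\<^esub> (m a b) = m (\<alpha>\<^bsub>A\<^esub> a) (\<alpha>\<^bsub>B\<^esub> b)"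
    and "\<And>a b. a \<in> vcarrier A \<Longrightarrow> b \<in> vcarrier B \<Longrightarrow> \<beta>\<^bsub>C\<^esub> (m a b) = m (\<beta>\<^bsub>A\<^esub> a) (\<beta>\<^bsub>B\<^esub> b)"
    and "\<And>a b. a \<in> vcarrier A \<Longrightarrow> b \<in> vcarrier B \<Longrightarrow> \<omega>\<^bsub>C\<^esub> (m a b) = m (\<omega>\<^bsub>A\<^esub> a) (\<omega>\<^bsub>B\<^esub> b)"
    and "\<And>a b. a \<in> vcarrier A \<Longrightarrow> b \<in> vcarrier B \<Longrightarrow> \<psi>\<^bsub>C\<^esub> (m a b) = m (\<psi>\<^bsub>A\<^esub> a) (\<psi>\<^bsub>B\<^esub> b)"
  shows "op_natural A B C m (twist A i j k l) (twist B i j k l) (twist C i j k l)"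
  unfolding twist_comp using assms
  by (intro op_natural_comp op_natural_ipow) (simp_all add: bihom_structure_def)

lemma coop_natural_twist:
  assumes "bihom_structure X" "bihom_structure A" "bihom_structure B"
    and "\<And>x F. x \<in> vcarrier X \<Longrightarrow> bilinear_map A B ground F \<Longrightarrow> \<rho> (\<alpha>\<^bsub>X\<^esub> x) F = \<rho> x (\<lambda>a b. F (\<alpha>\<^bsub>A\<^esub> a) (\<alpha>\<^bsub>B\<^esub> b))"
    and "\<And>x F. x \<in> vcarrier X \<Longrightarrow> bilinear_map A B ground F \<Longrightarrow> \<rho> (\<beta>\<^bsub>X\<^esub> x) F = \<rho> x (\<lambda>a b. F (\<beta>\<^bsub>A\<^esub> a) (\<beta>\<^bsub>B\<^esub> b))"
    and "\<And>x F. x \<in> vcarrier X \<Longrightarrow> bilinear_map A B ground F \<Longrightarrow> \<rho> (\<omega>\<^bsub>X\<^esub> x) F = \<rho> x (\<lambda>a b. F (\<omega>\<^bsub>A\<^esub> a) (\<omega>\<^bsub>B\<^esub> b))"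
    and "\<And>x F. x \<in> vcarrier X \<Longrightarrow> bilinear_map A B ground F \<Longrightarrow> \<rho> (\<psi>\<^bsub>X\<^esub> x) F = \<rho> x (\<lambda>a b. F (\<psi>\<^bsub>A\<^esub> a) (\<psi>\<^bsub>B\<^esub> b))"
    and "\<And>x F G. x \<in> vcarrier X \<Longrightarrow> bilinear_map A B ground F \<Longrightarrow> bilinear_map A B ground G \<Longrightarrow>
      (\<And>a b. a \<in> vcarrier A \<Longrightarrow> b \<in> vcarrier B \<Longrightarrow> F a b = G a b) \<Longrightarrow> \<rho> x F = \<rho> x G"
  shows "coop_natural X A B \<rho> (twist X i j k l) (twist A i j k l) (twist B i j k l)"
  unfolding twist_comp
  by (intro coop_natural_comp coop_natural_ipow)
    (fact assms(4-8) | rule assms(8); assumption | use assms(1-3) in \<open>simp add: bihom_structure_def\<close>)+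


section \<open>Tensors as Sweedler sums\<close>

text \<open>The decomposition into pure tensors that \<open>tensor_lift\<close> chooses, so that \<open>tensor_lift\<close> is literally
  a sum over this list.\<close>
definition decomp ::
  "('k::field, 'a::ab_group_add, 'x) vspace_scheme \<Rightarrow> ('k, 'b::ab_group_add, 'y) vspace_scheme \<Rightarrow>
   ('k, 'a, 'b) tensor \<Rightarrow> ('a \<times> 'b) list" where
  "decomp V W t = (SOME xs. set xs \<subseteq> vcarrier V \<times> vcarrier W \<and> t = (\<Sum>(v, w)\<leftarrow>xs. v \<otimes>\<^bsub>V,W\<^esub> w))"

lemma decomp:
  assumes "vec_space V" "vec_space W" "t \<in> vcarrier (tensor_space V W)"
  shows "set (decomp V W t) \<subseteq> vcarrier V \<times> vcarrier W" "t = (\<Sum>(v, w)\<leftarrow>decomp V W t. v \<otimes>\<^bsub>V,W\<^esub> w)"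
  using someI_ex[OF tensor_decompose[OF assms]] by (auto simp: decomp_def)

lemma sw_sum_list:
  "set xs \<subseteq> vcarrier V \<times> vcarrier W \<Longrightarrow> sw V W xs f = (\<Sum>(a, b)\<leftarrow>xs. f a b)"
  unfolding sw_def by (subst filter_True) auto

lemma sw_decomp:
  assumes "vec_space V" "vec_space W" "t \<in> vcarrier (tensor_space V W)" "bilinear_map V W ground f"
  shows "sw V W (decomp V W t) f = t f"
  using decomp[OF assms(1-3)] sum_list_tens_apply[OF assms(4), of "decomp V W t"]
  by (simp add: sw_sum_list)

lemma tensor_lift_decomp: "tensor_lift V W t f = (\<Sum>(a, b)\<leftarrow>decomp V W t. f a b)"
  by (simp add: tensor_lift_def decomp_def Let_def)

lemma sum_list_apply: "(\<Sum>x\<leftarrow>xs. F x) B = (\<Sum>x\<leftarrow>xs. F x B)" for F :: "_ \<Rightarrow> _ \<Rightarrow> 'k::comm_monoid_add"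
  by (induction xs) auto

text \<open>Tensors are functions of forms, so evaluation commutes with sums of tensors. Evaluating the
  tensor identities of the definitions at a form turns them into identities between Sweedler
  sums.\<close>
lemma tensor_lift_eval:
  fixes G :: "_ \<Rightarrow> _ \<Rightarrow> ('k::field, _, _) tensor"
  assumes "vec_space V" "vec_space W" "t \<in> vcarrier (tensor_space V W)"
  shows "tensor_lift V W t G B = sw V W (decomp V W t) (\<lambda>a b. G a b B)"
  using decomp(1)[OF assms]
  by (simp add: tensor_lift_decomp sw_sum_list sum_list_apply case_prod_unfold)

lemma linear_tensor_lift_sw:
  assumes "vec_space V" "vec_space W" "t \<in> vcarrier (tensor_space V W)" "vec_space U"
    and f: "linear_map U ground f"
    and G: "\<And>a b. a \<in> vcarrier V \<Longrightarrow> b \<in> vcarrier W \<Longrightarrow> G a b \<in> vcarrier U"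
  shows "f (tensor_lift V W t G) = sw V W (decomp V W t) (\<lambda>a b. f (G a b))"
proof -
  have "f 0 = f 0 + f 0"
    using linear_map_add[OF f vec_space_closed(1)[OF assms(4)] vec_space_closed(1)[OF assms(4)]]
    by (subst (asm) add_0_left)
  then have f0: "f 0 = 0" by (subst (asm) add_cancel_right_right)
  have "(\<Sum>(a, b)\<leftarrow>xs. G a b) \<in> vcarrier U \<and> f (\<Sum>(a, b)\<leftarrow>xs. G a b) = (\<Sum>(a, b)\<leftarrow>xs. f (G a b))"
    if "set xs \<subseteq> vcarrier V \<times> vcarrier W" for xs
    using that
    by (induction xs) (auto simp: f0 vec_space_closed[OF assms(4)] G linear_map_add[OF f])
  then show ?thesis
    using decomp(1)[OF assms(1-3)] by (simp add: tensor_lift_decomp sw_sum_list)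
qed

lemma tens_eval: "bilinear_map V W ground B \<Longrightarrow> (v \<otimes>\<^bsub>V,W\<^esub> w) B = B v w"
  by (simp add: tens_def)

lemma tens_closed:
  "v \<in> vcarrier V \<Longrightarrow> w \<in> vcarrier W \<Longrightarrow> v \<otimes>\<^bsub>V,W\<^esub> w \<in> vcarrier (tensor_space V W)"
  using bilinear_closed[OF bilinear_tens] .

text \<open>At a bilinear form the sum over the chosen decomposition is the value of the tensor, which is
  linear in the vector although the choice is not.\<close>
lemma sweedler_map_decomp:
  assumes "vec_space V" "vec_space W" "linear_map X (tensor_space V W) \<rho>" "vec_space X"
  shows "sweedler_map X V W (\<lambda>x. decomp V W (\<rho> x))"
  unfolding sweedler_map_def
proof (intro allI impI)
  fix f assume f: "bilinear_map V W ground f"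
  have eq: "sw V W (decomp V W (\<rho> x)) f = \<rho> x f" if "x \<in> vcarrier X" for x
    using sw_decomp[OF assms(1,2) linear_map_closed[OF assms(3) that] f] .
  have "linear_map X ground (\<lambda>x. \<rho> x f)"
    unfolding linear_map_def
  proof (intro conjI ballI allI)
    fix x y assume "x \<in> vcarrier X" "y \<in> vcarrier X"
    then show "\<rho> (x + y) f = \<rho> x f + \<rho> y f"
      by (subst linear_map_add[OF assms(3)]) auto
  next
    fix r x assume "x \<in> vcarrier X"
    then show "\<rho> (vscale X r x) f = vscale ground r (\<rho> x f)"
      by (subst linear_map_scale[OF assms(3)]) (auto simp: tensor_space_def tensor_scale_def ground_def)
  qed (simp add: ground_def)
  then show "linear_map X ground (\<lambda>x. sw V W (decomp V W (\<rho> x)) f)"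
    by (rule linear_map_cong_on[OF assms(4)]) (simp only: eq)
qed

text \<open>Applying a pair of maps to a list of pairs. The pairs outside the carriers are dropped first, since
  their images could lie inside.\<close>
definition sw_map where
  "sw_map V W u w xs = map (\<lambda>(x, y). (u x, w y)) (filter (\<lambda>(x, y). x \<in> vcarrier V \<and> y \<in> vcarrier W) xs)"

lemma sw_sw_map:
  assumes "linear_map V A u" "linear_map W B w"
  shows "sw A B (sw_map V W u w xs) f = sw V W xs (\<lambda>x y. f (u x) (w y))"
  using linear_map_closed[OF assms(1)] linear_map_closed[OF assms(2)]
  by (induction xs) (auto simp: sw_def sw_map_def)

section \<open>Untwisting BiHom-algebras and BiHom-coalgebras\<close>

text \<open>Threefold tensors are bracketed to the right, so a trilinear form has to be extended to a bilinear
  form on \<open>A \<times> (B \<otimes> C)\<close>.\<close>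
lemma trilinear_eval:
  assumes "vec_space B" "vec_space C" and F: "trilinear_form A B C F"
  shows "bilinear_map A (tensor_space B C) ground (\<lambda>a t. sw B C (decomp B C t) (F a))"
proof -
  have "sweedler_map (tensor_space B C) B C (decomp B C)"
    using sweedler_map_decomp[OF assms(1,2) linear_map_id vec_space_tensor] by simp
  then show ?thesis
    unfolding bilinear_map_def
    using F by (auto simp: trilinear_form_def sweedler_map_def
        intro!: linear_sw_body trilinear_lin[OF F] linear_map_id)
qed

lemma sw_decomp_tens:
  assumes "vec_space V" "vec_space W" "v \<in> vcarrier V" "w \<in> vcarrier W" "bilinear_map V W ground f"
  shows "sw V W (decomp V W (v \<otimes>\<^bsub>V,W\<^esub> w)) f = f v w"
  using sw_decomp[OF assms(1,2) tens_closed[OF assms(3,4)] assms(5)] tens_eval[OF assms(5)] by simp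

text \<open>The ordinary product and coproduct of which those of a BiHom-algebra and a BiHom-coalgebra are
  twists.\<close>
definition untwist_mult where
  "untwist_mult A a b = twist A (- 1) 0 0 0 a \<cdot>\<^bsub>A\<^esub> twist A 0 (- 1) 0 0 b"

definition untwist_comult where
  "untwist_comult C x =
     sw_map C C (twist C 0 0 (- 1) 0) (twist C 0 0 0 (- 1)) (decomp C C (\<Delta>\<^bsub>C\<^esub> x))"

context bihom_structure
begin

lemma linear_twist: "linear_map M M (twist M i j k l)"
proof -
  have "linear_map M M (ipow (vcarrier M) f n)" if "linear_aut M f" for f n
    by (rule ipow_induct3[where R = "\<lambda>u v w. linear_map M M u"])
      (use that linear_aut_inv(1)[OF vec_space that] in
        \<open>auto simp: linear_aut_def id_def intro: linear_map_id linear_map_comp\<close>)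
  then show ?thesis
    unfolding twist_comp using linear_aut_struct by (intro linear_map_comp) auto
qed

lemmas lin_twist = linear_map_compose[OF linear_twist]

end

text \<open>What \<open>H\<close> and \<open>D\<close> have in common on the algebra side: all four maps are algebra automorphisms.\<close>
locale twisted_algebra = bihom_structure A + bihom_algebra A
  for A :: "('k::field, 'a::ab_group_add, 'x) bihom_scheme" +
  assumes omega_mult_map: "bihom_algebra_map A A \<omega>\<^bsub>A\<^esub>"
    and psi_mult_map: "bihom_algebra_map A A \<psi>\<^bsub>A\<^esub>"
begin

lemma mult_natural: "op_natural A A A (bmult A) (twist A i j k l) (twist A i j k l) (twist A i j k l)"
  by (rule op_natural_twist[OF bihom_structure_axioms bihom_structure_axioms bihom_structure_axioms mult_bilinear])
    (use alpha_mult beta_mult omega_mult_map psi_mult_map in \<open>auto simp: bihom_algebra_map_def\<close>)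

lemma twist_mult:
  "a \<in> vcarrier A \<Longrightarrow> b \<in> vcarrier A \<Longrightarrow>
    twist A i j k l (a \<cdot>\<^bsub>A\<^esub> b) = twist A i j k l a \<cdot>\<^bsub>A\<^esub> twist A i j k l b"
  using mult_natural by (auto simp: op_natural_def)

lemma twist_unit: "twist A i j k l \<one>\<^bsub>A\<^esub> = \<one>\<^bsub>A\<^esub>"
proof -
  have "ipow (vcarrier A) f n \<one>\<^bsub>A\<^esub> = \<one>\<^bsub>A\<^esub>" if "f \<one>\<^bsub>A\<^esub> = \<one>\<^bsub>A\<^esub>" "linear_aut A f" for f n
    by (rule ipow_induct3[where R = "\<lambda>u v w. u \<one>\<^bsub>A\<^esub> = \<one>\<^bsub>A\<^esub>"])
      (use that linear_aut_inv(3)[OF vec_space that(2) unit_closed] in auto)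
  then show ?thesis
    using alpha_unit beta_unit omega_mult_map psi_mult_map linear_aut_struct
    by (simp add: twist_def bihom_algebra_map_def)
qed

lemma mult_closed: "a \<in> vcarrier A \<Longrightarrow> b \<in> vcarrier A \<Longrightarrow> a \<cdot>\<^bsub>A\<^esub> b \<in> vcarrier A"
  using bilinear_closed[OF mult_bilinear] .

text \<open>BiHom-associativity solved for \<open>x(yz)\<close>; in this form it is a rewrite rule towards left bracketing
  for arbitrary \<open>x\<close>. The other BiHom-axioms are solved for one side in the same way below.\<close>
lemma twisted_assoc:
  assumes "x \<in> vcarrier A" "y \<in> vcarrier A" "z \<in> vcarrier A"
  shows "x \<cdot>\<^bsub>A\<^esub> (y \<cdot>\<^bsub>A\<^esub> z) = (twist A (- 1) 0 0 0 x \<cdot>\<^bsub>A\<^esub> y) \<cdot>\<^bsub>A\<^esub> twist A 0 1 0 0 z"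
  using bihom_assoc[of "twist A (- 1) 0 0 0 x" y z] assms
  by (simp add: struct_twist twist_twist twist_closed)

lemma twisted_unit:
  "a \<in> vcarrier A \<Longrightarrow> a \<cdot>\<^bsub>A\<^esub> \<one>\<^bsub>A\<^esub> = twist A 1 0 0 0 a"
  "a \<in> vcarrier A \<Longrightarrow> \<one>\<^bsub>A\<^esub> \<cdot>\<^bsub>A\<^esub> a = twist A 0 1 0 0 a"
  using unit_left unit_right by (simp_all add: struct_twist)

lemma assoc_algebra_untwist: "assoc_algebra A (untwist_mult A) \<one>\<^bsub>A\<^esub>"
proof
  show "bilinear_map A A A (untwist_mult A)"
    unfolding bilinear_map_def untwist_mult_def
    by (auto intro!: bilinear_lin[OF mult_bilinear] linear_twist twist_closed)
qed (simp_all add: vec_space unit_closed untwist_mult_def twist_mult twist_unit twist_twist twist_closed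
    mult_closed twisted_assoc twisted_unit)

end

text \<open>What \<open>H\<close> and \<open>D\<close> have in common on the coalgebra side: all four maps are coalgebra automorphisms.\<close>
locale twisted_coalgebra = bihom_structure C + bihom_coalgebra C
  for C :: "('k::field, 'a::ab_group_add, 'x) bihom_scheme" +
  assumes alpha_comult_map: "bihom_coalgebra_map C C \<alpha>\<^bsub>C\<^esub>"
    and beta_comult_map: "bihom_coalgebra_map C C \<beta>\<^bsub>C\<^esub>"
begin

abbreviation sC where "sC x \<equiv> sw C C (decomp C C (\<Delta>\<^bsub>C\<^esub> x))"

lemma comult_closed: "x \<in> vcarrier C \<Longrightarrow> \<Delta>\<^bsub>C\<^esub> x \<in> vcarrier (tensor_space C C)"
  using linear_map_closed[OF comult_linear] .

lemma sC: "x \<in> vcarrier C \<Longrightarrow> bilinear_map C C ground F \<Longrightarrow> sC x F = \<Delta>\<^bsub>C\<^esub> x F"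
  by (rule sw_decomp[OF vec_space vec_space comult_closed])

lemmas lin_C = linear_map_id lin_twist twist_closed linear_map_compose[OF counit_linear] linear_form_scale
  linear_sw_arg[OF sweedler_map_decomp[OF vec_space vec_space comult_linear vec_space]]
  linear_sw_body multilinear_defs

lemma comult_map_eval:
  assumes "bihom_coalgebra_map C C g" "x \<in> vcarrier C" "bilinear_map C C ground F"
  shows "\<Delta>\<^bsub>C\<^esub> (g x) F = \<Delta>\<^bsub>C\<^esub> x (\<lambda>a b. F (g a) (g b))"
proof -
  have g: "linear_map C C g" using assms(1) by (simp add: bihom_coalgebra_map_def)
  show ?thesis
    using assms sC[OF assms(2) bilinear_map_compose[OF assms(3) g g]]
    by (simp add: bihom_coalgebra_map_def tensor_lift_eval[OF vec_space vec_space comult_closed] tens_eval)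
qed

lemma comult_natural: "coop_natural C C C \<Delta>\<^bsub>C\<^esub> (twist C i j k l) (twist C i j k l) (twist C i j k l)"
proof (rule coop_natural_twist[OF bihom_structure_axioms bihom_structure_axioms bihom_structure_axioms])
  fix x F assume x: "x \<in> vcarrier C" and F: "bilinear_map C C ground F"
  show "\<Delta>\<^bsub>C\<^esub> (\<alpha>\<^bsub>C\<^esub> x) F = \<Delta>\<^bsub>C\<^esub> x (\<lambda>a b. F (\<alpha>\<^bsub>C\<^esub> a) (\<alpha>\<^bsub>C\<^esub> b))"
    "\<Delta>\<^bsub>C\<^esub> (\<beta>\<^bsub>C\<^esub> x) F = \<Delta>\<^bsub>C\<^esub> x (\<lambda>a b. F (\<beta>\<^bsub>C\<^esub> a) (\<beta>\<^bsub>C\<^esub> b))"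
    by (rule comult_map_eval[OF alpha_comult_map x F] comult_map_eval[OF beta_comult_map x F])+
  have "linear_map C C \<omega>\<^bsub>C\<^esub>" "linear_map C C \<psi>\<^bsub>C\<^esub>"
    using linear_aut_struct by (auto simp: linear_aut_def)
  then show "\<Delta>\<^bsub>C\<^esub> (\<omega>\<^bsub>C\<^esub> x) F = \<Delta>\<^bsub>C\<^esub> x (\<lambda>a b. F (\<omega>\<^bsub>C\<^esub> a) (\<omega>\<^bsub>C\<^esub> b))"
    "\<Delta>\<^bsub>C\<^esub> (\<psi>\<^bsub>C\<^esub> x) F = \<Delta>\<^bsub>C\<^esub> x (\<lambda>a b. F (\<psi>\<^bsub>C\<^esub> a) (\<psi>\<^bsub>C\<^esub> b))"
    using sC[OF x bilinear_map_compose[OF F]] x F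
    by (simp_all add: comult_omega comult_psi tensor_lift_eval[OF vec_space vec_space comult_closed] tens_eval)
next
  fix x F G assume "x \<in> vcarrier C" "bilinear_map C C ground F" "bilinear_map C C ground G"
    "\<And>a b. a \<in> vcarrier C \<Longrightarrow> b \<in> vcarrier C \<Longrightarrow> F a b = G a b"
  then show "\<Delta>\<^bsub>C\<^esub> x F = \<Delta>\<^bsub>C\<^esub> x G"
    using sC[of x F] sC[of x G] by simp
qed

lemma sC_twist:
  assumes "bilinear_map C C ground F" "x \<in> vcarrier C"
  shows "sC (twist C i j k l x) F = sC x (\<lambda>a b. F (twist C i j k l a) (twist C i j k l b))"
  using comult_natural[of i j k l] assms
  by (simp add: sC twist_closed coop_natural_def bilinear_map_compose)

lemma counit_twist:
  assumes "x \<in> vcarrier C"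
  shows "\<epsilon>\<^bsub>C\<^esub> (twist C i j k l x) = \<epsilon>\<^bsub>C\<^esub> x"
proof -
  have "ipow (vcarrier C) f n x \<in> vcarrier C \<and> \<epsilon>\<^bsub>C\<^esub> (ipow (vcarrier C) f n x) = \<epsilon>\<^bsub>C\<^esub> x"
    if f: "linear_aut C f" "\<And>c. c \<in> vcarrier C \<Longrightarrow> \<epsilon>\<^bsub>C\<^esub> (f c) = \<epsilon>\<^bsub>C\<^esub> c" and x: "x \<in> vcarrier C" for f n x
  proof -
    note inv = linear_aut_inv[OF vec_space f(1)]
    have i: "\<epsilon>\<^bsub>C\<^esub> (inv_into (vcarrier C) f c) = \<epsilon>\<^bsub>C\<^esub> c" if "c \<in> vcarrier C" for c
      using f(2)[OF inv(4)[OF that]] inv(2)[OF that] by simp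
    have "\<forall>x\<in>vcarrier C. ipow (vcarrier C) f n x \<in> vcarrier C \<and> \<epsilon>\<^bsub>C\<^esub> (ipow (vcarrier C) f n x) = \<epsilon>\<^bsub>C\<^esub> x"
      by (rule ipow_induct3[where R = "\<lambda>u v w. \<forall>x\<in>vcarrier C. u x \<in> vcarrier C \<and> \<epsilon>\<^bsub>C\<^esub> (u x) = \<epsilon>\<^bsub>C\<^esub> x"])
        (use f(2) i inv(4,5) in auto)
    with x show ?thesis by blast
  qed
  then show ?thesis
    using assms alpha_comult_map beta_comult_map counit_omega counit_psi linear_aut_struct
    by (simp add: twist_def bihom_coalgebra_map_def)
qed

lemma sC_counit:
  assumes "linear_map C ground f" "x \<in> vcarrier C"
  shows "sC x (\<lambda>x1 x2. f x1 * \<epsilon>\<^bsub>C\<^esub> x2) = f (twist C 0 0 1 0 x)"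
    and "sC x (\<lambda>x1 x2. \<epsilon>\<^bsub>C\<^esub> x1 * f x2) = f (twist C 0 0 0 1 x)"
proof -
  have f: "f (vscale C r y) = r * f y" if "y \<in> vcarrier C" for r y
    using assms(1) that by (simp add: linear_map_def ground_def)
  note r = linear_tensor_lift_sw[OF vec_space vec_space comult_closed[OF assms(2)] vec_space assms(1)]
  show "sC x (\<lambda>x1 x2. f x1 * \<epsilon>\<^bsub>C\<^esub> x2) = f (twist C 0 0 1 0 x)"
    using arg_cong[OF counit_right[OF assms(2)], of f]
    by (simp add: r vec_space_closed[OF vec_space] f struct_twist mult.commute)
  show "sC x (\<lambda>x1 x2. \<epsilon>\<^bsub>C\<^esub> x1 * f x2) = f (twist C 0 0 0 1 x)"
    using arg_cong[OF counit_left[OF assms(2)], of f]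
    by (simp add: r vec_space_closed[OF vec_space] f struct_twist)
qed

text \<open>BiHom-coassociativity with the map \<open>\<psi>\<close> moved to the other side, so that the left side contains no
  structure map and matches every iterated coproduct.\<close>
lemma sC_coassoc:
  assumes F: "trilinear_form C C C F" and x: "x \<in> vcarrier C"
  shows "sC x (\<lambda>x1 x2. sC x1 (\<lambda>x11 x12. F x11 x12 x2)) =
    sC x (\<lambda>x1 x2. sC x2 (\<lambda>x21 x22. F (twist C 0 0 1 0 x1) x21 (twist C 0 0 0 (- 1) x22)))"
proof -
  note l = lin_C trilinear_lin[OF F] x
  have G: "trilinear_form C C C (\<lambda>v a b. F v a (twist C 0 0 0 (- 1) b))"
    by (simp add: l)
  show ?thesis
    using fun_cong[OF bihom_coassoc[OF x], of "\<lambda>v t. sw C C (decomp C C t) (\<lambda>a b. F v a (twist C 0 0 0 (- 1) b))"]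
    by (simp add: tensor_lift_eval vec_space vec_space_tensor comult_closed x
        tens_eval[OF trilinear_eval[OF vec_space vec_space G]] struct_twist sw_decomp_tens twist_twist l)
qed

lemma sw_untwist_comult:
  "sw C C (untwist_comult C x) F = sC x (\<lambda>x1 x2. F (twist C 0 0 (- 1) 0 x1) (twist C 0 0 0 (- 1) x2))"
  unfolding untwist_comult_def by (rule sw_sw_map[OF linear_twist linear_twist])

lemma sweedler_coalgebra_untwist: "sweedler_coalgebra C (untwist_comult C) \<epsilon>\<^bsub>C\<^esub>"
proof
  show "sweedler_map C C C (untwist_comult C)"
    unfolding sweedler_map_def
    by (auto simp: sw_untwist_comult intro!: linear_map_id linear_twist bilinear_map_compose
      linear_sw_arg[OF sweedler_map_decomp[OF vec_space vec_space comult_linear vec_space]])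
  show "linear_map C ground \<epsilon>\<^bsub>C\<^esub>" by (rule counit_linear)
next
  fix f x assume f: "linear_map C ground f" and x: "x \<in> vcarrier C"
  note l = lin_C linear_map_compose[OF f] x
  show "sw C C (untwist_comult C x) (\<lambda>x1 x2. f x1 * \<epsilon>\<^bsub>C\<^esub> x2) = f x"
    "sw C C (untwist_comult C x) (\<lambda>x1 x2. \<epsilon>\<^bsub>C\<^esub> x1 * f x2) = f x"
    by (simp_all add: sw_untwist_comult counit_twist sC_counit twist_twist l)
next
  fix F x assume F: "trilinear_form C C C F" and x: "x \<in> vcarrier C"
  note l = lin_C trilinear_lin[OF F] x
  show "sw C C (untwist_comult C x) (\<lambda>x1 x2. sw C C (untwist_comult C x1) (\<lambda>x11 x12. F x11 x12 x2)) =
      sw C C (untwist_comult C x) (\<lambda>x1 x2. sw C C (untwist_comult C x2) (F x1))"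
    by (simp add: sw_untwist_comult sC_twist twist_twist l sC_coassoc)
qed

end

section \<open>Untwisting an admissible pair\<close>

locale twisted_LR_pair = H: bihom_bialgebra H + LR_admissible_pair H D lact ract \<rho>L \<rho>R m n p q s t u v
  for H :: "('k::field, 'h::ab_group_add, 'x) bihom_scheme"
    and D :: "('k, 'd::ab_group_add, 'y) bihom_scheme"
    and lact :: "'h \<Rightarrow> 'd \<Rightarrow> 'd" (infixr "\<triangleright>" 76)
    and ract :: "'d \<Rightarrow> 'h \<Rightarrow> 'd" (infixl "\<triangleleft>" 76)
    and \<rho>L \<rho>R m n p q s t u v
begin

sublocale HA: twisted_algebra H
  by unfold_locales (rule H.omega_algebra_map H.psi_algebra_map)+

sublocale HC: twisted_coalgebra H
  by unfold_locales (rule H.alpha_coalgebra_map H.beta_coalgebra_map)+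

sublocale DA: twisted_algebra D
  by unfold_locales (rule omegaD_algebra_map psiD_algebra_map)+

sublocale DC: twisted_coalgebra D
  by unfold_locales (rule alphaD_coalgebra_map betaD_coalgebra_map)+

abbreviation "tH \<equiv> twist H"
abbreviation "tD \<equiv> twist D"
abbreviation sH where "sH h \<equiv> sw H H (decomp H H (\<Delta>\<^bsub>H\<^esub> h))"
abbreviation sD where "sD a \<equiv> sw D D (decomp D D (\<Delta>\<^bsub>D\<^esub> a))"
abbreviation sL where "sL a \<equiv> sw H D (decomp H D (\<rho>L a))"
abbreviation sR where "sR a \<equiv> sw D H (decomp D H (\<rho>R a))"

lemmas vec_spaces = H.vec_space vec_space vec_space_tensor

lemmas carrier = H.twist_closed twist_closed HA.mult_closed DA.mult_closed H.unit_closed unit_closed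
  bilinear_closed[OF lact_bilinear] bilinear_closed[OF ract_bilinear]
  HC.comult_closed DC.comult_closed linear_map_closed[OF lcoact_linear] linear_map_closed[OF rcoact_linear]

lemmas lin_base = linear_map_id H.lin_twist lin_twist bilinear_lin[OF H.mult_bilinear] bilinear_lin[OF mult_bilinear]
  bilinear_lin[OF lact_bilinear] bilinear_lin[OF ract_bilinear]
  linear_map_compose[OF H.counit_linear] linear_map_compose[OF counit_linear] linear_form_scale
  linear_sw_arg[OF sweedler_map_decomp[OF H.vec_space H.vec_space H.comult_linear H.vec_space]]
  linear_sw_arg[OF sweedler_map_decomp[OF vec_space vec_space comult_linear vec_space]]
  linear_sw_arg[OF sweedler_map_decomp[OF H.vec_space vec_space lcoact_linear vec_space]]
  linear_sw_arg[OF sweedler_map_decomp[OF vec_space H.vec_space rcoact_linear vec_space]]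
  linear_sw_body multilinear_defs carrier

lemmas evals = tensor_lift_eval vec_spaces tens_eval

lemma lact_twist:
  "h \<in> vcarrier H \<Longrightarrow> a \<in> vcarrier D \<Longrightarrow> tD i j k l (h \<triangleright> a) = tH i j k l h \<triangleright> tD i j k l a"
  using op_natural_twist[OF H.bihom_structure_axioms bihom_structure_axioms bihom_structure_axioms lact_bilinear]
  by (auto simp: op_natural_def lact_struct struct_pairs_def)

lemma ract_twist:
  "h \<in> vcarrier H \<Longrightarrow> a \<in> vcarrier D \<Longrightarrow> tD i j k l (a \<triangleleft> h) = tD i j k l a \<triangleleft> tH i j k l h"
  using op_natural_twist[OF bihom_structure_axioms H.bihom_structure_axioms bihom_structure_axioms ract_bilinear]
  by (auto simp: op_natural_def ract_struct struct_pairs_def)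

lemma sL_twist:
  assumes F: "bilinear_map H D ground F" and x: "x \<in> vcarrier D"
  shows "sL (tD i j k l x) F = sL x (\<lambda>a b. F (tH i j k l a) (tD i j k l b))"
proof -
  have st: "\<rho>L (\<theta>' x) F = \<rho>L x (\<lambda>a b. F (\<theta> a) (\<theta>' b))"
    if "(\<theta>', \<theta>) \<in> struct_pairs D H" "x \<in> vcarrier D" and F: "bilinear_map H D ground F" for \<theta> \<theta>' x F
  proof -
    have "linear_map H H \<theta>" "linear_map D D \<theta>'"
      using that(1) linear_aut_struct H.linear_aut_struct by (auto simp: struct_pairs_def linear_aut_def)
    then show ?thesis
      using fun_cong[OF lcoact_struct[OF that(1,2)], of F] that(2) F
      by (simp add: evals carrier sw_decomp bilinear_map_compose)
  qed
  have "coop_natural D H D \<rho>L (tD i j k l) (tH i j k l) (tD i j k l)"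
  proof (rule coop_natural_twist[OF bihom_structure_axioms H.bihom_structure_axioms bihom_structure_axioms])
    fix x F G assume "x \<in> vcarrier D" "bilinear_map H D ground F" "bilinear_map H D ground G"
      "\<And>a b. a \<in> vcarrier H \<Longrightarrow> b \<in> vcarrier D \<Longrightarrow> F a b = G a b"
    then show "\<rho>L x F = \<rho>L x G"
      using sw_decomp[OF H.vec_space vec_space, of "\<rho>L x" F] sw_decomp[OF H.vec_space vec_space, of "\<rho>L x" G]
      by (simp add: carrier)
  qed (simp_all add: st struct_pairs_def)
  then show ?thesis
    using assms by (simp add: coop_natural_def sw_decomp vec_spaces carrier bilinear_map_compose H.linear_twist
        linear_twist)
qed

lemma sR_twist:
  assumes F: "bilinear_map D H ground F" and x: "x \<in> vcarrier D"
  shows "sR (tD i j k l x) F = sR x (\<lambda>a b. F (tD i j k l a) (tH i j k l b))"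
proof -
  have st: "\<rho>R (\<theta>' x) F = \<rho>R x (\<lambda>a b. F (\<theta>' a) (\<theta> b))"
    if "(\<theta>', \<theta>) \<in> struct_pairs D H" "x \<in> vcarrier D" and F: "bilinear_map D H ground F" for \<theta> \<theta>' x F
  proof -
    have "linear_map H H \<theta>" "linear_map D D \<theta>'"
      using that(1) linear_aut_struct H.linear_aut_struct by (auto simp: struct_pairs_def linear_aut_def)
    then show ?thesis
      using fun_cong[OF rcoact_struct[OF that(1,2)], of F] that(2) F
      by (simp add: evals carrier sw_decomp bilinear_map_compose)
  qed
  have "coop_natural D D H \<rho>R (tD i j k l) (tD i j k l) (tH i j k l)"
  proof (rule coop_natural_twist[OF bihom_structure_axioms bihom_structure_axioms H.bihom_structure_axioms])
    fix x F G assume "x \<in> vcarrier D" "bilinear_map D H ground F" "bilinear_map D H ground G"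
      "\<And>a b. a \<in> vcarrier D \<Longrightarrow> b \<in> vcarrier H \<Longrightarrow> F a b = G a b"
    then show "\<rho>R x F = \<rho>R x G"
      using sw_decomp[OF vec_space H.vec_space, of "\<rho>R x" F] sw_decomp[OF vec_space H.vec_space, of "\<rho>R x" G]
      by (simp add: carrier)
  qed (simp_all add: st struct_pairs_def)
  then show ?thesis
    using assms by (simp add: coop_natural_def sw_decomp vec_spaces carrier bilinear_map_compose H.linear_twist
        linear_twist)
qed

lemma sH_mult:
  "\<lbrakk>bilinear_map H H ground F; h \<in> vcarrier H; g \<in> vcarrier H\<rbrakk> \<Longrightarrow>
    sH (h \<cdot>\<^bsub>H\<^esub> g) F = sH h (\<lambda>h1 h2. sH g (\<lambda>g1 g2. F (h1 \<cdot>\<^bsub>H\<^esub> g1) (h2 \<cdot>\<^bsub>H\<^esub> g2)))"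
  by (subst sw_decomp, simp_all add: vec_spaces carrier) (simp add: evals H.comult_mult carrier)

lemma sH_one: "bilinear_map H H ground F \<Longrightarrow> sH \<one>\<^bsub>H\<^esub> F = F \<one>\<^bsub>H\<^esub> \<one>\<^bsub>H\<^esub>"
  by (simp add: H.comult_unit sw_decomp_tens vec_spaces carrier)

lemma sD_one: "bilinear_map D D ground F \<Longrightarrow> sD \<one>\<^bsub>D\<^esub> F = F \<one>\<^bsub>D\<^esub> \<one>\<^bsub>D\<^esub>"
  by (simp add: LR5 sw_decomp_tens vec_spaces carrier)

lemma sL_one: "bilinear_map H D ground F \<Longrightarrow> sL \<one>\<^bsub>D\<^esub> F = F \<one>\<^bsub>H\<^esub> \<one>\<^bsub>D\<^esub>"
  by (simp add: LR3_left sw_decomp_tens vec_spaces carrier)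

lemma sR_one: "bilinear_map D H ground F \<Longrightarrow> sR \<one>\<^bsub>D\<^esub> F = F \<one>\<^bsub>D\<^esub> \<one>\<^bsub>H\<^esub>"
  by (simp add: LR3_right sw_decomp_tens vec_spaces carrier)

lemma twisted_module:
  "\<lbrakk>h \<in> vcarrier H; g \<in> vcarrier H; x \<in> vcarrier D\<rbrakk> \<Longrightarrow>
    h \<triangleright> (g \<triangleright> x) = (tH (- 1) 0 0 0 h \<cdot>\<^bsub>H\<^esub> g) \<triangleright> tD 0 1 0 0 x"
  "\<lbrakk>h \<in> vcarrier H; g \<in> vcarrier H; x \<in> vcarrier D\<rbrakk> \<Longrightarrow>
    (x \<triangleleft> h) \<triangleleft> g = tD 1 0 0 0 x \<triangleleft> (h \<cdot>\<^bsub>H\<^esub> tH 0 (- 1) 0 0 g)"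
  "\<lbrakk>h \<in> vcarrier H; g \<in> vcarrier H; x \<in> vcarrier D\<rbrakk> \<Longrightarrow>
    h \<triangleright> (x \<triangleleft> g) = (tH (- 1) 0 0 0 h \<triangleright> x) \<triangleleft> tH 0 1 0 0 g"
  "x \<in> vcarrier D \<Longrightarrow> \<one>\<^bsub>H\<^esub> \<triangleright> x = tD 0 1 0 0 x"
  "x \<in> vcarrier D \<Longrightarrow> x \<triangleleft> \<one>\<^bsub>H\<^esub> = tD 1 0 0 0 x"
  using lact_assoc[of "tH (- 1) 0 0 0 h" g x] ract_assoc[of x h "tH 0 (- 1) 0 0 g"]
    bimodule_assoc[of "tH (- 1) 0 0 0 h" x g] lact_unit[of x] ract_unit[of x]
  by (simp_all add: H.struct_twist struct_twist H.twist_twist carrier)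

lemma twisted_lact_mult:
  "\<lbrakk>linear_map D ground f; h \<in> vcarrier H; a \<in> vcarrier D; b \<in> vcarrier D\<rbrakk> \<Longrightarrow>
    f (h \<triangleright> (a \<cdot>\<^bsub>D\<^esub> b)) = sH h (\<lambda>h1 h2. f ((tH (- 1) 0 (- 1) 0 h1 \<triangleright> a) \<cdot>\<^bsub>D\<^esub> (tH 0 (- 1) 0 (- 1) h2 \<triangleright> b)))"
  "\<lbrakk>linear_map D ground f; h \<in> vcarrier H; a \<in> vcarrier D; b \<in> vcarrier D\<rbrakk> \<Longrightarrow>
    f ((a \<cdot>\<^bsub>D\<^esub> b) \<triangleleft> h) = sH h (\<lambda>h1 h2. f ((a \<triangleleft> tH (- 1) 0 (- 1) 0 h1) \<cdot>\<^bsub>D\<^esub> (b \<triangleleft> tH 0 (- 1) 0 (- 1) h2)))"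
  by (simp_all add: lact_mult ract_mult linear_tensor_lift_sw[where f = f and U = D] vec_spaces carrier)

text \<open>As for the coproduct, the comodule axioms are solved for a side without structure maps. They are
  applied to \<open>F\<close> composed with the inverse structure map in one argument.\<close>
lemma sL_coassoc:
  assumes F: "trilinear_form H H D F" and x: "x \<in> vcarrier D"
  shows "sL x (\<lambda>y x0. sH y (\<lambda>y1 y2. F y1 y2 x0)) =
    sL x (\<lambda>y x0. sL x0 (\<lambda>z x00. F (tH 0 0 1 0 y) z (tD 0 0 0 (- 1) x00)))"
proof -
  note l = lin_base trilinear_lin[OF F] x
  have G: "trilinear_form H H D (\<lambda>a b c. F a b (tD 0 0 0 (- 1) c))"
    by (simp add: l)
  show ?thesis
    using fun_cong[OF lcoact_coassoc[OF x], of "\<lambda>a t. sw H D (decomp H D t) (\<lambda>b c. F a b (tD 0 0 0 (- 1) c))"]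
    by (simp add: tensor_lift_eval vec_spaces tens_eval[OF trilinear_eval[OF _ _ G]]
        struct_twist H.struct_twist sw_decomp_tens twist_twist l)
qed

lemma sR_coassoc:
  assumes F: "trilinear_form D H H F" and x: "x \<in> vcarrier D"
  shows "sR x (\<lambda>x0 x1. sH x1 (\<lambda>y1 y2. F x0 y1 y2)) =
    sR x (\<lambda>x0 x1. sR x0 (\<lambda>x00 x01. F (tD 0 0 (- 1) 0 x00) x01 (tH 0 0 0 1 x1)))"
proof -
  note l = lin_base trilinear_lin[OF F] x
  have G: "trilinear_form D H H (\<lambda>a b c. F (tD 0 0 (- 1) 0 a) b c)"
    by (simp add: l)
  show ?thesis
    using fun_cong[OF rcoact_coassoc[OF x], of "\<lambda>a t. sw H H (decomp H H t) (\<lambda>b c. F (tD 0 0 (- 1) 0 a) b c)"]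
    by (simp add: tensor_lift_eval vec_spaces tens_eval[OF trilinear_eval[OF _ _ G]]
        struct_twist H.struct_twist sw_decomp_tens twist_twist l)
qed

lemma sL_sR:
  assumes F: "trilinear_form H D H F" and x: "x \<in> vcarrier D"
  shows "sL x (\<lambda>y x0. sR x0 (\<lambda>x00 x01. F y x00 x01)) =
    sR x (\<lambda>x0 x1. sL x0 (\<lambda>y x00. F (tH 0 0 (- 1) 0 y) x00 (tH 0 0 0 1 x1)))"
proof -
  note l = lin_base trilinear_lin[OF F] x
  have G: "trilinear_form H D H (\<lambda>a b c. F (tH 0 0 (- 1) 0 a) b c)"
    by (simp add: l)
  show ?thesis
    using fun_cong[OF bicomodule_coassoc[OF x], of "\<lambda>a t. sw D H (decomp D H t) (\<lambda>b c. F (tH 0 0 (- 1) 0 a) b c)"]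
    by (simp add: tensor_lift_eval vec_spaces tens_eval[OF trilinear_eval[OF _ _ G]]
        struct_twist H.struct_twist sw_decomp_tens H.twist_twist l)
qed

lemma sL_sR_counit:
  assumes f: "linear_map D ground f" and x: "x \<in> vcarrier D"
  shows "sL x (\<lambda>y x0. \<epsilon>\<^bsub>H\<^esub> y * f x0) = f (tD 0 0 0 1 x)"
    and "sR x (\<lambda>x0 x1. f x0 * \<epsilon>\<^bsub>H\<^esub> x1) = f (tD 0 0 1 0 x)"
proof -
  have fs: "f (vscale D r y) = r * f y" if "y \<in> vcarrier D" for r y
    using f that by (simp add: linear_map_def ground_def)
  note r = linear_tensor_lift_sw[OF _ _ _ vec_space f]
  show "sL x (\<lambda>y x0. \<epsilon>\<^bsub>H\<^esub> y * f x0) = f (tD 0 0 0 1 x)"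
    using arg_cong[OF lcoact_counit[OF x], of f]
    by (simp add: r vec_spaces carrier x vec_space_closed[OF vec_space] fs struct_twist)
  show "sR x (\<lambda>x0 x1. f x0 * \<epsilon>\<^bsub>H\<^esub> x1) = f (tD 0 0 1 0 x)"
    using arg_cong[OF rcoact_counit[OF x], of f]
    by (simp add: r vec_spaces carrier x vec_space_closed[OF vec_space] fs struct_twist mult.commute)
qed

lemma sL_sR_counitD:
  assumes f: "linear_map H ground f" and c: "c \<in> vcarrier D"
  shows "sL c (\<lambda>cL c0. f cL * \<epsilon>\<^bsub>D\<^esub> c0) = \<epsilon>\<^bsub>D\<^esub> c * f \<one>\<^bsub>H\<^esub>"
    and "sR c (\<lambda>c0 cR. \<epsilon>\<^bsub>D\<^esub> c0 * f cR) = \<epsilon>\<^bsub>D\<^esub> c * f \<one>\<^bsub>H\<^esub>"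
proof -
  have fs: "f (vscale H r y) = r * f y" if "y \<in> vcarrier H" for r y
    using f that by (simp add: linear_map_def ground_def)
  note r = linear_tensor_lift_sw[OF _ _ _ H.vec_space f]
  show "sL c (\<lambda>cL c0. f cL * \<epsilon>\<^bsub>D\<^esub> c0) = \<epsilon>\<^bsub>D\<^esub> c * f \<one>\<^bsub>H\<^esub>"
    using arg_cong[OF lcoact_counitD[OF c], of f]
    by (simp add: r vec_spaces carrier c vec_space_closed[OF H.vec_space] fs mult.commute)
  show "sR c (\<lambda>c0 cR. \<epsilon>\<^bsub>D\<^esub> c0 * f cR) = \<epsilon>\<^bsub>D\<^esub> c * f \<one>\<^bsub>H\<^esub>"
    using arg_cong[OF rcoact_counitD[OF c], of f]
    by (simp add: r vec_spaces carrier c vec_space_closed[OF H.vec_space] fs)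
qed

lemma sL_comult:
  assumes F: "trilinear_form H D D F" and c: "c \<in> vcarrier D"
  shows "sL c (\<lambda>cL c0. sD c0 (\<lambda>c01 c02. F cL c01 c02)) =
    sD c (\<lambda>c1 c2. sL c1 (\<lambda>c1L c10. sL c2 (\<lambda>c2L c20.
      F (tH (- 1) 0 (- 1) 0 c1L \<cdot>\<^bsub>H\<^esub> tH 0 (- 1) 0 (- 1) c2L) c10 c20)))"
proof -
  note l = lin_base trilinear_lin[OF F] c
  show ?thesis
    using fun_cong[OF lcoact_comult[OF c], of "\<lambda>a t. sw D D (decomp D D t) (F a)"]
    by (simp add: tensor_lift_eval vec_spaces tens_eval[OF trilinear_eval[OF _ _ F]] sw_decomp_tens l)
qed

lemma sR_comult:
  assumes F: "trilinear_form D D H F" and c: "c \<in> vcarrier D"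
  shows "sR c (\<lambda>c0 cR. sD c0 (\<lambda>c01 c02. F c01 c02 cR)) =
    sD c (\<lambda>c1 c2. sR c1 (\<lambda>c10 c11. sR c2 (\<lambda>c20 c21.
      F c10 c20 (tH (- 1) 0 (- 1) 0 c11 \<cdot>\<^bsub>H\<^esub> tH 0 (- 1) 0 (- 1) c21))))"
proof -
  note l = lin_base trilinear_lin[OF F] c
  show ?thesis
    using fun_cong[OF rcoact_comult[OF c], of "\<lambda>a t. sw D H (decomp D H t) (F a)"]
    by (simp add: tensor_lift_eval vec_spaces tens_eval[OF trilinear_eval[OF _ _ F]] sw_decomp_tens l)
qed

lemma sL_mult:
  "\<lbrakk>bilinear_map H D ground F; a \<in> vcarrier D; b \<in> vcarrier D\<rbrakk> \<Longrightarrow>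
    sL (a \<cdot>\<^bsub>D\<^esub> b) F = sL a (\<lambda>aL a0. sL b (\<lambda>bL b0. F (aL \<cdot>\<^bsub>H\<^esub> bL) (a0 \<cdot>\<^bsub>D\<^esub> b0)))"
  by (subst sw_decomp, simp_all add: vec_spaces carrier) (simp add: evals LR4_left carrier)

lemma sR_mult:
  "\<lbrakk>bilinear_map D H ground F; a \<in> vcarrier D; b \<in> vcarrier D\<rbrakk> \<Longrightarrow>
    sR (a \<cdot>\<^bsub>D\<^esub> b) F = sR a (\<lambda>a0 a1. sR b (\<lambda>b0 b1. F (a0 \<cdot>\<^bsub>D\<^esub> b0) (a1 \<cdot>\<^bsub>H\<^esub> b1)))"
  by (subst sw_decomp, simp_all add: vec_spaces carrier) (simp add: evals LR4_right carrier)

lemma sD_lact: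
  "\<lbrakk>bilinear_map D D ground F; h \<in> vcarrier H; a \<in> vcarrier D\<rbrakk> \<Longrightarrow>
    sD (h \<triangleright> a) F = sH h (\<lambda>h1 h2. sD a (\<lambda>a1 a2. F (h1 \<triangleright> a1) (h2 \<triangleright> a2)))"
  by (subst sw_decomp, simp_all add: vec_spaces carrier) (simp add: evals LR6_left carrier)

lemma sD_ract:
  "\<lbrakk>bilinear_map D D ground F; h \<in> vcarrier H; a \<in> vcarrier D\<rbrakk> \<Longrightarrow>
    sD (a \<triangleleft> h) F = sD a (\<lambda>a1 a2. sH h (\<lambda>h1 h2. F (a1 \<triangleleft> h1) (a2 \<triangleleft> h2)))"
  by (subst sw_decomp, simp_all add: vec_spaces carrier) (simp add: evals LR6_right carrier)

lemma sD_mult: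
  "\<lbrakk>bilinear_map D D ground F; a \<in> vcarrier D; b \<in> vcarrier D\<rbrakk> \<Longrightarrow>
    sD (a \<cdot>\<^bsub>D\<^esub> b) F = sD a (\<lambda>a1 a2. sD b (\<lambda>b1 b2. sL a2 (\<lambda>a2L a20. sR b1 (\<lambda>b10 b11.
      F (a1 \<cdot>\<^bsub>D\<^esub> (tH (s + 1) p (q + 1) t a2L \<triangleright> tD 0 (- 1) (- 1) 0 b10))
        ((tD (- 1) 0 0 (- 1) a20 \<triangleleft> tH m (u + 1) v (n + 1) b11) \<cdot>\<^bsub>D\<^esub> b2)))))"
  by (subst sw_decomp, simp_all add: vec_spaces carrier) (simp add: evals LR7 carrier)

lemma sR_lact:
  "\<lbrakk>bilinear_map D H ground F; h \<in> vcarrier H; b \<in> vcarrier D\<rbrakk> \<Longrightarrow>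
    sR (h \<triangleright> b) F = sR b (\<lambda>b0 b1. F (tH 0 0 1 0 h \<triangleright> b0) (tH 0 1 0 0 b1))"
  by (subst sw_decomp, simp_all add: vec_spaces carrier) (simp add: evals LR9 carrier H.struct_twist)

lemma sL_ract:
  "\<lbrakk>bilinear_map H D ground F; g \<in> vcarrier H; a \<in> vcarrier D\<rbrakk> \<Longrightarrow>
    sL (a \<triangleleft> g) F = sL a (\<lambda>aL a0. F (tH 1 0 0 0 aL) (a0 \<triangleleft> tH 0 0 0 1 g))"
  by (subst sw_decomp, simp_all add: vec_spaces carrier) (simp add: evals LR11 carrier H.struct_twist)

text \<open>The left sides of this and the following two conditions contain twists that depend on the
  exponents, so they do not match untwisted expressions; suitable instances are chosen when the pair
  is untwisted.\<close>
lemma sL_lact: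
  "\<lbrakk>bilinear_map H D ground F; h \<in> vcarrier H; b \<in> vcarrier D\<rbrakk> \<Longrightarrow>
    sH h (\<lambda>h1 h2. sL (tH s (p + 1) q (t + 1) h1 \<triangleright> b) (\<lambda>xL x0. F (xL \<cdot>\<^bsub>H\<^esub> tH 1 (- 1) 1 (- 1) h2) x0)) =
    sH h (\<lambda>h1 h2. sL b (\<lambda>bL b0. F (h1 \<cdot>\<^bsub>H\<^esub> tH 1 0 0 0 bL) (tH s (p + 1) (q + 1) (t + 1) h2 \<triangleright> b0)))"
  using fun_cong[OF LR8[of h b], of F] by (simp add: evals carrier H.struct_twist)

lemma sR_ract:
  "\<lbrakk>bilinear_map D H ground F; g \<in> vcarrier H; a \<in> vcarrier D\<rbrakk> \<Longrightarrow>
    sH g (\<lambda>g1 g2. sR (a \<triangleleft> tH (m + 1) u (v + 1) n g2) (\<lambda>x0 x1. F x0 (tH (- 1) 1 (- 1) 1 g1 \<cdot>\<^bsub>H\<^esub> x1))) =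
    sR a (\<lambda>a0 a1. sH g (\<lambda>g1 g2. F (a0 \<triangleleft> tH (m + 1) u (v + 1) (n + 1) g1) (tH 0 1 0 0 a1 \<cdot>\<^bsub>H\<^esub> g2)))"
  using fun_cong[OF LR10[of a g], of F] by (simp add: evals carrier H.struct_twist)

lemma sR_sL_trivial:
  "\<lbrakk>bilinear_map D D ground F; a \<in> vcarrier D; b \<in> vcarrier D\<rbrakk> \<Longrightarrow>
    sR a (\<lambda>a0 a1. sL b (\<lambda>bL b0.
      F (tD (- 1) 0 (- 1) 0 a0 \<triangleleft> tH (m + s + 1) 0 1 (n + t) bL)
        (tH 0 (p + u + 1) (q + v) 1 a1 \<triangleright> tD 0 (- 1) 0 (- 1) b0))) = F a b"
  using fun_cong[OF LR12[of a b], of F] by (simp add: evals carrier)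

text \<open>The untwisted actions and coactions. A plain untwisting would use \<open>\<alpha>\<^sup>-\<^sup>1(h) \<triangleright> \<beta>\<^sup>-\<^sup>1(a)\<close> and
  \<open>(\<omega>\<^sup>-\<^sup>1 \<otimes> \<psi>\<^sup>-\<^sup>1) \<rho>\<^sub>R\<close>, and similarly on the other side. The additional factors \<open>\<beta>\<^sup>p\<^sup>+\<^sup>1 \<omega>\<^sup>q\<^sup>+\<^sup>1\<close>,
  \<open>\<alpha>\<^sup>m\<^sup>+\<^sup>1 \<psi>\<^sup>n\<^sup>+\<^sup>1\<close>, \<open>\<alpha>\<^sup>s\<^sup>+\<^sup>1 \<psi>\<^sup>t\<^sup>+\<^sup>1\<close> and \<open>\<beta>\<^sup>u\<^sup>+\<^sup>1 \<omega>\<^sup>v\<^sup>+\<^sup>1\<close> are those that make the multiplication and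
  comultiplication of the biproduct twists of \<open>smash\<close> and \<open>cosmash\<close>.\<close>
definition ulact where "ulact h a = tH (- 1) (p + 1) (q + 1) 0 h \<triangleright> tD 0 (- 1) 0 0 a"
definition uract where "uract a g = tD (- 1) 0 0 0 a \<triangleleft> tH (m + 1) (- 1) 0 (n + 1) g"
definition uL where "uL c = sw_map H D (tH (s + 1) 0 (- 1) (t + 1)) (tD 0 0 0 (- 1)) (decomp H D (\<rho>L c))"
definition uR where "uR c = sw_map D H (tD 0 0 (- 1) 0) (tH 0 (u + 1) (v + 1) (- 1)) (decomp D H (\<rho>R c))"

lemma sw_uL: "sw H D (uL c) F = sL c (\<lambda>x y. F (tH (s + 1) 0 (- 1) (t + 1) x) (tD 0 0 0 (- 1) y))"
  unfolding uL_def by (rule sw_sw_map[OF H.linear_twist linear_twist])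

lemma sw_uR: "sw D H (uR c) F = sR c (\<lambda>x y. F (tD 0 0 (- 1) 0 x) (tH 0 (u + 1) (v + 1) (- 1) y))"
  unfolding uR_def by (rule sw_sw_map[OF linear_twist H.linear_twist])

lemma sweedler_uL: "sweedler_map D H D uL"
proof -
  have "linear_map D ground (\<lambda>x. sw H D (uL x) F)" if "bilinear_map H D ground F" for F
    by (simp add: sw_uL lin_base bilinear_lin[OF that])
  then show ?thesis by (simp add: sweedler_map_def)
qed

lemma sweedler_uR: "sweedler_map D D H uR"
proof -
  have "linear_map D ground (\<lambda>x. sw D H (uR x) F)" if "bilinear_map D H ground F" for F
    by (simp add: sw_uR lin_base bilinear_lin[OF that])
  then show ?thesis by (simp add: sweedler_map_def)
qed

lemmas untwist = untwist_mult_def HC.sw_untwist_comult DC.sw_untwist_comult ulact_def uract_def sw_uL sw_uR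

lemmas natural = HA.twist_mult DA.twist_mult HA.twist_unit DA.twist_unit H.twist_twist twist_twist
  lact_twist ract_twist HC.sC_twist DC.sC_twist sL_twist sR_twist HC.counit_twist DC.counit_twist

text \<open>Each ordinary axiom is obtained from its BiHom-counterpart by moving all twists inwards to the
  variables: by naturality they pass through products, actions, coproducts and coactions, and there
  their exponents add up. The cases are in the order of the axioms of \<open>LR_pair\<close>.\<close>
lemma LR_pair_untwist:
  "LR_pair H (untwist_mult H) \<one>\<^bsub>H\<^esub> (untwist_comult H) \<epsilon>\<^bsub>H\<^esub>
     D (untwist_mult D) \<one>\<^bsub>D\<^esub> (untwist_comult D) \<epsilon>\<^bsub>D\<^esub> ulact uract uL uR"
proof (intro LR_pair.intro HA.assoc_algebra_untwist HC.sweedler_coalgebra_untwist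
    DA.assoc_algebra_untwist DC.sweedler_coalgebra_untwist LR_pair_axioms.intro, goal_cases)
  case (1 F h g) then show ?case
    by (simp add: untwist natural sH_mult lin_base bilinear_lin[OF 1(1)])
next
  case (2 F) then show ?case
    by (simp add: untwist natural sH_one lin_base bilinear_lin[OF 2(1)])
next
  case (3 h g) then show ?case by (simp add: untwist natural carrier H.counit_mult)
next
  case 4 then show ?case by (rule H.counit_unit)
next
  case 5 then show ?case by (simp add: untwist lin_base)
next
  case 6 then show ?case by (simp add: untwist lin_base)
next
  case 7 then show ?case by (simp add: untwist natural carrier twisted_module algebra_simps)
next
  case 8 then show ?case by (simp add: untwist natural carrier twisted_module algebra_simps)
next
  case 9 then show ?case by (simp add: untwist natural carrier twisted_module algebra_simps)
next
  case 10 then show ?case by (simp add: untwist natural carrier twisted_module algebra_simps)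
next
  case 11 then show ?case by (simp add: untwist natural carrier twisted_module algebra_simps)
next
  case (12 f h a b) then show ?case
    by (simp add: untwist natural lin_base linear_map_compose[OF 12(1)] twisted_lact_mult algebra_simps)
next
  case (13 f h a b) then show ?case
    by (simp add: untwist natural lin_base linear_map_compose[OF 13(1)] twisted_lact_mult algebra_simps)
next
  case (14 h) then show ?case by (simp add: untwist natural lin_base lact_one)
next
  case (15 h) then show ?case by (simp add: untwist natural lin_base ract_one)
next
  case 16 show ?case by (rule sweedler_uL)
next
  case 17 show ?case by (rule sweedler_uR)
next
  case (18 F a) then show ?case
    by (simp add: untwist natural lin_base trilinear_lin[OF 18(1)] sL_coassoc algebra_simps)
next
  case (19 F a) then show ?case
    by (simp add: untwist natural lin_base trilinear_lin[OF 19(1)] sR_coassoc algebra_simps)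
next
  case (20 F a) then show ?case
    by (simp add: untwist natural lin_base trilinear_lin[OF 20(1)] sL_sR algebra_simps)
next
  case (21 f a) then show ?case
    by (simp add: untwist natural lin_base linear_map_compose[OF 21(1)] sL_sR_counit)
next
  case (22 f a) then show ?case
    by (simp add: untwist natural lin_base linear_map_compose[OF 22(1)] sL_sR_counit)
next
  case (23 F a) then show ?case
    by (simp add: untwist natural lin_base trilinear_lin[OF 23(1)] sL_comult algebra_simps)
next
  case (24 F a) then show ?case
    by (simp add: untwist natural lin_base trilinear_lin[OF 24(1)] sR_comult algebra_simps)
next
  case (25 f a) then show ?case
    by (simp add: untwist natural lin_base linear_map_compose[OF 25(1)] sL_sR_counitD)
next
  case (26 f a) then show ?case
    by (simp add: untwist natural lin_base linear_map_compose[OF 26(1)] sL_sR_counitD)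
next
  case 27 then show ?case by (rule LR1_unit)
next
  case 28 then show ?case by (simp add: untwist natural carrier LR1_mult)
next
  case 29 then show ?case by (simp add: untwist natural carrier LR2_left)
next
  case 30 then show ?case by (simp add: untwist natural carrier LR2_right)
next
  case (31 F) then show ?case by (simp add: untwist natural sL_one lin_base bilinear_lin[OF 31(1)])
next
  case (32 F) then show ?case by (simp add: untwist natural sR_one lin_base bilinear_lin[OF 32(1)])
next
  case (33 F a b) then show ?case
    by (simp add: untwist natural sL_mult lin_base bilinear_lin[OF 33(1)] algebra_simps)
next
  case (34 F a b) then show ?case
    by (simp add: untwist natural sR_mult lin_base bilinear_lin[OF 34(1)] algebra_simps)
next
  case (35 F) then show ?case by (simp add: untwist natural sD_one lin_base bilinear_lin[OF 35(1)])
next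
  case (36 F h a) then show ?case
    by (simp add: untwist natural sD_lact lin_base bilinear_lin[OF 36(1)] algebra_simps)
next
  case (37 F h a) then show ?case
    by (simp add: untwist natural sD_ract lin_base bilinear_lin[OF 37(1)] algebra_simps)
next
  case (38 F a b) then show ?case
    by (simp add: untwist natural sD_mult lin_base bilinear_lin[OF 38(1)] algebra_simps)
next
  case (39 F h b)
  \<comment> \<open>Left coaction of \<open>h \<triangleright> b\<close>. The untwisted coaction applies \<open>\<alpha>\<^sup>s\<^sup>+\<^sup>1 \<omega>\<^sup>-\<^sup>1 \<psi>\<^sup>t\<^sup>+\<^sup>1\<close> to the component in \<open>H\<close>, one
    \<open>\<alpha>\<close> of which is used up by the product. The given condition acts with \<open>\<alpha>\<^sup>s \<beta>\<^sup>p\<^sup>+\<^sup>1 \<omega>\<^sup>q \<psi>\<^sup>t\<^sup>+\<^sup>1(h\<^sub>1)\<close>, the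
    untwisted action with \<open>\<alpha>\<^sup>-\<^sup>1 \<beta>\<^sup>p\<^sup>+\<^sup>1 \<omega>\<^sup>q(h\<^sub>1)\<close>, as the untwisted coproduct contributes \<open>\<omega>\<^sup>-\<^sup>1\<close>; hence the
        shift of \<open>h\<close>.\<close>
  have "sH (tH (- s - 1) 0 0 (- t - 1) h) (\<lambda>h1 h2. sL (tH s (p + 1) q (t + 1) h1 \<triangleright> tD 0 (- 1) 0 0 b) (\<lambda>xL x0.
      F (tH s 0 (- 1) (t + 1) (xL \<cdot>\<^bsub>H\<^esub> tH 1 (- 1) 1 (- 1) h2)) (tD 0 0 0 (- 1) x0))) =
    sH (tH (- s - 1) 0 0 (- t - 1) h) (\<lambda>h1 h2. sL (tD 0 (- 1) 0 0 b) (\<lambda>bL b0.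
      F (tH s 0 (- 1) (t + 1) (h1 \<cdot>\<^bsub>H\<^esub> tH 1 0 0 0 bL)) (tD 0 0 0 (- 1) (tH s (p + 1) (q + 1) (t + 1) h2 \<triangleright> b0))))"
    using 39 by (intro sL_lact) (simp_all add: lin_base bilinear_lin[OF 39(1)])
  then show ?case using 39
    by (simp add: untwist natural lin_base bilinear_lin[OF 39(1)] algebra_simps)
next
  case (40 F h b) then show ?case
    by (simp add: untwist natural sR_lact lin_base bilinear_lin[OF 40(1)] algebra_simps)
next
  case (41 F g a)
  \<comment> \<open>The mirror image for the right coaction of \<open>a \<triangleleft> g\<close>.\<close>
  have "sH (tH 0 (- u - 1) (- v - 1) 0 g) (\<lambda>g1 g2. sR (tD (- 1) 0 0 0 a \<triangleleft> tH (m + 1) u (v + 1) n g2) (\<lambda>x0 x1.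
      F (tD 0 0 (- 1) 0 x0) (tH 0 u (v + 1) (- 1) (tH (- 1) 1 (- 1) 1 g1 \<cdot>\<^bsub>H\<^esub> x1)))) =
    sR (tD (- 1) 0 0 0 a) (\<lambda>a0 a1. sH (tH 0 (- u - 1) (- v - 1) 0 g) (\<lambda>g1 g2.
      F (tD 0 0 (- 1) 0 (a0 \<triangleleft> tH (m + 1) u (v + 1) (n + 1) g1)) (tH 0 u (v + 1) (- 1) (tH 0 1 0 0 a1 \<cdot>\<^bsub>H\<^esub> g2))))"
    using 41 by (intro sR_ract) (simp_all add: lin_base bilinear_lin[OF 41(1)])
  then show ?case using 41
    by (simp add: untwist natural lin_base bilinear_lin[OF 41(1)] algebra_simps)
next
  case (42 F g a) then show ?case
    by (simp add: untwist natural sL_ract lin_base bilinear_lin[OF 42(1)] algebra_simps)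
next
  case (43 F a b)
  \<comment> \<open>Shifting \<open>b\<close> by \<open>\<alpha> \<beta>\<^sup>-\<^sup>1 \<omega>\<^sup>-\<^sup>2 \<psi>\<^sup>2\<close> matches the exponents in the first factor, and the inverse shift
    applied to the second factor does so there.\<close>
  show ?case
    using sR_sL_trivial[of "\<lambda>x y. F x (tD (- 1) 1 2 (- 2) y)" a "tD 1 (- 1) (- 2) 2 b"] 43
    by (simp add: untwist natural lin_base bilinear_lin[OF 43(1)] algebra_simps)
qed

end

section \<open>Forms on tensor products\<close>

text \<open>By construction pure tensors vanish at functions that are not bilinear; hence tensors are
  determined by their values at bilinear forms.\<close>
lemma tensor_eval_nonbilinear:
  assumes "vec_space V" "vec_space W" "z \<in> vcarrier (tensor_space V W)" "\<not> bilinear_map V W ground B"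
  shows "z B = 0"
proof -
  obtain xs where "z = (\<Sum>(v, w)\<leftarrow>xs. v \<otimes>\<^bsub>V,W\<^esub> w)"
    using tensor_decompose[OF assms(1-3)] by blast
  moreover have "(\<Sum>(v, w)\<leftarrow>xs. v \<otimes>\<^bsub>V,W\<^esub> w) B = 0"
    using assms(4) by (induction xs) (auto simp: tens_def)
  ultimately show ?thesis by simp
qed

lemma tensor_eqI:
  assumes "vec_space V" "vec_space W" "x \<in> vcarrier (tensor_space V W)" "y \<in> vcarrier (tensor_space V W)"
    and "\<And>B. bilinear_map V W ground B \<Longrightarrow> x B = y B"
  shows "x = y"
proof
  fix B
  show "x B = y B"
    using assms(5)[of B] tensor_eval_nonbilinear[OF assms(1-3), of B] tensor_eval_nonbilinear[OF assms(1,2,4), of B]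
    by (cases "bilinear_map V W ground B") auto
qed

lemma tensor_lift_closed:
  assumes "vec_space V" "vec_space W" "vec_space U" "z \<in> vcarrier (tensor_space V W)"
    and "\<And>v w. v \<in> vcarrier V \<Longrightarrow> w \<in> vcarrier W \<Longrightarrow> f v w \<in> vcarrier U"
  shows "tensor_lift V W z f \<in> vcarrier U"
proof -
  have "(\<Sum>(v, w)\<leftarrow>xs. f v w) \<in> vcarrier U" if "set xs \<subseteq> vcarrier V \<times> vcarrier W" for xs
    using that by (induction xs) (auto simp: vec_space_closed[OF assms(3)] assms(5))
  then show ?thesis
    using decomp(1)[OF assms(1,2,4)] by (simp add: tensor_lift_decomp)
qed

lemma linear_form_eval: "linear_map X (tensor_space V W) g \<Longrightarrow> linear_map X ground (\<lambda>x. g x B)"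
  by (auto simp: linear_map_def ground_def tensor_space_def tensor_scale_def)

lemma bilinear_form_compose:
  "linear_map U ground f \<Longrightarrow> bilinear_map V W U g \<Longrightarrow> bilinear_map V W ground (\<lambda>v w. f (g v w))"
  by (auto simp: bilinear_map_def linear_map_def)

text \<open>A linear form on the tensor product evaluated at \<open>z\<close> is \<open>z\<close> evaluated at the corresponding bilinear
  form. Thus products, which are not pure tensors, can be fed into linear forms.\<close>
lemma linear_form_tensor:
  assumes "vec_space V" "vec_space W" and f: "linear_map (tensor_space V W) ground f"
    and "z \<in> vcarrier (tensor_space V W)"
  shows "f z = z (\<lambda>v w. f (v \<otimes>\<^bsub>V,W\<^esub> w))"
proof -
  note T = vec_space_tensor[of V W]
  have B: "bilinear_map V W ground (\<lambda>v w. f (v \<otimes>\<^bsub>V,W\<^esub> w))"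
    by (rule bilinear_form_compose[OF f bilinear_tens])
  have "f z = f (tensor_lift V W z (\<lambda>v w. v \<otimes>\<^bsub>V,W\<^esub> w))"
    using decomp(2)[OF assms(1,2,4)] by (simp add: tensor_lift_decomp)
  also have "\<dots> = sw V W (decomp V W z) (\<lambda>v w. f (v \<otimes>\<^bsub>V,W\<^esub> w))"
    by (rule linear_tensor_lift_sw[OF assms(1,2,4) T f tens_closed])
  also have "\<dots> = z (\<lambda>v w. f (v \<otimes>\<^bsub>V,W\<^esub> w))"
    by (rule sw_decomp[OF assms(1,2,4) B])
  finally show ?thesis .
qed

lemma linear_forms_eq_on_tensors:
  assumes "vec_space V" "vec_space W" and f: "linear_map (tensor_space V W) ground f"
    and g: "linear_map (tensor_space V W) ground g"
    and z: "z \<in> vcarrier (tensor_space V W)"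
    and eq: "\<And>v w. v \<in> vcarrier V \<Longrightarrow> w \<in> vcarrier W \<Longrightarrow> f (v \<otimes>\<^bsub>V,W\<^esub> w) = g (v \<otimes>\<^bsub>V,W\<^esub> w)"
  shows "f z = g z"
proof -
  note B = bilinear_form_compose[OF f bilinear_tens] bilinear_form_compose[OF g bilinear_tens]
  show ?thesis
    unfolding linear_form_tensor[OF assms(1,2) f z] linear_form_tensor[OF assms(1,2) g z]
    unfolding sw_decomp[OF assms(1,2) z B(1), symmetric] sw_decomp[OF assms(1,2) z B(2), symmetric]
    using eq by (intro sw_cong refl)
qed

lemma linear_map_tensorI:
  assumes "vec_space X" "vec_space V" "vec_space W"
    and "\<And>x. x \<in> vcarrier X \<Longrightarrow> g x \<in> vcarrier (tensor_space V W)"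
    and lin: "\<And>B. bilinear_map V W ground B \<Longrightarrow> linear_map X ground (\<lambda>x. g x B)"
  shows "linear_map X (tensor_space V W) g"
proof -
  note T = vec_space_tensor[of V W]
  show ?thesis
    unfolding linear_map_def
  proof (intro conjI ballI allI assms(4))
    fix x y assume xy: "x \<in> vcarrier X" "y \<in> vcarrier X"
    show "g (x + y) = g x + g y"
      by (rule tensor_eqI[OF assms(2,3)])
        (use xy linear_map_add[OF lin] in \<open>auto simp: assms(4) vec_space_closed[OF assms(1)] vec_space_closed[OF T]\<close>)
  next
    fix r x assume x: "x \<in> vcarrier X"
    show "g (vscale X r x) = vscale (tensor_space V W) r (g x)"
    proof (rule tensor_eqI[OF assms(2,3) assms(4) vec_space_closed(3)[OF T]])
      fix B assume "bilinear_map V W ground B"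
      then show "g (vscale X r x) B = vscale (tensor_space V W) r (g x) B"
        using linear_map_scale[OF lin x, of B r]
        by (simp add: tensor_space_def tensor_scale_def ground_def)
    qed (use x assms(4) vec_space_closed(3)[OF assms(1)] in auto)
  qed
qed

section \<open>The biproduct as a twist of the ordinary biproduct\<close>

context twisted_LR_pair
begin

sublocale U: LR_pair H "untwist_mult H" "\<one>\<^bsub>H\<^esub>" "untwist_comult H" "\<epsilon>\<^bsub>H\<^esub>"
  D "untwist_mult D" "\<one>\<^bsub>D\<^esub>" "untwist_comult D" "\<epsilon>\<^bsub>D\<^esub>" ulact uract uL uR
  by (rule LR_pair_untwist)

lemma endomorphism_twist:
  "LR_endomorphism H (untwist_mult H) \<one>\<^bsub>H\<^esub> (untwist_comult H) \<epsilon>\<^bsub>H\<^esub>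
     D (untwist_mult D) \<one>\<^bsub>D\<^esub> (untwist_comult D) \<epsilon>\<^bsub>D\<^esub> ulact uract uL uR (tH i j k l) (tD i j k l)"
proof (intro LR_endomorphism.intro LR_pair_untwist LR_endomorphism_axioms.intro)
  show "linear_map H H (tH i j k l)" "linear_map D D (tD i j k l)"
    by (rule H.linear_twist linear_twist)+
qed (simp_all add: untwist natural lin_base bilinear_lin algebra_simps)

abbreviation P where "P \<equiv> U.smash"
abbreviation C where "C \<equiv> U.cosmash"

lemmas P_twist = LR_endomorphism.smash_natural[OF endomorphism_twist]
lemmas C_twist = LR_endomorphism.cosmash_natural[OF endomorphism_twist]

text \<open>The arguments of \<open>F\<close> lie in the carriers only if \<open>a\<close> and \<open>b\<close> do, so this is no rule for the
  simplifier and is applied by hand.\<close>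
lemma P_cong:
  assumes "a \<in> vcarrier D" "b \<in> vcarrier D"
    and "\<And>x y. x \<in> vcarrier D \<Longrightarrow> y \<in> vcarrier H \<Longrightarrow> F x y = G x y"
  shows "P a h b g F = P a h b g G"
  using assms by (simp add: U.smash_def U.closed)

lemma C_cong:
  assumes "\<And>x y z w. x \<in> vcarrier D \<Longrightarrow> y \<in> vcarrier H \<Longrightarrow> z \<in> vcarrier D \<Longrightarrow> w \<in> vcarrier H \<Longrightarrow>
    F x y z w = G x y z w"
  shows "C c h F = C c h G"
  using assms by (simp add: U.cosmash_def U.closed)

abbreviation "T \<equiv> tensor_space D H"
abbreviation "E \<equiv> LR_biproduct H D lact ract \<rho>L \<rho>R m n p q s t u v"
abbreviation tw (infix "\<otimes>\<otimes>" 70) where "d \<otimes>\<otimes> h \<equiv> tens D H d h"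
text \<open>The structure maps of the biproduct are instances of the tensor product of two twists with equal
  exponents.\<close>
definition tE where "tE i j k l x = tensor_lift D H x (\<lambda>d h. tD i j k l d \<otimes>\<otimes> tH i j k l h)"

text \<open>The record of the biproduct has the same carrier and scalar multiplication as \<open>D \<otimes> H\<close>, hence the
  same linear maps, bilinear forms and tensor products. This replaces it by \<open>D \<otimes> H\<close> in all axioms.\<close>
lemma E_simps:
  "vcarrier E = vcarrier T" "vscale E = vscale T"
  "linear_map E X f = linear_map T X f" "linear_map Y E g = linear_map Y T g"
  "vec_space E"
  using vec_space_tensor[of D H] by (simp_all add: LR_biproduct_def linear_map_def vec_space_def)

lemma E_tensor:
  "bilinear_map E X Y f = bilinear_map T X Y f" "bilinear_map X' E Y' g = bilinear_map X' T Y' g"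
  "bilinear_map X'' Y'' E g' = bilinear_map X'' Y'' T g'"
  by (simp_all add: bilinear_map_def E_simps)

lemma E_tensor2:
  "tens E X = tens T X" "tens Y E = tens Y T"
  by (simp_all add: fun_eq_iff tens_def E_tensor)

lemma E_tensor3: "tensor_space E X = tensor_space T X" "tensor_space Y E = tensor_space Y T"
  "tensor_lift E X' = tensor_lift T X'" "tensor_lift Y' E = tensor_lift Y' T"
  by (simp_all add: fun_eq_iff tensor_space_def tensor_lift_def E_tensor2 E_simps)

lemma E_struct: "balpha E = tE 1 0 0 0" "bbeta E = tE 0 1 0 0" "bomega E = tE 0 0 1 0" "bpsi E = tE 0 0 0 1"
  by (simp_all add: fun_eq_iff LR_biproduct_def tE_def H.struct_twist struct_twist)

lemmas spaces = vec_space H.vec_space vec_space_tensor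

lemma bilinear_twist:
  "bilinear_map D H ground B \<Longrightarrow> bilinear_map D H ground (\<lambda>d h. B (tD i j k l d) (tH i j k l h))"
  by (rule bilinear_map_compose[OF _ linear_twist H.linear_twist])

lemma tE_closed: "x \<in> vcarrier T \<Longrightarrow> tE i j k l x \<in> vcarrier T"
  unfolding tE_def by (rule tensor_lift_closed) (auto simp: spaces tens_closed carrier)

lemma tE_eval:
  "x \<in> vcarrier T \<Longrightarrow> bilinear_map D H ground B \<Longrightarrow> tE i j k l x B = x (\<lambda>d h. B (tD i j k l d) (tH i j k l h))"
  using sw_decomp[OF spaces(1,2) _ bilinear_twist, of x B i j k l]
  by (simp add: tE_def tensor_lift_eval spaces tens_eval)

lemma tE_tens: "d \<in> vcarrier D \<Longrightarrow> h \<in> vcarrier H \<Longrightarrow> tE i j k l (d \<otimes>\<otimes> h) = tD i j k l d \<otimes>\<otimes> tH i j k l h"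
  by (rule tensor_eqI[OF spaces(1,2)]) (auto simp: tE_eval tE_closed tens_closed carrier tens_eval bilinear_twist)

lemma tE_linear: "linear_map T T (tE i j k l)"
proof (rule linear_map_tensorI[OF spaces(3,1,2) tE_closed])
  fix B assume B: "bilinear_map D H ground B"
  show "linear_map T ground (\<lambda>x. tE i j k l x B)"
    by (rule linear_map_cong_on[OF spaces(3) linear_form_eval[OF linear_map_id] tE_eval[OF _ B]])
qed

lemma tE_tE: "x \<in> vcarrier T \<Longrightarrow> tE i j k l (tE i' j' k' l' x) = tE (i + i') (j + j') (k + k') (l + l') x"
proof (rule tensor_eqI[OF spaces(1,2)])
  fix B assume x: "x \<in> vcarrier T" and B: "bilinear_map D H ground B"
  have B': "bilinear_map D H ground (\<lambda>d h. B (tD i j k l (tD i' j' k' l' d)) (tH i j k l (tH i' j' k' l' h)))"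
    using bilinear_twist[OF bilinear_twist[OF B]] .
  show "tE i j k l (tE i' j' k' l' x) B = tE (i + i') (j + j') (k + k') (l + l') x B"
    using sw_decomp[OF spaces(1,2) x B'] sw_decomp[OF spaces(1,2) x bilinear_twist[OF B]]
    by (simp add: tE_eval tE_closed x B bilinear_twist twist_twist H.twist_twist)
qed (auto simp: tE_closed)

lemma tE_zero: "x \<in> vcarrier T \<Longrightarrow> tE 0 0 0 0 x = x"
  by (rule tensor_eqI[OF spaces(1,2)]) (auto simp: tE_closed tE_eval)

lemma tE_aut: "linear_aut T (tE i j k l)"
  unfolding linear_aut_def
proof (intro conjI tE_linear)
  show "bij_betw (tE i j k l) (vcarrier T) (vcarrier T)"
    by (rule bij_betw_byWitness[where f' = "tE (- i) (- j) (- k) (- l)"])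
      (auto simp: tE_tE tE_zero tE_closed)
qed

lemma bihom_structure_E: "bihom_structure E"
  by unfold_locales
    (simp_all add: E_simps E_struct linear_aut_def tE_aut[unfolded linear_aut_def] commute_on_def tE_tE)

abbreviation mE (infixl "\<diamondop>" 75) where "mE \<equiv> bmult E"
abbreviation cE where "cE \<equiv> bcomult E"
abbreviation eE where "eE \<equiv> bcounit E"

text \<open>The Sweedler expressions in the definition of the biproduct, evaluated at a form.\<close>
abbreviation P1 where "P1 a h b g B \<equiv> sH h (\<lambda>h1 h2. sH g (\<lambda>g1 g2.
    B ((tD (- 1) 0 0 0 a \<triangleleft> tH m 0 0 n g2) \<cdot>\<^bsub>D\<^esub> (tH 0 p q 0 h1 \<triangleright> tD 0 (- 1) 0 0 b))
      (tH 0 0 0 (- 1) h2 \<cdot>\<^bsub>H\<^esub> tH 0 0 (- 1) 0 g1)))"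

abbreviation C1 where "C1 c h Q \<equiv> sD c (\<lambda>c1 c2. sH h (\<lambda>h1 h2. sR c1 (\<lambda>c10 c11. sL c2 (\<lambda>c2L c20.
    Q (tD 0 0 (- 1) 0 c10 \<otimes>\<otimes> (tH s 0 0 t c2L \<cdot>\<^bsub>H\<^esub> tH 0 (- 1) 0 0 h1))
      (tD 0 0 0 (- 1) c20 \<otimes>\<otimes> (tH (- 1) 0 0 0 h2 \<cdot>\<^bsub>H\<^esub> tH 0 u v 0 c11))))))"

lemma mE_closed: "x \<in> vcarrier T \<Longrightarrow> y \<in> vcarrier T \<Longrightarrow> x \<diamondop> y \<in> vcarrier T"
  unfolding LR_biproduct_def bihom.simps
  by (intro tensor_lift_closed spaces tens_closed) (auto simp: carrier)

lemma mE_eval: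
  assumes "x \<in> vcarrier T" "y \<in> vcarrier T" "bilinear_map D H ground B"
  shows "(x \<diamondop> y) B = sw D H (decomp D H x) (\<lambda>a h. sw D H (decomp D H y) (\<lambda>b g. P1 a h b g B))"
  using assms by (simp add: LR_biproduct_def tensor_lift_eval spaces carrier tens_eval)

lemma cE_closed: "x \<in> vcarrier T \<Longrightarrow> cE x \<in> vcarrier (tensor_space T T)"
  unfolding LR_biproduct_def bihom.simps
  by (intro tensor_lift_closed spaces tens_closed) (auto simp: carrier)

lemma cE_eval:
  assumes "x \<in> vcarrier T" "bilinear_map T T ground Q"
  shows "cE x Q = sw D H (decomp D H x) (\<lambda>c h. C1 c h Q)"
  using assms by (simp add: LR_biproduct_def tensor_lift_eval spaces carrier tens_eval tens_closed)

lemma sweedler_tensor: "sweedler_map T D H (decomp D H)" "sweedler_map (tensor_space T T) T T (decomp T T)"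
  using sweedler_map_decomp[OF spaces(1,2) linear_map_id spaces(3)] sweedler_map_decomp[OF spaces(3,3)
      linear_map_id spaces(3)]
  by simp_all

lemma eE_eval: "x \<in> vcarrier T \<Longrightarrow> eE x = sw D H (decomp D H x) (\<lambda>d h. \<epsilon>\<^bsub>D\<^esub> d * \<epsilon>\<^bsub>H\<^esub> h)"
  using decomp(1)[OF spaces(1,2)] by (simp add: LR_biproduct_def tensor_lift_decomp sw_sum_list)

lemmas lin_tens = lin_base bilinear_lin[OF bilinear_tens] tens_closed

lemma mE_bilinear: "bilinear_map T T T mE"
  unfolding bilinear_map_def
proof (intro conjI ballI)
  fix x assume x: "x \<in> vcarrier T"
  show "linear_map T T (mE x)"
  proof (rule linear_map_tensorI[OF spaces(3,1,2) mE_closed[OF x]])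
    fix B assume B: "bilinear_map D H ground B"
    show "linear_map T ground (\<lambda>y. (x \<diamondop> y) B)"
      by (rule linear_map_cong_on[OF spaces(3) _ mE_eval[OF x _ B]])
        (simp_all add: lin_tens linear_sw_arg[OF sweedler_tensor(1)] bilinear_lin[OF B])
  qed
next
  fix y assume y: "y \<in> vcarrier T"
  show "linear_map T T (\<lambda>x. x \<diamondop> y)"
  proof (rule linear_map_tensorI[OF spaces(3,1,2) mE_closed[OF _ y]])
    fix B assume B: "bilinear_map D H ground B"
    show "linear_map T ground (\<lambda>x. (x \<diamondop> y) B)"
      by (rule linear_map_cong_on[OF spaces(3) _ mE_eval[OF _ y B]])
        (simp_all add: lin_tens linear_sw_arg[OF sweedler_tensor(1)] bilinear_lin[OF B])
  qed
qed

lemma cE_linear: "linear_map T (tensor_space T T) cE"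
proof (rule linear_map_tensorI[OF spaces(3,3,3) cE_closed])
  fix Q assume Q: "bilinear_map T T ground Q"
  show "linear_map T ground (\<lambda>x. cE x Q)"
    by (rule linear_map_cong_on[OF spaces(3) _ cE_eval[OF _ Q]])
      (simp_all add: lin_tens linear_sw_arg[OF sweedler_tensor(1)] bilinear_lin[OF Q])
qed

lemma eE_linear: "linear_map T ground eE"
  by (rule linear_map_cong_on[OF spaces(3) _ eE_eval]) (simp_all add: lin_tens linear_sw_arg[OF sweedler_tensor(1)])

text \<open>The product of the biproduct is the twist by \<open>\<alpha>\<close> and \<open>\<beta>\<close> of the ordinary smash product of the
  untwisted pair; here the choice of the exponents in \<open>ulact\<close> and \<open>uract\<close> pays off.\<close>
lemma mE_tens:
  assumes "a \<in> vcarrier D" "h \<in> vcarrier H" "b \<in> vcarrier D" "g \<in> vcarrier H" and B: "bilinear_map D H ground B"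
  shows "((a \<otimes>\<otimes> h) \<diamondop> (b \<otimes>\<otimes> g)) B = P (tD 1 0 0 0 a) (tH 1 0 0 0 h) (tD 0 1 0 0 b) (tH 0 1 0 0 g) B"
  using assms
  by (simp add: mE_eval tens_closed sw_decomp_tens spaces lin_tens bilinear_lin[OF B] U.smash_def untwist
      natural algebra_simps)

text \<open>Likewise for the coproduct, which is twisted by \<open>\<omega>\<close> and \<open>\<psi>\<close> on its two tensor factors.\<close>
lemma cE_tens:
  assumes "c \<in> vcarrier D" "h \<in> vcarrier H" and Q: "bilinear_map T T ground Q"
  shows "cE (c \<otimes>\<otimes> h) Q = C c h (\<lambda>d k d' k'. Q (tD 0 0 1 0 d \<otimes>\<otimes> tH 0 0 1 0 k) (tD 0 0 0 1 d' \<otimes>\<otimes> tH 0 0 0 1 k'))"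
  using assms
  by (simp add: cE_eval tens_closed sw_decomp_tens spaces lin_tens bilinear_lin[OF Q] U.cosmash_def untwist
      natural algebra_simps
      sw_swap[of H H _ D D])

lemma eE_tens:
  "d \<in> vcarrier D \<Longrightarrow> h \<in> vcarrier H \<Longrightarrow> eE (d \<otimes>\<otimes> h) = \<epsilon>\<^bsub>D\<^esub> d * \<epsilon>\<^bsub>H\<^esub> h"
  by (simp add: eE_eval tens_closed sw_decomp_tens spaces lin_tens)

lemma E_unit: "bunit E = \<one>\<^bsub>D\<^esub> \<otimes>\<otimes> \<one>\<^bsub>H\<^esub>"
  by (simp add: LR_biproduct_def)

abbreviation sE where "sE x \<equiv> sw T T (decomp T T (cE x))"
abbreviation uE where "uE \<equiv> \<one>\<^bsub>D\<^esub> \<otimes>\<otimes> \<one>\<^bsub>H\<^esub>"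

lemmas lin_E = lin_tens bilinear_lin[OF mE_bilinear] linear_map_compose[OF tE_linear] linear_map_compose[OF eE_linear]
  linear_sw_arg[OF sweedler_map_decomp[OF spaces(3,3) cE_linear spaces(3)]] linear_sw_arg[OF sweedler_tensor(1)]
  tE_closed mE_closed cE_closed

lemmas lin_PC = U.smash_def U.cosmash_def U.lin_intros U.closed lin_E

lemma sE_eval: "x \<in> vcarrier T \<Longrightarrow> bilinear_map T T ground Q \<Longrightarrow> cE x Q = sE x Q"
  by (simp add: sw_decomp spaces cE_closed)

lemma mE_eval_lin:
  "linear_map V T f \<Longrightarrow> y \<in> vcarrier T \<Longrightarrow> linear_map V ground (\<lambda>x. (f x \<diamondop> y) B)"
  "linear_map V T f \<Longrightarrow> y \<in> vcarrier T \<Longrightarrow> linear_map V ground (\<lambda>x. (y \<diamondop> f x) B)"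
  by (rule linear_form_eval[where V = D and W = H]; simp add: lin_E)+

lemma E_aut: "linear_aut E f = linear_aut T f"
  by (simp add: linear_aut_def E_simps)

lemma mE_form:
  assumes L: "linear_map T ground L"
    and mem: "a \<in> vcarrier D" "h \<in> vcarrier H" "b \<in> vcarrier D" "g \<in> vcarrier H"
  shows "L ((a \<otimes>\<otimes> h) \<diamondop> (b \<otimes>\<otimes> g)) =
    P (tD 1 0 0 0 a) (tH 1 0 0 0 h) (tD 0 1 0 0 b) (tH 0 1 0 0 g) (\<lambda>x y. L (x \<otimes>\<otimes> y))"
  using linear_form_tensor[OF spaces(1,2) L mE_closed[OF tens_closed tens_closed]]
    mE_tens[OF mem bilinear_form_compose[OF L bilinear_tens]] mem by simp

lemma sE_tens:
  assumes "c \<in> vcarrier D" "h \<in> vcarrier H" and Q: "bilinear_map T T ground Q"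
  shows "sE (c \<otimes>\<otimes> h) Q = C c h (\<lambda>d k d' k'. Q (tD 0 0 1 0 d \<otimes>\<otimes> tH 0 0 1 0 k) (tD 0 0 0 1 d' \<otimes>\<otimes> tH 0 0 0 1 k'))"
  using cE_tens[OF assms] sE_eval[OF tens_closed Q] assms by simp

lemma mE_form2:
  assumes Q: "bilinear_map T T ground Q"
    and mem: "a \<in> vcarrier D" "h \<in> vcarrier H" "b \<in> vcarrier D" "g \<in> vcarrier H"
      "a' \<in> vcarrier D" "h' \<in> vcarrier H" "b' \<in> vcarrier D" "g' \<in> vcarrier H"
  shows "Q ((a \<otimes>\<otimes> h) \<diamondop> (b \<otimes>\<otimes> g)) ((a' \<otimes>\<otimes> h') \<diamondop> (b' \<otimes>\<otimes> g')) =
    P (tD 1 0 0 0 a) (tH 1 0 0 0 h) (tD 0 1 0 0 b) (tH 0 1 0 0 g) (\<lambda>x y.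
      P (tD 1 0 0 0 a') (tH 1 0 0 0 h') (tD 0 1 0 0 b') (tH 0 1 0 0 g') (\<lambda>z w. Q (x \<otimes>\<otimes> y) (z \<otimes>\<otimes> w)))"
proof -
  note Ql = bilinear_lin[OF Q]
  have "Q ((a \<otimes>\<otimes> h) \<diamondop> (b \<otimes>\<otimes> g)) ((a' \<otimes>\<otimes> h') \<diamondop> (b' \<otimes>\<otimes> g')) =
    P (tD 1 0 0 0 a) (tH 1 0 0 0 h) (tD 0 1 0 0 b) (tH 0 1 0 0 g) (\<lambda>x y.
      Q (x \<otimes>\<otimes> y) ((a' \<otimes>\<otimes> h') \<diamondop> (b' \<otimes>\<otimes> g')))"
    using mem by (intro mE_form) (simp_all add: lin_E Ql)
  also have "\<dots> = P (tD 1 0 0 0 a) (tH 1 0 0 0 h) (tD 0 1 0 0 b) (tH 0 1 0 0 g) (\<lambda>x y.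
      P (tD 1 0 0 0 a') (tH 1 0 0 0 h') (tD 0 1 0 0 b') (tH 0 1 0 0 g') (\<lambda>z w. Q (x \<otimes>\<otimes> y) (z \<otimes>\<otimes> w)))"
    using mem by (intro P_cong mE_form) (simp_all add: lin_E Ql)
  finally show ?thesis .
qed

lemma linear_eq_T:
  assumes "linear_map T T f" "linear_map T T g" "x \<in> vcarrier T"
    and "\<And>a h. a \<in> vcarrier D \<Longrightarrow> h \<in> vcarrier H \<Longrightarrow> f (a \<otimes>\<otimes> h) = g (a \<otimes>\<otimes> h)"
  shows "f x = g x"
proof (rule tensor_eqI[OF spaces(1,2)])
  show "f x \<in> vcarrier T" "g x \<in> vcarrier T"
    using assms linear_map_closed by blast+
  fix B
  show "f x B = g x B"
    by (rule linear_forms_eq_on_tensors[OF spaces(1,2) linear_form_eval[OF assms(1)] linear_form_eval[OF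
        assms(2)] assms(3)])
      (simp add: assms(4))
qed

text \<open>On pure tensors this is the naturality of the smash product together with the commutation of all
  twists; linearity in both arguments extends it.\<close>
lemma tE_mult:
  assumes x: "x \<in> vcarrier T" and y: "y \<in> vcarrier T"
  shows "tE i j k l (x \<diamondop> y) = tE i j k l x \<diamondop> tE i j k l y"
proof -
  have pure: "tE i j k l ((a \<otimes>\<otimes> h) \<diamondop> (b \<otimes>\<otimes> g)) = tE i j k l (a \<otimes>\<otimes> h) \<diamondop> tE i j k l (b \<otimes>\<otimes> g)"
    if mem: "a \<in> vcarrier D" "h \<in> vcarrier H" "b \<in> vcarrier D" "g \<in> vcarrier H" for a h b g
  proof (rule tensor_eqI[OF spaces(1,2)])
    fix B assume B: "bilinear_map D H ground B"
    have "P (tD i j k l (tD 1 0 0 0 a)) (tH i j k l (tH 1 0 0 0 h)) (tD i j k l (tD 0 1 0 0 b)) (tH i j k l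
        (tH 0 1 0 0 g)) B =
      P (tD 1 0 0 0 a) (tH 1 0 0 0 h) (tD 0 1 0 0 b) (tH 0 1 0 0 g) (\<lambda>x y. B (tD i j k l x) (tH i j k l y))"
      using mem by (intro P_twist B) (simp_all add: carrier)
    then show "tE i j k l ((a \<otimes>\<otimes> h) \<diamondop> (b \<otimes>\<otimes> g)) B = (tE i j k l (a \<otimes>\<otimes> h) \<diamondop> tE i j k l (b \<otimes>\<otimes> g)) B"
      using mem B
      by (simp add: tE_eval mE_closed tens_closed tE_tens mE_tens bilinear_twist carrier twist_twist
          H.twist_twist add.commute)
  qed (use mem in \<open>simp_all add: lin_E\<close>)
  have "tE i j k l ((a \<otimes>\<otimes> h) \<diamondop> y) = tE i j k l (a \<otimes>\<otimes> h) \<diamondop> tE i j k l y"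
    if mem: "a \<in> vcarrier D" "h \<in> vcarrier H" for a h
    by (rule linear_eq_T[of _ _ y]) (use mem y in \<open>simp_all add: lin_E pure\<close>)
  note 1 = this
  show ?thesis
    by (rule linear_eq_T[of "\<lambda>x. tE i j k l (x \<diamondop> y)" "\<lambda>x. tE i j k l x \<diamondop> tE i j k l y" x]) (use x y in \<open>simp_all
        add: lin_E 1\<close>)
qed

text \<open>On pure tensors both sides are iterated smash products of \<open>\<alpha>\<^sup>2(a), \<alpha>\<^sup>2(h)\<close>, \<open>\<alpha>\<beta>(b), \<alpha>\<beta>(g)\<close> and
  \<open>\<beta>\<^sup>2(c), \<beta>\<^sup>2(k)\<close>: naturality moves the outer \<open>\<beta>\<close>, respectively \<open>\<alpha>\<close>, from the inner product to its
  factors. Ordinary associativity does the rest.\<close>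
lemma mE_assoc:
  assumes x: "x \<in> vcarrier T" and y: "y \<in> vcarrier T" and z: "z \<in> vcarrier T"
  shows "tE 1 0 0 0 x \<diamondop> (y \<diamondop> z) = (x \<diamondop> y) \<diamondop> tE 0 1 0 0 z"
proof -
  have pure: "tE 1 0 0 0 (a \<otimes>\<otimes> h) \<diamondop> ((b \<otimes>\<otimes> g) \<diamondop> (c \<otimes>\<otimes> k)) = ((a \<otimes>\<otimes> h) \<diamondop> (b \<otimes>\<otimes> g)) \<diamondop> tE 0 1 0 0 (c \<otimes>\<otimes> k)"
    if mem: "a \<in> vcarrier D" "h \<in> vcarrier H" "b \<in> vcarrier D" "g \<in> vcarrier H" "c \<in> vcarrier D" "k \<in> vcarrier H"
    for a h b g c k
  proof (rule tensor_eqI[OF spaces(1,2)])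
    fix B assume B: "bilinear_map D H ground B"
    note Bl = bilinear_lin[OF B]
    have "(tE 1 0 0 0 (a \<otimes>\<otimes> h) \<diamondop> ((b \<otimes>\<otimes> g) \<diamondop> (c \<otimes>\<otimes> k))) B =
      P (tD 1 0 0 0 b) (tH 1 0 0 0 g) (tD 0 1 0 0 c) (tH 0 1 0 0 k) (\<lambda>x y.
        (tE 1 0 0 0 (a \<otimes>\<otimes> h) \<diamondop> (x \<otimes>\<otimes> y)) B)"
      by (rule mE_form[where L = "\<lambda>z. (tE 1 0 0 0 (a \<otimes>\<otimes> h) \<diamondop> z) B"])
        (use mem in \<open>simp_all add: lin_E mE_eval_lin\<close>)
    also have "\<dots> = P (tD 1 0 0 0 b) (tH 1 0 0 0 g) (tD 0 1 0 0 c) (tH 0 1 0 0 k) (\<lambda>x y.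
        P (tD 2 0 0 0 a) (tH 2 0 0 0 h) (tD 0 1 0 0 x) (tH 0 1 0 0 y) B)"
      by (rule P_cong) (use mem B in \<open>simp_all add: tE_tens mE_tens carrier twist_twist H.twist_twist\<close>)
    also have "\<dots> = P (tD 0 1 0 0 (tD 1 0 0 0 b)) (tH 0 1 0 0 (tH 1 0 0 0 g)) (tD 0 1 0 0 (tD 0 1 0 0 c))
        (tH 0 1 0 0 (tH 0 1 0 0 k)) (\<lambda>x y.
        P (tD 2 0 0 0 a) (tH 2 0 0 0 h) x y B)"
      by (rule P_twist[symmetric]) (use mem in \<open>simp_all add: lin_PC Bl\<close>)
    also have "\<dots> = P (tD 2 0 0 0 a) (tH 2 0 0 0 h) (tD 1 1 0 0 b) (tH 1 1 0 0 g) (\<lambda>x y. P x y (tD 0 2 0 0 c)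
        (tH 0 2 0 0 k) B)"
      by (subst U.smash_assoc[OF B]) (use mem in \<open>simp_all add: carrier twist_twist H.twist_twist\<close>)
    also have "\<dots> = P (tD 1 0 0 0 (tD 1 0 0 0 a)) (tH 1 0 0 0 (tH 1 0 0 0 h)) (tD 1 0 0 0 (tD 0 1 0 0 b))
        (tH 1 0 0 0 (tH 0 1 0 0 g)) (\<lambda>x y. P x y (tD 0 2 0 0 c) (tH 0 2 0 0 k) B)"
      using mem by (simp add: twist_twist H.twist_twist)
    also have "\<dots> = P (tD 1 0 0 0 a) (tH 1 0 0 0 h) (tD 0 1 0 0 b) (tH 0 1 0 0 g) (\<lambda>x y.
        P (tD 1 0 0 0 x) (tH 1 0 0 0 y) (tD 0 2 0 0 c) (tH 0 2 0 0 k) B)"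
      by (rule P_twist) (use mem in \<open>simp_all add: lin_PC Bl\<close>)
    also have "\<dots> = P (tD 1 0 0 0 a) (tH 1 0 0 0 h) (tD 0 1 0 0 b) (tH 0 1 0 0 g) (\<lambda>x y.
        ((x \<otimes>\<otimes> y) \<diamondop> tE 0 1 0 0 (c \<otimes>\<otimes> k)) B)"
      by (rule P_cong) (use mem B in \<open>simp_all add: tE_tens mE_tens carrier twist_twist H.twist_twist\<close>)
    also have "\<dots> = (((a \<otimes>\<otimes> h) \<diamondop> (b \<otimes>\<otimes> g)) \<diamondop> tE 0 1 0 0 (c \<otimes>\<otimes> k)) B"
      by (rule mE_form[where L = "\<lambda>z. (z \<diamondop> tE 0 1 0 0 (c \<otimes>\<otimes> k)) B", symmetric])
        (use mem in \<open>simp_all add: lin_E mE_eval_lin\<close>)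
    finally show "(tE 1 0 0 0 (a \<otimes>\<otimes> h) \<diamondop> ((b \<otimes>\<otimes> g) \<diamondop> (c \<otimes>\<otimes> k))) B = \<dots>" .
  qed (use mem in \<open>simp_all add: lin_E\<close>)
  have 1: "tE 1 0 0 0 (a \<otimes>\<otimes> h) \<diamondop> ((b \<otimes>\<otimes> g) \<diamondop> z) = ((a \<otimes>\<otimes> h) \<diamondop> (b \<otimes>\<otimes> g)) \<diamondop> tE 0 1 0 0 z"
    if mem: "a \<in> vcarrier D" "h \<in> vcarrier H" "b \<in> vcarrier D" "g \<in> vcarrier H" for a h b g
    by (rule linear_eq_T[of _ _ z]) (use mem z in \<open>simp_all add: lin_E pure\<close>)
  have 2: "tE 1 0 0 0 (a \<otimes>\<otimes> h) \<diamondop> (y \<diamondop> z) = ((a \<otimes>\<otimes> h) \<diamondop> y) \<diamondop> tE 0 1 0 0 z"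
    if mem: "a \<in> vcarrier D" "h \<in> vcarrier H" for a h
    by (rule linear_eq_T[of _ _ y]) (use mem y z in \<open>simp_all add: lin_E 1\<close>)
  show ?thesis
    by (rule linear_eq_T[of _ _ x]) (use x y z in \<open>simp_all add: lin_E 2\<close>)
qed

lemma mE_unit:
  assumes x: "x \<in> vcarrier T"
  shows "x \<diamondop> uE = tE 1 0 0 0 x" "uE \<diamondop> x = tE 0 1 0 0 x"
proof -
  have "(a \<otimes>\<otimes> h) \<diamondop> uE = tE 1 0 0 0 (a \<otimes>\<otimes> h)" "uE \<diamondop> (a \<otimes>\<otimes> h) = tE 0 1 0 0 (a \<otimes>\<otimes> h)"
    if mem: "a \<in> vcarrier D" "h \<in> vcarrier H" for a h
    by (rule tensor_eqI[OF spaces(1,2)];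
      use mem in \<open>simp add: tens_closed tE_closed mE_closed carrier mE_tens U.smash_one natural tE_tens tens_eval\<close>)+
  note pure = this
  show "x \<diamondop> uE = tE 1 0 0 0 x"
    by (rule linear_eq_T[of "\<lambda>x. x \<diamondop> uE" "tE 1 0 0 0" x]) (use x in \<open>simp_all add: lin_E tE_linear pure\<close>)
  show "uE \<diamondop> x = tE 0 1 0 0 x"
    by (rule linear_eq_T[of "\<lambda>x. uE \<diamondop> x" "tE 0 1 0 0" x]) (use x in \<open>simp_all add: lin_E tE_linear pure\<close>)
qed

lemma bihom_algebra_E: "bihom_algebra E"
  by unfold_locales
    (simp_all add: E_simps E_tensor E_struct E_unit E_aut mE_bilinear lin_E tE_aut commute_on_def tE_tE tE_mult
        tE_tens
      natural mE_unit mE_assoc)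

lemma sE_tE:
  assumes Q: "bilinear_map T T ground Q" and x: "x \<in> vcarrier T"
  shows "sE (tE i j k l x) Q = sE x (\<lambda>x1 x2. Q (tE i j k l x1) (tE i j k l x2))"
proof (rule linear_forms_eq_on_tensors[OF spaces(1,2) _ _ x])
  note Ql = bilinear_lin[OF Q]
  show "linear_map T ground (\<lambda>x. sE (tE i j k l x) Q)"
    "linear_map T ground (\<lambda>x. sE x (\<lambda>x1 x2. Q (tE i j k l x1) (tE i j k l x2)))"
    by (simp_all add: lin_E Ql)
  fix c h assume mem: "c \<in> vcarrier D" "h \<in> vcarrier H"
  have "sE (tE i j k l (c \<otimes>\<otimes> h)) Q = C (tD i j k l c) (tH i j k l h)
      (\<lambda>d k d' k'. Q (tD 0 0 1 0 d \<otimes>\<otimes> tH 0 0 1 0 k) (tD 0 0 0 1 d' \<otimes>\<otimes> tH 0 0 0 1 k'))"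
    using mem Q by (simp add: tE_tens sE_tens carrier)
  also have "\<dots> = C c h (\<lambda>d e d' e'. Q (tD 0 0 1 0 (tD i j k l d) \<otimes>\<otimes> tH 0 0 1 0 (tH i j k l e))
      (tD 0 0 0 1 (tD i j k l d') \<otimes>\<otimes> tH 0 0 0 1 (tH i j k l e')))"
    by (rule C_twist) (use mem in \<open>simp_all add: lin_E Ql\<close>)
  also have "\<dots> = C c h (\<lambda>d e d' e'. Q (tE i j k l (tD 0 0 1 0 d \<otimes>\<otimes> tH 0 0 1 0 e))
      (tE i j k l (tD 0 0 0 1 d' \<otimes>\<otimes> tH 0 0 0 1 e')))"
    by (rule C_cong) (simp add: tE_tens carrier twist_twist H.twist_twist add.commute)
  also have "\<dots> = sE (c \<otimes>\<otimes> h) (\<lambda>x1 x2. Q (tE i j k l x1) (tE i j k l x2))"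
    by (rule sE_tens[symmetric]) (use mem in \<open>simp_all add: lin_E Ql\<close>)
  finally show "sE (tE i j k l (c \<otimes>\<otimes> h)) Q = \<dots>" .
qed

lemma eE_tE: "x \<in> vcarrier T \<Longrightarrow> eE (tE i j k l x) = eE x"
  by (rule linear_forms_eq_on_tensors[where f = "\<lambda>x. eE (tE i j k l x)" and g = eE, OF spaces(1,2)])
    (simp_all add: lin_E eE_linear tE_tens eE_tens natural)

lemma sE_counit:
  assumes B: "bilinear_map D H ground B" and x: "x \<in> vcarrier T"
  shows "sE x (\<lambda>x1 x2. eE x2 * x1 B) = x (\<lambda>d h. B (tD 0 0 1 0 d) (tH 0 0 1 0 h))"
    and "sE x (\<lambda>x1 x2. eE x1 * x2 B) = x (\<lambda>d h. B (tD 0 0 0 1 d) (tH 0 0 0 1 h))"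
proof -
  note Bl = bilinear_lin[OF B]
  have lB: "linear_map T ground (\<lambda>x. x B)" for B
    by (rule linear_form_eval[OF linear_map_id])
  have l: "linear_map T ground (\<lambda>x. sE x (\<lambda>x1 x2. eE x2 * x1 B))"
    "linear_map T ground (\<lambda>x. sE x (\<lambda>x1 x2. eE x1 * x2 B))"
    "bilinear_map T T ground (\<lambda>x1 x2. eE x2 * x1 B)" "bilinear_map T T ground (\<lambda>x1 x2. eE x1 * x2 B)"
    by (simp_all add: lin_E lB eE_linear)
  have B': "bilinear_map D H ground (\<lambda>d h. B (tD i j k l d) (tH i j k l h))" for i j k l
    by (rule bilinear_twist[OF B])
  have "sE (c \<otimes>\<otimes> h) (\<lambda>x1 x2. eE x2 * x1 B) = B (tD 0 0 1 0 c) (tH 0 0 1 0 h)"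
    "sE (c \<otimes>\<otimes> h) (\<lambda>x1 x2. eE x1 * x2 B) = B (tD 0 0 0 1 c) (tH 0 0 0 1 h)"
    if mem: "c \<in> vcarrier D" "h \<in> vcarrier H" for c h
  proof -
    have "sE (c \<otimes>\<otimes> h) (\<lambda>x1 x2. eE x2 * x1 B) =
        C c h (\<lambda>d k d' k'. B (tD 0 0 1 0 d) (tH 0 0 1 0 k) * (\<epsilon>\<^bsub>D\<^esub> d' * \<epsilon>\<^bsub>H\<^esub> k'))"
      unfolding sE_tens[OF mem l(3)]
      by (rule C_cong) (simp add: eE_tens carrier natural tens_eval[OF B])
    then show "sE (c \<otimes>\<otimes> h) (\<lambda>x1 x2. eE x2 * x1 B) = B (tD 0 0 1 0 c) (tH 0 0 1 0 h)"
      by (simp add: U.cosmash_counit(1)[OF B' mem])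
    have "sE (c \<otimes>\<otimes> h) (\<lambda>x1 x2. eE x1 * x2 B) =
        C c h (\<lambda>d k d' k'. \<epsilon>\<^bsub>D\<^esub> d * \<epsilon>\<^bsub>H\<^esub> k * B (tD 0 0 0 1 d') (tH 0 0 0 1 k'))"
      unfolding sE_tens[OF mem l(4)]
      by (rule C_cong) (simp add: eE_tens carrier natural tens_eval[OF B])
    then show "sE (c \<otimes>\<otimes> h) (\<lambda>x1 x2. eE x1 * x2 B) = B (tD 0 0 0 1 c) (tH 0 0 0 1 h)"
      by (simp add: U.cosmash_counit(2)[OF B' mem])
  qed
  note pure = this
  show "sE x (\<lambda>x1 x2. eE x2 * x1 B) = x (\<lambda>d h. B (tD 0 0 1 0 d) (tH 0 0 1 0 h))"
    by (rule linear_forms_eq_on_tensors[OF spaces(1,2) l(1) lB x]) (simp add: tens_eval B' pure)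
  show "sE x (\<lambda>x1 x2. eE x1 * x2 B) = x (\<lambda>d h. B (tD 0 0 0 1 d) (tH 0 0 0 1 h))"
    by (rule linear_forms_eq_on_tensors[OF spaces(1,2) l(2) lB x]) (simp add: tens_eval B' pure)
qed

text \<open>Both sides become an ordinary iterated coproduct whose three factors carry the twists \<open>\<omega>\<^sup>2\<close>, \<open>\<omega>\<psi>\<close>
  and \<open>\<psi>\<^sup>2\<close>, by naturality of the inner coproduct.\<close>
lemma sE_coassoc:
  assumes K: "trilinear_form T T T K" and x: "x \<in> vcarrier T"
  shows "sE x (\<lambda>x1 x2. sE x2 (\<lambda>y z. K (tE 0 0 1 0 x1) y z)) =
    sE x (\<lambda>x1 x2. sE x1 (\<lambda>y z. K y z (tE 0 0 0 1 x2)))"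
proof (rule linear_forms_eq_on_tensors[where f = "\<lambda>x. sE x (\<lambda>x1 x2. sE x2 (\<lambda>y z. K (tE 0 0 1 0 x1) y z))"
    and g = "\<lambda>x. sE x (\<lambda>x1 x2. sE x1 (\<lambda>y z. K y z (tE 0 0 0 1 x2)))", OF spaces(1,2) _ _ x])
  note Kl = trilinear_lin[OF K]
  show "linear_map T ground (\<lambda>x. sE x (\<lambda>x1 x2. sE x2 (\<lambda>y z. K (tE 0 0 1 0 x1) y z)))"
    "linear_map T ground (\<lambda>x. sE x (\<lambda>x1 x2. sE x1 (\<lambda>y z. K y z (tE 0 0 0 1 x2))))"
    by (simp_all add: lin_E Kl)
  fix c h assume mem: "c \<in> vcarrier D" "h \<in> vcarrier H"
  let ?F = "\<lambda>d k e l e' l'. K (tD 0 0 2 0 d \<otimes>\<otimes> tH 0 0 2 0 k) (tD 0 0 1 1 e \<otimes>\<otimes> tH 0 0 1 1 l)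
     (tD 0 0 0 2 e' \<otimes>\<otimes> tH 0 0 0 2 l')"
  have F: "sexalinear_form D H D H D H ?F"
    by (simp add: lin_E Kl)
  have "sE (c \<otimes>\<otimes> h) (\<lambda>x1 x2. sE x2 (\<lambda>y z. K (tE 0 0 1 0 x1) y z)) =
    C c h (\<lambda>d k d' k'. sE (tD 0 0 0 1 d' \<otimes>\<otimes> tH 0 0 0 1 k')
      (\<lambda>y z. K (tE 0 0 1 0 (tD 0 0 1 0 d \<otimes>\<otimes> tH 0 0 1 0 k)) y z))"
    by (rule sE_tens) (use mem in \<open>simp_all add: lin_E Kl\<close>)
  also have "\<dots> = C c h (\<lambda>d k d' k'. C d' k' (\<lambda>e l e' l'. ?F d k e l e' l'))"
  proof (rule C_cong)
    fix d k d' k' assume m: "d \<in> vcarrier D" "k \<in> vcarrier H" "d' \<in> vcarrier D" "k' \<in> vcarrier H"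
    have "sE (tD 0 0 0 1 d' \<otimes>\<otimes> tH 0 0 0 1 k') (\<lambda>y z. K (tE 0 0 1 0 (tD 0 0 1 0 d \<otimes>\<otimes> tH 0 0 1 0 k)) y z) =
      C (tD 0 0 0 1 d') (tH 0 0 0 1 k') (\<lambda>e l e' l'. K (tD 0 0 2 0 d \<otimes>\<otimes> tH 0 0 2 0 k)
        (tD 0 0 1 0 e \<otimes>\<otimes> tH 0 0 1 0 l) (tD 0 0 0 1 e' \<otimes>\<otimes> tH 0 0 0 1 l'))"
      using m by (subst sE_tens) (simp_all add: lin_E Kl tE_tens twist_twist H.twist_twist)
    also have "\<dots> = C d' k' (\<lambda>e l e' l'. K (tD 0 0 2 0 d \<otimes>\<otimes> tH 0 0 2 0 k)
        (tD 0 0 1 0 (tD 0 0 0 1 e) \<otimes>\<otimes> tH 0 0 1 0 (tH 0 0 0 1 l)) (tD 0 0 0 1 (tD 0 0 0 1 e') \<otimes>\<otimes> tH 0 0 0 1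
            (tH 0 0 0 1 l')))"
      by (rule C_twist) (use m in \<open>simp_all add: lin_E Kl\<close>)
    also have "\<dots> = C d' k' (\<lambda>e l e' l'. ?F d k e l e' l')"
      by (rule C_cong) (simp add: twist_twist H.twist_twist)
    finally show "sE (tD 0 0 0 1 d' \<otimes>\<otimes> tH 0 0 0 1 k') (\<lambda>y z. K (tE 0 0 1 0 (tD 0 0 1 0 d \<otimes>\<otimes> tH 0 0 1 0 k)) y z) = \<dots>" .
  qed
  also have "\<dots> = C c h (\<lambda>d k d' k'. C d k (\<lambda>e l e' l'. ?F e l e' l' d' k'))"
    by (rule U.cosmash_coassoc[OF F mem, symmetric])
  also have "\<dots> = C c h (\<lambda>d k d' k'. sE (tD 0 0 1 0 d \<otimes>\<otimes> tH 0 0 1 0 k)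
      (\<lambda>y z. K y z (tE 0 0 0 1 (tD 0 0 0 1 d' \<otimes>\<otimes> tH 0 0 0 1 k'))))"
  proof (rule C_cong)
    fix d k d' k' assume m: "d \<in> vcarrier D" "k \<in> vcarrier H" "d' \<in> vcarrier D" "k' \<in> vcarrier H"
    have "sE (tD 0 0 1 0 d \<otimes>\<otimes> tH 0 0 1 0 k) (\<lambda>y z. K y z (tE 0 0 0 1 (tD 0 0 0 1 d' \<otimes>\<otimes> tH 0 0 0 1 k'))) =
      C (tD 0 0 1 0 d) (tH 0 0 1 0 k) (\<lambda>e l e' l'. K (tD 0 0 1 0 e \<otimes>\<otimes> tH 0 0 1 0 l)
        (tD 0 0 0 1 e' \<otimes>\<otimes> tH 0 0 0 1 l') (tD 0 0 0 2 d' \<otimes>\<otimes> tH 0 0 0 2 k'))"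
      using m by (subst sE_tens) (simp_all add: lin_E Kl tE_tens twist_twist H.twist_twist)
    also have "\<dots> = C d k (\<lambda>e l e' l'. K (tD 0 0 1 0 (tD 0 0 1 0 e) \<otimes>\<otimes> tH 0 0 1 0 (tH 0 0 1 0 l))
        (tD 0 0 0 1 (tD 0 0 1 0 e') \<otimes>\<otimes> tH 0 0 0 1 (tH 0 0 1 0 l')) (tD 0 0 0 2 d' \<otimes>\<otimes> tH 0 0 0 2 k'))"
      by (rule C_twist) (use m in \<open>simp_all add: lin_E Kl\<close>)
    also have "\<dots> = C d k (\<lambda>e l e' l'. ?F e l e' l' d' k')"
      by (rule C_cong) (simp add: twist_twist H.twist_twist)
    finally show "C d k (\<lambda>e l e' l'. ?F e l e' l' d' k') = sE (tD 0 0 1 0 d \<otimes>\<otimes> tH 0 0 1 0 k)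
      (\<lambda>y z. K y z (tE 0 0 0 1 (tD 0 0 0 1 d' \<otimes>\<otimes> tH 0 0 0 1 k')))" by simp
  qed
  also have "\<dots> = sE (c \<otimes>\<otimes> h) (\<lambda>x1 x2. sE x1 (\<lambda>y z. K y z (tE 0 0 0 1 x2)))"
    by (rule sE_tens[symmetric]) (use mem in \<open>simp_all add: lin_E Kl\<close>)
  finally show "sE (c \<otimes>\<otimes> h) (\<lambda>x1 x2. sE x2 (\<lambda>y z. K (tE 0 0 1 0 x1) y z)) = \<dots>" .
qed

text \<open>On pure tensors both sides are rewritten to ordinary products and coproducts, to which
  \<open>cosmash_smash\<close> applies. The twists \<open>\<alpha>, \<beta>\<close> of the product are moved through the coproduct and the
  twists \<open>\<omega>, \<psi>\<close> of the coproduct through the product, both by naturality.\<close>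
lemma sE_mult:
  assumes Q: "bilinear_map T T ground Q" and x: "x \<in> vcarrier T" and y: "y \<in> vcarrier T"
  shows "sE (x \<diamondop> y) Q = sE x (\<lambda>x1 x2. sE y (\<lambda>y1 y2. Q (x1 \<diamondop> y1) (x2 \<diamondop> y2)))"
proof -
  note Ql = bilinear_lin[OF Q]
  let ?F = "\<lambda>d k d' k'. Q (tD 0 0 1 0 d \<otimes>\<otimes> tH 0 0 1 0 k) (tD 0 0 0 1 d' \<otimes>\<otimes> tH 0 0 0 1 k')"
  have F: "quadrilinear_form D H D H ?F"
    by (simp add: lin_E Ql)
  have pure: "sE ((a \<otimes>\<otimes> h) \<diamondop> (b \<otimes>\<otimes> g)) Q =
      sE (a \<otimes>\<otimes> h) (\<lambda>x1 x2. sE (b \<otimes>\<otimes> g) (\<lambda>y1 y2. Q (x1 \<diamondop> y1) (x2 \<diamondop> y2)))"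
    if mem: "a \<in> vcarrier D" "h \<in> vcarrier H" "b \<in> vcarrier D" "g \<in> vcarrier H" for a h b g
  proof -
    have "sE ((a \<otimes>\<otimes> h) \<diamondop> (b \<otimes>\<otimes> g)) Q =
      P (tD 1 0 0 0 a) (tH 1 0 0 0 h) (tD 0 1 0 0 b) (tH 0 1 0 0 g) (\<lambda>c k. sE (c \<otimes>\<otimes> k) Q)"
      by (rule mE_form[OF _ mem]) (simp add: lin_E Ql)
    also have "\<dots> = P (tD 1 0 0 0 a) (tH 1 0 0 0 h) (tD 0 1 0 0 b) (tH 0 1 0 0 g) (\<lambda>c k. C c k ?F)"
      by (rule P_cong) (use mem Q in \<open>simp_all add: carrier sE_tens\<close>)
    also have "\<dots> = C (tD 1 0 0 0 a) (tH 1 0 0 0 h) (\<lambda>a' h' a'' h''. C (tD 0 1 0 0 b) (tH 0 1 0 0 g) (\<lambda>b' g' b'' g''.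
        P a' h' b' g' (\<lambda>x y. P a'' h'' b'' g'' (\<lambda>z w. ?F x y z w))))"
      by (rule U.cosmash_smash[OF F]) (use mem in \<open>simp_all add: carrier\<close>)
    also have "\<dots> = C a h (\<lambda>a' h' a'' h''. C (tD 0 1 0 0 b) (tH 0 1 0 0 g) (\<lambda>b' g' b'' g''.
        P (tD 1 0 0 0 a') (tH 1 0 0 0 h') b' g' (\<lambda>x y. P (tD 1 0 0 0 a'') (tH 1 0 0 0 h'') b'' g'' (\<lambda>z w. ?F x y
            z w))))"
      by (rule C_twist) (use mem in \<open>simp_all add: lin_PC Ql\<close>)
    also have "\<dots> = C a h (\<lambda>a' h' a'' h''. C b g (\<lambda>b' g' b'' g''.
        Q ((tD 0 0 1 0 a' \<otimes>\<otimes> tH 0 0 1 0 h') \<diamondop> (tD 0 0 1 0 b' \<otimes>\<otimes> tH 0 0 1 0 g'))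
          ((tD 0 0 0 1 a'' \<otimes>\<otimes> tH 0 0 0 1 h'') \<diamondop> (tD 0 0 0 1 b'' \<otimes>\<otimes> tH 0 0 0 1 g''))))"
    proof (rule C_cong)
      fix a' h' a'' h'' assume m: "a' \<in> vcarrier D" "h' \<in> vcarrier H" "a'' \<in> vcarrier D" "h'' \<in> vcarrier H"
      have "C (tD 0 1 0 0 b) (tH 0 1 0 0 g) (\<lambda>b' g' b'' g''.
        P (tD 1 0 0 0 a') (tH 1 0 0 0 h') b' g' (\<lambda>x y. P (tD 1 0 0 0 a'') (tH 1 0 0 0 h'') b'' g'' (\<lambda>z w. ?F x y
            z w))) =
        C b g (\<lambda>b' g' b'' g''. P (tD 1 0 0 0 a') (tH 1 0 0 0 h') (tD 0 1 0 0 b') (tH 0 1 0 0 g') (\<lambda>x y.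
          P (tD 1 0 0 0 a'') (tH 1 0 0 0 h'') (tD 0 1 0 0 b'') (tH 0 1 0 0 g'') (\<lambda>z w. ?F x y z w)))"
        by (rule C_twist) (use m mem in \<open>simp_all add: lin_PC Ql\<close>)
      also have "\<dots> = C b g (\<lambda>b' g' b'' g''.
        Q ((tD 0 0 1 0 a' \<otimes>\<otimes> tH 0 0 1 0 h') \<diamondop> (tD 0 0 1 0 b' \<otimes>\<otimes> tH 0 0 1 0 g'))
          ((tD 0 0 0 1 a'' \<otimes>\<otimes> tH 0 0 0 1 h'') \<diamondop> (tD 0 0 0 1 b'' \<otimes>\<otimes> tH 0 0 0 1 g'')))"
      proof (rule C_cong)
        fix b' g' b'' g'' assume m': "b' \<in> vcarrier D" "g' \<in> vcarrier H" "b'' \<in> vcarrier D" "g'' \<in> vcarrier H"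
        note mm = m m'
        have "P (tD 1 0 0 0 a') (tH 1 0 0 0 h') (tD 0 1 0 0 b') (tH 0 1 0 0 g') (\<lambda>x y.
            P (tD 1 0 0 0 a'') (tH 1 0 0 0 h'') (tD 0 1 0 0 b'') (tH 0 1 0 0 g'') (\<lambda>z w. ?F x y z w)) =
          P (tD 1 0 0 0 a') (tH 1 0 0 0 h') (tD 0 1 0 0 b') (tH 0 1 0 0 g') (\<lambda>x y.
            P (tD 0 0 0 1 (tD 1 0 0 0 a'')) (tH 0 0 0 1 (tH 1 0 0 0 h'')) (tD 0 0 0 1 (tD 0 1 0 0 b''))
                (tH 0 0 0 1 (tH 0 1 0 0 g''))
              (\<lambda>z w. Q (tD 0 0 1 0 x \<otimes>\<otimes> tH 0 0 1 0 y) (z \<otimes>\<otimes> w)))"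
          by (intro P_cong P_twist[symmetric]) (use mm in \<open>simp_all add: lin_E Ql\<close>)
        also have "\<dots> = P (tD 0 0 1 0 (tD 1 0 0 0 a')) (tH 0 0 1 0 (tH 1 0 0 0 h')) (tD 0 0 1 0 (tD 0 1 0 0 b'))
            (tH 0 0 1 0 (tH 0 1 0 0 g')) (\<lambda>x y.
            P (tD 0 0 0 1 (tD 1 0 0 0 a'')) (tH 0 0 0 1 (tH 1 0 0 0 h'')) (tD 0 0 0 1 (tD 0 1 0 0 b''))
                (tH 0 0 0 1 (tH 0 1 0 0 g''))
              (\<lambda>z w. Q (x \<otimes>\<otimes> y) (z \<otimes>\<otimes> w)))"
          by (rule P_twist[symmetric]) (use mm in \<open>simp_all add: lin_PC Ql\<close>)
        also have "\<dots> = Q ((tD 0 0 1 0 a' \<otimes>\<otimes> tH 0 0 1 0 h') \<diamondop> (tD 0 0 1 0 b' \<otimes>\<otimes> tH 0 0 1 0 g'))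
          ((tD 0 0 0 1 a'' \<otimes>\<otimes> tH 0 0 0 1 h'') \<diamondop> (tD 0 0 0 1 b'' \<otimes>\<otimes> tH 0 0 0 1 g''))"
          using mm by (simp add: mE_form2[OF Q] carrier twist_twist H.twist_twist)
        finally show "P (tD 1 0 0 0 a') (tH 1 0 0 0 h') (tD 0 1 0 0 b') (tH 0 1 0 0 g') (\<lambda>x y.
            P (tD 1 0 0 0 a'') (tH 1 0 0 0 h'') (tD 0 1 0 0 b'') (tH 0 1 0 0 g'') (\<lambda>z w. ?F x y z w)) = \<dots>" .
      qed
      finally show "C (tD 0 1 0 0 b) (tH 0 1 0 0 g) (\<lambda>b' g' b'' g''.
        P (tD 1 0 0 0 a') (tH 1 0 0 0 h') b' g' (\<lambda>x y. P (tD 1 0 0 0 a'') (tH 1 0 0 0 h'') b'' g'' (\<lambda>z w. ?F x y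
            z w))) = \<dots>" .
    qed
    also have "\<dots> = C a h (\<lambda>a' h' a'' h''. sE (b \<otimes>\<otimes> g) (\<lambda>y1 y2.
        Q ((tD 0 0 1 0 a' \<otimes>\<otimes> tH 0 0 1 0 h') \<diamondop> y1) ((tD 0 0 0 1 a'' \<otimes>\<otimes> tH 0 0 0 1 h'') \<diamondop> y2)))"
      by (intro C_cong sE_tens[symmetric]) (use mem in \<open>simp_all add: lin_E Ql\<close>)
    also have "\<dots> = sE (a \<otimes>\<otimes> h) (\<lambda>x1 x2. sE (b \<otimes>\<otimes> g) (\<lambda>y1 y2. Q (x1 \<diamondop> y1) (x2 \<diamondop> y2)))"
      by (rule sE_tens[symmetric]) (use mem in \<open>simp_all add: lin_E Ql\<close>)
    finally show ?thesis .
  qed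
  have 1: "sE ((a \<otimes>\<otimes> h) \<diamondop> y) Q = sE (a \<otimes>\<otimes> h) (\<lambda>x1 x2. sE y (\<lambda>y1 y2. Q (x1 \<diamondop> y1) (x2 \<diamondop> y2)))"
    if mem: "a \<in> vcarrier D" "h \<in> vcarrier H" for a h
    by (rule linear_forms_eq_on_tensors[where f = "\<lambda>y. sE ((a \<otimes>\<otimes> h) \<diamondop> y) Q"
        and g = "\<lambda>y. sE (a \<otimes>\<otimes> h) (\<lambda>x1 x2. sE y (\<lambda>y1 y2. Q (x1 \<diamondop> y1) (x2 \<diamondop> y2)))",
        OF spaces(1,2) _ _ y]) (use mem in \<open>simp_all add: lin_E Ql pure\<close>)
  show ?thesis
    by (rule linear_forms_eq_on_tensors[where f = "\<lambda>x. sE (x \<diamondop> y) Q"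
        and g = "\<lambda>x. sE x (\<lambda>x1 x2. sE y (\<lambda>y1 y2. Q (x1 \<diamondop> y1) (x2 \<diamondop> y2)))",
        OF spaces(1,2) _ _ x]) (use y in \<open>simp_all add: lin_E Ql 1\<close>)
qed

lemma cE_tE:
  assumes x: "x \<in> vcarrier T"
  shows "cE (tE i j k l x) = tensor_lift T T (cE x) (\<lambda>x1 x2. tens T T (tE i j k l x1) (tE i j k l x2))"
proof (rule tensor_eqI[OF spaces(3,3)])
  fix Q assume Q: "bilinear_map T T ground Q"
  show "cE (tE i j k l x) Q = tensor_lift T T (cE x) (\<lambda>x1 x2. tens T T (tE i j k l x1) (tE i j k l x2)) Q"
    using sE_tE[OF Q x] x by (simp add: sE_eval[OF _ Q] tE_closed tensor_lift_eval spaces cE_closed tens_eval[OF Q])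
qed (use x in \<open>auto intro!: tensor_lift_closed spaces tens_closed tE_closed cE_closed\<close>)

lemma cE_mult:
  assumes x: "x \<in> vcarrier T" and y: "y \<in> vcarrier T"
  shows "cE (x \<diamondop> y) = tensor_lift T T (cE x) (\<lambda>x1 x2. tensor_lift T T (cE y) (\<lambda>y1 y2.
    tens T T (x1 \<diamondop> y1) (x2 \<diamondop> y2)))"
proof (rule tensor_eqI[OF spaces(3,3)])
  fix Q assume Q: "bilinear_map T T ground Q"
  show "cE (x \<diamondop> y) Q = tensor_lift T T (cE x) (\<lambda>x1 x2. tensor_lift T T (cE y) (\<lambda>y1 y2.
    tens T T (x1 \<diamondop> y1) (x2 \<diamondop> y2))) Q"
    using sE_mult[OF Q x y] x y
    by (simp add: sE_eval[OF _ Q] mE_closed tensor_lift_eval spaces cE_closed tens_eval[OF Q])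
qed (use x y in \<open>auto intro!: tensor_lift_closed spaces tens_closed mE_closed cE_closed\<close>)

lemma cE_counit:
  assumes x: "x \<in> vcarrier T"
  shows "tensor_lift T T (cE x) (\<lambda>x1 x2. vscale T (eE x2) x1) = tE 0 0 1 0 x"
    and "tensor_lift T T (cE x) (\<lambda>x1 x2. vscale T (eE x1) x2) = tE 0 0 0 1 x"
proof -
  have sc: "vscale T r y B = r * y B" for r y B
    by (simp add: tensor_space_def tensor_scale_def)
  show "tensor_lift T T (cE x) (\<lambda>x1 x2. vscale T (eE x2) x1) = tE 0 0 1 0 x"
  proof (rule tensor_eqI[OF spaces(1,2)])
    fix B assume B: "bilinear_map D H ground B"
    show "tensor_lift T T (cE x) (\<lambda>x1 x2. vscale T (eE x2) x1) B = tE 0 0 1 0 x B"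
      using sE_counit(1)[OF B x] x by (simp add: tensor_lift_eval spaces cE_closed sc tE_eval B)
  qed (use x in \<open>auto intro!: tensor_lift_closed spaces vec_space_closed tE_closed cE_closed\<close>)
  show "tensor_lift T T (cE x) (\<lambda>x1 x2. vscale T (eE x1) x2) = tE 0 0 0 1 x"
  proof (rule tensor_eqI[OF spaces(1,2)])
    fix B assume B: "bilinear_map D H ground B"
    show "tensor_lift T T (cE x) (\<lambda>x1 x2. vscale T (eE x1) x2) B = tE 0 0 0 1 x B"
      using sE_counit(2)[OF B x] x by (simp add: tensor_lift_eval spaces cE_closed sc tE_eval B)
  qed (use x in \<open>auto intro!: tensor_lift_closed spaces vec_space_closed tE_closed cE_closed\<close>)
qed

lemma cE_coassoc:
  assumes x: "x \<in> vcarrier T"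
  shows "tensor_lift T T (cE x) (\<lambda>x1 x2. tens T (tensor_space T T) (tE 0 0 1 0 x1) (cE x2)) =
    tensor_lift T T (cE x) (\<lambda>x1 x2. tensor_lift T T (cE x1) (\<lambda>x11 x12.
      tens T (tensor_space T T) x11 (tens T T x12 (tE 0 0 0 1 x2))))"
proof (rule tensor_eqI[OF spaces(3,3)])
  fix G assume G: "bilinear_map T (tensor_space T T) ground G"
  note Gl = bilinear_lin[OF G]
  have K: "trilinear_form T T T (\<lambda>x y z. G x (tens T T y z))"
    by (simp add: lin_E Gl)
  have G2: "G y (cE z) = sE z (\<lambda>z1 z2. G y (tens T T z1 z2))" if "y \<in> vcarrier T" "z \<in> vcarrier T" for y z
  proof -
    have l: "linear_map (tensor_space T T) ground (G y)"
      using G that by (simp add: bilinear_map_def)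
    have b: "bilinear_map T T ground (\<lambda>z1 z2. G y (tens T T z1 z2))"
      by (rule bilinear_form_compose[OF l bilinear_tens])
    show ?thesis
      by (rule trans[OF linear_form_tensor[OF spaces(3,3) l cE_closed[OF that(2)]] sE_eval[OF that(2) b]])
  qed
  show "tensor_lift T T (cE x) (\<lambda>x1 x2. tens T (tensor_space T T) (tE 0 0 1 0 x1) (cE x2)) G =
    tensor_lift T T (cE x) (\<lambda>x1 x2. tensor_lift T T (cE x1) (\<lambda>x11 x12.
      tens T (tensor_space T T) x11 (tens T T x12 (tE 0 0 0 1 x2)))) G"
    using sE_coassoc[OF K x] x
    by (simp add: tensor_lift_eval spaces cE_closed tens_eval[OF G] G2 tE_closed)
qed (use x in \<open>auto intro!: tensor_lift_closed spaces tens_closed tE_closed cE_closed\<close>)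

lemma bihom_coalgebra_E: "bihom_coalgebra E"
  by unfold_locales
    (simp_all add: E_simps E_tensor2 E_tensor3 E_struct E_aut cE_linear eE_linear tE_aut commute_on_def tE_tE
        eE_tE cE_tE
      cE_counit cE_coassoc)

lemma eE_mult:
  assumes x: "x \<in> vcarrier T" and y: "y \<in> vcarrier T"
  shows "eE (x \<diamondop> y) = eE x * eE y"
proof -
  have pure: "eE ((a \<otimes>\<otimes> h) \<diamondop> (b \<otimes>\<otimes> g)) = eE (a \<otimes>\<otimes> h) * eE (b \<otimes>\<otimes> g)"
    if mem: "a \<in> vcarrier D" "h \<in> vcarrier H" "b \<in> vcarrier D" "g \<in> vcarrier H" for a h b g
  proof -
    have "eE ((a \<otimes>\<otimes> h) \<diamondop> (b \<otimes>\<otimes> g)) =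
      P (tD 1 0 0 0 a) (tH 1 0 0 0 h) (tD 0 1 0 0 b) (tH 0 1 0 0 g) (\<lambda>x y. eE (x \<otimes>\<otimes> y))"
      by (rule mE_form[OF eE_linear mem])
    also have "\<dots> = P (tD 1 0 0 0 a) (tH 1 0 0 0 h) (tD 0 1 0 0 b) (tH 0 1 0 0 g) (\<lambda>x y. \<epsilon>\<^bsub>D\<^esub> x * \<epsilon>\<^bsub>H\<^esub> y)"
      by (rule P_cong) (use mem in \<open>simp_all add: carrier eE_tens\<close>)
    also have "\<dots> = eE (a \<otimes>\<otimes> h) * eE (b \<otimes>\<otimes> g)"
      using mem by (simp add: U.smash_counit carrier natural eE_tens)
    finally show ?thesis .
  qed
  have 1: "eE ((a \<otimes>\<otimes> h) \<diamondop> y) = eE (a \<otimes>\<otimes> h) * eE y" if mem: "a \<in> vcarrier D" "h \<in> vcarrier H" for a h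
    by (rule linear_forms_eq_on_tensors[where f = "\<lambda>y. eE ((a \<otimes>\<otimes> h) \<diamondop> y)" and g = "\<lambda>y. eE (a \<otimes>\<otimes> h) * eE y",
        OF spaces(1,2) _ _ y]) (use mem in \<open>simp_all add: lin_E eE_linear pure\<close>)
  show ?thesis
    by (rule linear_forms_eq_on_tensors[where f = "\<lambda>x. eE (x \<diamondop> y)" and g = "\<lambda>x. eE x * eE y", OF spaces(1,2) _ _ x])
      (use y in \<open>simp_all add: lin_E eE_linear 1\<close>)
qed

lemma cE_unit: "cE uE = tens T T uE uE"
proof (rule tensor_eqI[OF spaces(3,3)])
  fix Q assume Q: "bilinear_map T T ground Q"
  have F: "quadrilinear_form D H D H (\<lambda>d k d' k'. Q (tD 0 0 1 0 d \<otimes>\<otimes> tH 0 0 1 0 k) (tD 0 0 0 1 d' \<otimes>\<otimes> tH 0 0 0 1 k'))"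
    by (simp add: lin_E bilinear_lin[OF Q])
  show "cE uE Q = tens T T uE uE Q"
    by (simp add: cE_tens carrier Q U.cosmash_one[OF F] tens_eval natural)
qed (auto intro!: spaces tens_closed cE_closed simp: carrier)

theorem bihom_bialgebra_E: "bihom_bialgebra E"
proof (intro bihom_bialgebra.intro bihom_structure_E bihom_algebra_E bihom_coalgebra_E bihom_bialgebra_axioms.intro)
  have coalg: "bihom_coalgebra_map E E (tE i j k l)" for i j k l
    by (simp add: bihom_coalgebra_map_def E_simps E_tensor2 E_tensor3 E_struct tE_linear tE_tE eE_tE cE_tE
        add.commute)
  show "bihom_coalgebra_map E E (balpha E)" "bihom_coalgebra_map E E (bbeta E)"
    by (simp_all add: E_struct coalg)
  have alg: "bihom_algebra_map E E (tE i j k l)" for i j k l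
    by (simp add: bihom_algebra_map_def E_simps E_struct E_unit tE_linear tE_tE tE_mult tE_tens carrier natural
        add.commute)
  show "bihom_algebra_map E E (bomega E)" "bihom_algebra_map E E (bpsi E)"
    by (simp_all add: E_struct alg)
qed (simp_all add: E_simps E_tensor2 E_tensor3 E_unit cE_mult eE_mult cE_unit eE_tens carrier H.counit_unit LR1_unit)

end

theorem theorem3p4:
  fixes H :: "('k::field, 'h::ab_group_add) bihom"
    and D :: "('k, 'd::ab_group_add) bihom"
    and lact :: "'h \<Rightarrow> 'd \<Rightarrow> 'd" and ract :: "'d \<Rightarrow> 'h \<Rightarrow> 'd"
    and \<rho>L :: "'d \<Rightarrow> ('k, 'h, 'd) tensor" and \<rho>R :: "'d \<Rightarrow> ('k, 'd, 'h) tensor"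
    and m n p q s t u v :: int
  assumes "bihom_bialgebra H"
    and "LR_admissible_pair H D lact ract \<rho>L \<rho>R m n p q s t u v"
  shows "bihom_bialgebra (LR_biproduct H D lact ract \<rho>L \<rho>R m n p q s t u v)"
  by (rule twisted_LR_pair.bihom_bialgebra_E[OF twisted_LR_pair.intro[OF assms]])

end
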